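(* Every convex parabolic polyhedron is parabolically infinitesimally rigid. That is, if $(P,G)$ is a convex parabolic polyhedron, then every parabolic deformation $Z$ of $\partial P$ is trivial.
   Context: A convex parabolic polyhedron in $\mathbb{H}^3$ is a pair $(P,G)$, where $P\subset\mathbb{H}^3$ is the convex hull of a discrete (non-empty) set of points, and $G$ is a discrete subgroup of $\mathrm{Iso}^+(\mathbb{H}^3)$ that acts freely and cocompactly on a horosphere in $\mathbb{H}^3$ and leaves $P$ invariant; the vertex set of $P$ is a union of finitely many orbits of $G$. The group $G$ has a unique fixed point $c\in\partial\overline{\mathbb{H}^3}$, called the center of $P$. A Killing field of $\mathbb{H}^3$ is a vector field whose local $1$-parameter group consists of isometries. An infinitesimal isometric deformation of a polyhedral surface $F\subset\mathbb{H}^3$ is a choice of a Killing field on each face of a triangulation of $F$ having the same set of vertices as $F$, such that the two Killing fields on two adjacent triangles are equal on the common edge; it is determined by its values at the vertices of $F$. It is called trivial if it is the restriction to $F$ of a global Killing field of $\mathbb{H}^3$. An infinitesimal isometric deformation $Z$ of $\partial P$ is a parabolic deformation if for every $g\in G$ there is a parabolic Killing field $\vec g$ such that for every vertex $i$ of $P$ $$Z(g(i))=dg\bigl(Z(i)+\vec g(i)\bigr).$$ Here a parabolic Killing field $\vec g$ is one obtained as follows: let $g_t$ be a smooth path of isometries of $\mathbb{H}^3$ leaving invariant each horosphere centered at $c$, with $g_0=g$; then $\vec g:=dg^{-1}\,\frac{\partial}{\partial t}g_t\big|_{t=0}$. In particular $\vec g$ is a Killing field of $\mathbb{H}^3$ tangent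 to all horospheres centered at $c$. *)

theory Defs
  imports "HOL-Analysis.Analysis"
begin

section \<open>Hyperbolic space\<close>

text \<open>
  Hyperboloid model: \<open>H3\<close> is the upper sheet of the two-sheeted hyperboloid in Minkowski space.
  The tangent space at \<open>x\<close> is the linear subspace of all \<open>v\<close> with \<open>mink x v = 0\<close>; vector fields
  on \<open>H3\<close> are functions into the ambient space, and only their values on \<open>H3\<close> are relevant.
\<close>

definition mink :: "real^4 \<Rightarrow> real^4 \<Rightarrow> real" where
  "mink x y = x$1 * y$1 + x$2 * y$2 + x$3 * y$3 - x$4 * y$4"

definition H3 :: "(real^4) set" where
  "H3 = {x. mink x x = -1 \<and> x$4 > 0}"

definition hyp_dist :: "real^4 \<Rightarrow> real^4 \<Rightarrow> real" where
  "hyp_dist x y = arcosh (- mink x y)"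

text \<open>
  Each isometry of \<open>H3\<close> is the restriction of a unique linear map, so isometries are represented by
  matrices. The differential of an isometry \<open>A\<close> at any point is then \<open>(*v) A\<close> itself. Since \<open>A\<close>
  maps the upper sheet to itself, it preserves the orientation of \<open>H3\<close> iff its determinant is
  positive.
\<close>

definition hyp_isometry :: "real^4^4 \<Rightarrow> bool" where
  "hyp_isometry A \<longleftrightarrow> (*v) A ` H3 = H3 \<and>
     (\<forall>x\<in>H3. \<forall>y\<in>H3. hyp_dist (A *v x) (A *v y) = hyp_dist x y)"

definition Iso_plus :: "(real^4^4) set" where
  "Iso_plus = {A. hyp_isometry A \<and> det A > 0}"

text \<open>
  Geodesics of \<open>H3\<close> are its intersections with linear planes, so the geodesic segment from
  \<open>x\<close> to \<open>y\<close> is cut out by the cone spanned by \<open>x\<close> and \<open>y\<close>.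
\<close>

definition hyp_segment :: "real^4 \<Rightarrow> real^4 \<Rightarrow> (real^4) set" where
  "hyp_segment x y = {z\<in>H3. \<exists>a\<ge>0. \<exists>b\<ge>0. z = a *\<^sub>R x + b *\<^sub>R y}"

definition hyp_convex :: "(real^4) set \<Rightarrow> bool" where
  "hyp_convex C \<longleftrightarrow> C \<subseteq> H3 \<and> (\<forall>x\<in>C. \<forall>y\<in>C. hyp_segment x y \<subseteq> C)"

definition hyp_boundary :: "(real^4) set \<Rightarrow> (real^4) set" where
  "hyp_boundary P = top_of_set H3 frontier_of P"

definition hyp_vertices :: "(real^4) set \<Rightarrow> (real^4) set" where
  "hyp_vertices P = {v\<in>P. \<forall>x\<in>P. \<forall>y\<in>P. v \<in> hyp_segment x y \<longrightarrow> v = x \<or> v = y}"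

text \<open>
  An ideal point is represented by a future-directed lightlike vector, which is determined up to a
  positive factor. The horospheres centered at \<open>c\<close> are the sets \<open>horosphere c r\<close> with \<open>r > 0\<close>.
\<close>

definition ideal_point :: "real^4 \<Rightarrow> bool" where
  "ideal_point c \<longleftrightarrow> mink c c = 0 \<and> c$4 > 0"

definition horosphere :: "real^4 \<Rightarrow> real \<Rightarrow> (real^4) set" where
  "horosphere c r = {x\<in>H3. mink x c = - r}"


section \<open>Convex parabolic polyhedra\<close>

definition matrix_subgroup :: "(real^4^4) set \<Rightarrow> bool" where
  "matrix_subgroup G \<longleftrightarrow> G \<subseteq> Iso_plus \<and> mat 1 \<in> G \<and>
     (\<forall>g\<in>G. \<forall>h\<in>G. g ** h \<in> G) \<and> (\<forall>g\<in>G. matrix_inv g \<in> G)"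

definition acts_freely_cocompactly :: "(real^4^4) set \<Rightarrow> (real^4) set \<Rightarrow> bool" where
  "acts_freely_cocompactly G S \<longleftrightarrow>
     (\<forall>g\<in>G. (*v) g ` S = S) \<and>
     (\<forall>g\<in>G. \<forall>x\<in>S. g *v x = x \<longrightarrow> g = mat 1) \<and>
     (\<exists>K. compact K \<and> K \<subseteq> S \<and> S = (\<Union>g\<in>G. (*v) g ` K))"

definition convex_parabolic_polyhedron :: "(real^4) set \<Rightarrow> (real^4^4) set \<Rightarrow> bool" where
  "convex_parabolic_polyhedron P G \<longleftrightarrow>
     (\<exists>S. S \<subseteq> H3 \<and> S \<noteq> {} \<and> discrete S \<and> P = hyp_convex hull S) \<and>
     matrix_subgroup G \<and> discrete G \<and>
     (\<exists>n r. ideal_point n \<and> r > 0 \<and> acts_freely_cocompactly G (horosphere n r)) \<and>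
     (\<forall>g\<in>G. (*v) g ` P = P) \<and>
     (\<exists>A. finite A \<and> hyp_vertices P = (\<Union>v\<in>A. (\<lambda>g. g *v v) ` G))"

text \<open>\<open>G\<close> fixes the ideal point represented by \<open>c\<close> iff it preserves the ray spanned by \<open>c\<close>.\<close>

definition center_of :: "(real^4^4) set \<Rightarrow> real^4 \<Rightarrow> bool" where
  "center_of G c \<longleftrightarrow> ideal_point c \<and> (\<forall>g\<in>G. \<exists>l>0. g *v c = l *\<^sub>R c)"


section \<open>Infinitesimal deformations\<close>

text \<open>
  \<open>\<phi>\<close> is the flow of the vector field \<open>X\<close>. It can be taken to be global, since Killing fields on
  the complete manifold \<open>H3\<close> are complete.
\<close>

definition killing_field :: "(real^4 \<Rightarrow> real^4) \<Rightarrow> bool" where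
  "killing_field X \<longleftrightarrow>
     (\<exists>\<phi>. \<phi> 0 = mat 1 \<and> (\<forall>t. hyp_isometry (\<phi> t)) \<and>
        (\<forall>x\<in>H3. \<forall>t. ((\<lambda>s. \<phi> s *v x) has_vector_derivative X (\<phi> t *v x)) (at t)))"

text \<open>
  A triangle is given by its set of three vertices. They do not lie on a common geodesic iff they
  are linearly independent.
\<close>

definition triangulation_of :: "(real^4) set \<Rightarrow> (real^4) set \<Rightarrow> (real^4) set set \<Rightarrow> bool" where
  "triangulation_of F V T \<longleftrightarrow>
     (\<forall>\<sigma>\<in>T. \<sigma> \<subseteq> H3 \<and> card \<sigma> = 3 \<and> independent \<sigma>) \<and>
     (\<forall>\<sigma>\<in>T. \<forall>\<tau>\<in>T. (hyp_convex hull \<sigma>) \<inter> (hyp_convex hull \<tau>) = hyp_convex hull (\<sigma> \<inter> \<tau>)) \<and>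
     (\<forall>x\<in>F. \<exists>U. open U \<and> x \<in> U \<and> finite {\<sigma>\<in>T. (hyp_convex hull \<sigma>) \<inter> U \<noteq> {}}) \<and>
     F = (\<Union>\<sigma>\<in>T. hyp_convex hull \<sigma>) \<and>
     V = \<Union>T"

text \<open>
  \<open>K\<close> assigns a Killing field to each triangle, and \<open>Z\<close> is the vector field along the boundary
  of \<open>P\<close> which it induces.
\<close>

definition inf_isometric_deformation :: "(real^4) set \<Rightarrow> (real^4 \<Rightarrow> real^4) \<Rightarrow> bool" where
  "inf_isometric_deformation P Z \<longleftrightarrow>
     (\<exists>T K. triangulation_of (hyp_boundary P) (hyp_vertices P) T \<and>
        (\<forall>\<sigma>\<in>T. killing_field (K \<sigma>)) \<and>
        (\<forall>\<sigma>\<in>T. \<forall>\<tau>\<in>T. card (\<sigma> \<inter> \<tau>) = 2 \<longrightarrow>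
           (\<forall>x \<in> hyp_convex hull (\<sigma> \<inter> \<tau>). K \<sigma> x = K \<tau> x)) \<and>
        (\<forall>\<sigma>\<in>T. \<forall>x \<in> hyp_convex hull \<sigma>. Z x = K \<sigma> x))"

definition trivial_deformation :: "(real^4) set \<Rightarrow> (real^4 \<Rightarrow> real^4) \<Rightarrow> bool" where
  "trivial_deformation P Z \<longleftrightarrow> (\<exists>X. killing_field X \<and> (\<forall>x\<in>hyp_boundary P. Z x = X x))"

text \<open>\<open>D k\<close> is the \<open>k\<close>-th derivative of the smooth path \<open>D 0\<close> of isometries.\<close>

definition parabolic_killing_field :: "real^4 \<Rightarrow> real^4^4 \<Rightarrow> (real^4 \<Rightarrow> real^4) \<Rightarrow> bool" where
  "parabolic_killing_field c g X \<longleftrightarrow>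
     (\<exists>(D :: nat \<Rightarrow> real \<Rightarrow> real^4^4) \<epsilon>. \<epsilon> > 0 \<and>
        (\<forall>k. \<forall>t\<in>{-\<epsilon><..<\<epsilon>}. (D k has_vector_derivative D (Suc k) t) (at t)) \<and>
        (\<forall>t\<in>{-\<epsilon><..<\<epsilon>}. hyp_isometry (D 0 t) \<and>
           (\<forall>r>0. (*v) (D 0 t) ` horosphere c r = horosphere c r)) \<and>
        D 0 0 = g \<and>
        (\<forall>x\<in>H3. X x = matrix_inv g *v (D 1 0 *v x)))"

definition parabolic_deformation ::
    "(real^4) set \<Rightarrow> (real^4^4) set \<Rightarrow> real^4 \<Rightarrow> (real^4 \<Rightarrow> real^4) \<Rightarrow> bool" where
  "parabolic_deformation P G c Z \<longleftrightarrow>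
     inf_isometric_deformation P Z \<and>
     (\<forall>g\<in>G. \<exists>X. parabolic_killing_field c g X \<and>
        (\<forall>i\<in>hyp_vertices P. Z (g *v i) = g *v (Z i + X i)))"

end

theory Submission
  imports Defs
begin

text \<open>
  Project \<open>H3\<close> to an affine hyperplane so that the center \<open>c\<close> becomes the vertical direction. Then \<open>P\<close> is
  the epigraph of a convex piecewise linear function \<open>f\<close> on the plane, and after Pogorelov's rescaling an
  infinitesimal isometry of the boundary consists of a vertical velocity \<open>\<beta>\<close> and a horizontal velocity
  \<open>\<eta>\<close> with \<open>(\<beta> i - \<beta> j) (f i - f j) = (\<eta> i - \<eta> j) \<bullet> (i - j)\<close> on every edge. On each triangle \<open>\<eta>\<close> is
  determined by \<open>\<beta>\<close>, \<open>\<nabla>f\<close> and a rotation number, which jumps across an edge by the crease of \<open>f\<close> times the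
  difference of \<open>\<beta>\<close>. Summing the jumps around a vertex shows that \<open>\<beta>\<close> is harmonic for nonnegative weights
  that are positive on the proper edges of \<open>P\<close>. A parabolic deformation makes \<open>\<beta>\<close> invariant under \<open>G\<close>, so
  \<open>\<beta>\<close> attains its maximum and is constant; then all rotation numbers agree and the motion is a Killing field.
\<close>

section \<open>Convex piecewise linear functions on the plane\<close>

text \<open>The triangulation may subdivide flat faces. Edges inside such a face have crease zero,
  so the maximum principle does not pass from a vertex to all its neighbours; the vertices must be
  linked by edges of nonzero crease. This is done by descent: every vertex is strictly exposed,
  hence the unique minimum of \<open>f\<close> minus a linear function, and from any other vertex
  this difference decreases along some edge of nonzero crease. Quadratic growth of \<open>f\<close>
  leaves finitely many vertices below each level.

  Infinitesimal isometries that move the center have \<open>\<beta>\<close> affine and nonconstant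
  in the plane, so the flex equation alone cannot make \<open>\<beta>\<close> constant. This is
  where the parabolic condition enters: it leaves \<open>\<beta>\<close> only finitely many values
  at the vertices.

  A second difficulty is that \<open>P\<close> is given as a hull, not as a closed set, and its
  boundary is taken inside the open model. All vertices lie in one horoball at the center, which
  keeps the boundary off the sphere at infinity and yields closedness.\<close>

definition det2 :: "complex \<Rightarrow> complex \<Rightarrow> real" where
  "det2 a b = Re a * Im b - Im a * Re b"

lemma det2_self [simp]: "det2 a a = 0"
  by (simp add: det2_def)

lemma det2_swap: "det2 a b = - det2 b a"
  by (simp add: det2_def)

lemma det2_zero [simp]: "det2 0 a = 0" "det2 a 0 = 0"
  by (simp_all add: det2_def)

lemma det2_linear [simp]:
  "det2 a (b + c) = det2 a b + det2 a c" "det2 (a + b) c = det2 a c + det2 b c"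
  "det2 a (r *\<^sub>R b) = r * det2 a b" "det2 (r *\<^sub>R a) b = r * det2 a b"
  by (simp_all add: det2_def algebra_simps)

lemma inner_i_mult: "(\<i> * a) \<bullet> b = det2 a b"
  by (simp add: inner_complex_def det2_def)

lemma det2_i_mult: "det2 a (\<i> * a) = (norm a)\<^sup>2"
  by (simp add: det2_def cmod_power2) (simp add: power2_eq_square)

text \<open>Cramer's rule.\<close>

lemma det2_expand:
  assumes "det2 u v \<noteq> 0"
  shows "w = (det2 w v / det2 u v) *\<^sub>R u + (det2 u w / det2 u v) *\<^sub>R v"
proof -
  have "det2 u v *\<^sub>R w = det2 w v *\<^sub>R u + det2 u w *\<^sub>R v"
    by (rule complex_eqI) (simp_all add: det2_def algebra_simps)
  then have "(1 / det2 u v) *\<^sub>R (det2 u v *\<^sub>R w) = (1 / det2 u v) *\<^sub>R (det2 w v *\<^sub>R u + det2 u w *\<^sub>R v)"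
    by simp
  then show ?thesis
    using assms by (simp add: scaleR_add_right)
qed

lemma ex_inner_eq:
  assumes "det2 u v \<noteq> 0"
  obtains p where "p \<bullet> u = \<alpha>" "p \<bullet> v = \<gamma>"
proof
  define p where "p = Complex ((\<alpha> * Im v - \<gamma> * Im u) / det2 u v) ((\<gamma> * Re u - \<alpha> * Re v) / det2 u v)"
  have "det2 u v * (p \<bullet> u) = det2 u v * \<alpha>" "det2 u v * (p \<bullet> v) = det2 u v * \<gamma>"
    using assms
    by (simp_all add: p_def inner_complex_def distrib_left) (simp_all add: det2_def algebra_simps)
  then show "p \<bullet> u = \<alpha>" "p \<bullet> v = \<gamma>"
    using assms by auto
qed

lemma orthogonal_imp_i_mult:
  assumes "m \<bullet> u = 0" "u \<noteq> 0"
  obtains r where "m = r *\<^sub>R (\<i> * u)"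
proof
  have "m = (det2 m (\<i> * u) / det2 u (\<i> * u)) *\<^sub>R u + (det2 u m / det2 u (\<i> * u)) *\<^sub>R (\<i> * u)"
    using assms(2) by (intro det2_expand) (simp add: det2_i_mult)
  moreover have "det2 m (\<i> * u) = 0"
    using assms(1) by (simp add: det2_def inner_complex_def)
  ultimately show "m = (det2 u m / det2 u (\<i> * u)) *\<^sub>R (\<i> * u)"
    by simp
qed

lemma in_triangle_iff:
  "y \<in> convex hull {a, b, c} \<longleftrightarrow>
     (\<exists>u v. 0 \<le> u \<and> 0 \<le> v \<and> u + v \<le> 1 \<and> y = a + u *\<^sub>R (b - a) + v *\<^sub>R (c - a))"
  by (auto simp: convex_hull_3_alt)

text \<open>Detects the side of an edge on which a triangle lies. The quarter turn of
  \<open>b - a\<close> is expanded in the two sides at \<open>a\<close>; its coefficient along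
  \<open>c - a\<close> is nonnegative by orientation.\<close>

lemma edge_midpoint_push:
  assumes "det2 (b - a) (c - a) > 0"
  shows "\<exists>d>0. \<forall>t. 0 < t \<longrightarrow> t < d \<longrightarrow> midpoint a b + t *\<^sub>R (\<i> * (b - a)) \<in> convex hull {a, b, c}"
proof -
  obtain \<alpha> \<gamma> where e: "\<i> * (b - a) = \<alpha> *\<^sub>R (b - a) + \<gamma> *\<^sub>R (c - a)" and \<gamma>: "\<gamma> \<ge> 0"
  proof
    show "\<i> * (b - a) = (det2 (\<i> * (b - a)) (c - a) / det2 (b - a) (c - a)) *\<^sub>R (b - a) +
        (det2 (b - a) (\<i> * (b - a)) / det2 (b - a) (c - a)) *\<^sub>R (c - a)"
      using assms by (intro det2_expand) simp
    show "det2 (b - a) (\<i> * (b - a)) / det2 (b - a) (c - a) \<ge> 0"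
      using assms by (simp add: det2_i_mult)
  qed
  \<comment> \<open>The midpoint has coordinates \<open>(1/2, 0)\<close> in these sides; a total
    change below \<open>1/4\<close> keeps it inside the triangle.\<close>
  define d where "d = 1 / (4 * (\<bar>\<alpha>\<bar> + \<gamma> + 1))"
  have "d > 0"
    using \<gamma> by (simp add: d_def add_nonneg_pos)
  moreover have "midpoint a b + t *\<^sub>R (\<i> * (b - a)) \<in> convex hull {a, b, c}" if t: "0 < t" "t < d" for t
  proof -
    have "t * (\<bar>\<alpha>\<bar> + \<gamma> + 1) < 1 / 4"
      using t \<gamma> by (simp add: d_def field_simps add_nonneg_pos)
    then have "t * \<bar>\<alpha>\<bar> + t * \<gamma> + t < 1 / 4"
      by (simp only: distrib_left mult_1_right)
    moreover have "t * \<bar>\<alpha>\<bar> \<ge> 0" "t * \<gamma> \<ge> 0" "t * \<alpha> \<le> t * \<bar>\<alpha>\<bar>" "- (t * \<alpha>) \<le> t * \<bar>\<alpha>\<bar>"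
      using t \<gamma> by (auto simp: abs_if)
    ultimately have "0 \<le> 1/2 + t * \<alpha>" "0 \<le> t * \<gamma>" "(1/2 + t * \<alpha>) + t * \<gamma> \<le> 1"
      using t by linarith+
    moreover have "midpoint a b + t *\<^sub>R (\<i> * (b - a)) = a + (1/2 + t * \<alpha>) *\<^sub>R (b - a) + (t * \<gamma>) *\<^sub>R (c - a)"
      unfolding e midpoint_def
      by (rule complex_eqI) (simp_all add: field_simps)
    ultimately show ?thesis
      unfolding in_triangle_iff by blast
  qed
  ultimately show ?thesis
    by blast
qed

text \<open>The centroid is an interior point, so a short step from it towards any \<open>y\<close>
  stays in the triangle. This lets convexity compare a triangle with arbitrary points of the
  plane.\<close>

lemma centroid_push:
  assumes "det2 (b - a) (c - a) \<noteq> 0"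
  obtains g t where "t > 0" "t \<le> 1" "g \<in> convex hull {a, b, c}" "g + t *\<^sub>R (y - g) \<in> convex hull {a, b, c}"
proof -
  define g where "g = a + (1/3) *\<^sub>R (b - a) + (1/3) *\<^sub>R (c - a)"
  obtain \<alpha> \<gamma> where e: "y - g = \<alpha> *\<^sub>R (b - a) + \<gamma> *\<^sub>R (c - a)"
    using det2_expand[OF assms] by blast
  define t where "t = 1 / (6 * (\<bar>\<alpha>\<bar> + \<bar>\<gamma>\<bar> + 1))"
  have t: "t > 0" "t \<le> 1"
    by (simp_all add: t_def add_nonneg_pos divide_le_eq)
  have "t * (\<bar>\<alpha>\<bar> + \<bar>\<gamma>\<bar> + 1) = 1/6"
    by (simp add: t_def field_simps add_nonneg_pos)
  then have "t * \<bar>\<alpha>\<bar> + t * \<bar>\<gamma>\<bar> + t = 1/6"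
    by (simp only: distrib_left mult_1_right)
  moreover have "- (t * \<alpha>) \<le> t * \<bar>\<alpha>\<bar>" "t * \<alpha> \<le> t * \<bar>\<alpha>\<bar>" "- (t * \<gamma>) \<le> t * \<bar>\<gamma>\<bar>" "t * \<gamma> \<le> t * \<bar>\<gamma>\<bar>"
    "t * \<bar>\<alpha>\<bar> \<ge> 0" "t * \<bar>\<gamma>\<bar> \<ge> 0"
    using t by (auto simp: abs_if)
  ultimately have "0 \<le> 1/3 + t * \<alpha>" "0 \<le> 1/3 + t * \<gamma>" "(1/3 + t * \<alpha>) + (1/3 + t * \<gamma>) \<le> 1"
    using t by linarith+
  moreover have "g + t *\<^sub>R (y - g) = a + (1/3 + t * \<alpha>) *\<^sub>R (b - a) + (1/3 + t * \<gamma>) *\<^sub>R (c - a)"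
    unfolding e by (simp add: g_def algebra_simps)
  ultimately have "g + t *\<^sub>R (y - g) \<in> convex hull {a, b, c}"
    unfolding in_triangle_iff by blast
  moreover have "g \<in> convex hull {a, b, c}"
    unfolding in_triangle_iff g_def by (intro exI[of _ "1/3"]) simp
  ultimately show thesis
    using that t by blast
qed

section \<open>Triangulations of the plane carrying a convex function\<close>

definition left_of :: "complex \<Rightarrow> complex \<Rightarrow> complex set \<Rightarrow> bool" where
  "left_of a b \<sigma> \<longleftrightarrow> (\<exists>c. \<sigma> = {a, b, c} \<and> det2 (b - a) (c - a) > 0)"

lemma det2_perm:
  "det2 (c - a) (b - a) = - det2 (b - a) (c - a)"
  "det2 (a - b) (c - b) = - det2 (b - a) (c - a)"
  "det2 (c - b) (a - b) = det2 (b - a) (c - a)"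
  "det2 (a - c) (b - c) = det2 (b - a) (c - a)"
  "det2 (b - c) (a - c) = - det2 (b - a) (c - a)"
  by (simp_all add: det2_def algebra_simps)

lemma small_scale:
  fixes e :: real
  assumes "e > 0" "u \<noteq> 0"
  shows "0 < min 1 (e / (2 * norm u))" "min 1 (e / (2 * norm u)) \<le> 1" "min 1 (e / (2 * norm u)) * norm u < e"
proof -
  have "min 1 (e / (2 * norm u)) * norm u \<le> e / (2 * norm u) * norm u"
    by (intro mult_right_mono) auto
  then show "min 1 (e / (2 * norm u)) * norm u < e"
    using assms by simp
qed (use assms in auto)

text \<open>The graph of \<open>f\<close> is to be the boundary of the polyhedron in the chart.
  \<open>strict\<close> records that vertices are extreme points, and \<open>growth\<close> that the
  graph lies above the paraboloid bounding the projective model.\<close>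

locale convex_triangulated =
  fixes f :: "complex \<Rightarrow> real" and T :: "complex set set"
  assumes convex: "convex_on UNIV f"
    and triangle: "\<sigma> \<in> T \<Longrightarrow> \<exists>a b c. \<sigma> = {a, b, c} \<and> det2 (b - a) (c - a) \<noteq> 0"
    and inter: "\<sigma> \<in> T \<Longrightarrow> \<tau> \<in> T \<Longrightarrow> convex hull \<sigma> \<inter> convex hull \<tau> = convex hull (\<sigma> \<inter> \<tau>)"
    and locally_finite: "\<exists>U. open U \<and> y \<in> U \<and> finite {\<sigma>\<in>T. convex hull \<sigma> \<inter> U \<noteq> {}}"
    and cover: "\<exists>\<sigma>\<in>T. y \<in> convex hull \<sigma>"
    and affine: "\<sigma> \<in> T \<Longrightarrow> \<exists>p k. \<forall>y\<in>convex hull \<sigma>. f y = p \<bullet> y + k"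
    and strict: "v \<in> \<Union>T \<Longrightarrow> u \<noteq> 0 \<Longrightarrow> 2 * f v < f (v + u) + f (v - u)"
    and growth: "(norm y)\<^sup>2 / 2 \<le> f y"
begin

lemma third_vertex:
  assumes "\<sigma> \<in> T" "a \<in> \<sigma>" "b \<in> \<sigma>" "a \<noteq> b"
  obtains c where "\<sigma> = {a, b, c}" "c \<noteq> a" "c \<noteq> b" "det2 (b - a) (c - a) \<noteq> 0"
proof -
  obtain x y z where s: "\<sigma> = {x, y, z}" and d: "det2 (y - x) (z - x) \<noteq> 0"
    using triangle[OF assms(1)] by blast
  have "x \<noteq> y" "x \<noteq> z" "y \<noteq> z"
    using d by auto
  consider "a = x \<and> b = y" | "a = x \<and> b = z" | "a = y \<and> b = x" | "a = y \<and> b = z"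
    | "a = z \<and> b = x" | "a = z \<and> b = y"
    using assms s by blast
  then obtain c where "\<sigma> = {a, b, c}" "det2 (b - a) (c - a) \<noteq> 0"
  proof cases
    case 1 then show ?thesis using s d that[of z] by blast
  next
    case 2 then show ?thesis using s d that[of y] using det2_perm[where a=x and b=y and c=z] by auto
  next
    case 3 then show ?thesis using s d that[of z] using det2_perm[where a=x and b=y and c=z] by auto
  next
    case 4 then show ?thesis using s d that[of x] using det2_perm[where a=x and b=y and c=z] by auto
  next
    case 5 then show ?thesis using s d that[of y] using det2_perm[where a=x and b=y and c=z] by auto
  next
    case 6 then show ?thesis using s d that[of x] using det2_perm[where a=x and b=y and c=z] by auto
  qed
  moreover from this have "c \<noteq> a" "c \<noteq> b"
    by auto
  ultimately show thesis
    using that by blast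
qed

lemma triangle_at:
  assumes "\<sigma> \<in> T" "a \<in> \<sigma>"
  obtains b c where "\<sigma> = {a, b, c}" "det2 (b - a) (c - a) > 0"
proof -
  obtain x y z where s: "\<sigma> = {x, y, z}" and d: "det2 (y - x) (z - x) \<noteq> 0"
    using triangle[OF assms(1)] by blast
  then have "\<exists>b\<in>\<sigma>. a \<noteq> b"
    by auto
  then obtain b where b: "b \<in> \<sigma>" "a \<noteq> b"
    by blast
  obtain c where c: "\<sigma> = {a, b, c}" "det2 (b - a) (c - a) \<noteq> 0"
    using third_vertex[OF assms b] by blast
  show thesis
  proof (cases "det2 (b - a) (c - a) > 0")
    case True
    then show ?thesis using that c by blast
  next
    case False
    then have "det2 (c - a) (b - a) > 0"
      using c(2) by (simp add: det2_swap[of "c - a"])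
    then show ?thesis using that[of c b] c(1) by blast
  qed
qed

lemma finite_triangle: "\<sigma> \<in> T \<Longrightarrow> finite \<sigma>"
  using triangle by fastforce

text \<open>In a nondegenerate triangle a vertex cannot lie on the opposite side.\<close>

lemma vertex_in_hull:
  assumes "\<sigma> \<in> T" "\<rho> \<subseteq> \<sigma>" "v \<in> \<sigma>" "v \<in> convex hull \<rho>"
  shows "v \<in> \<rho>"
proof (rule ccontr)
  assume "v \<notin> \<rho>"
  obtain b c where s: "\<sigma> = {v, b, c}" and d: "det2 (b - v) (c - v) > 0"
    using triangle_at assms(1,3) by blast
  have "\<rho> \<subseteq> {b, c}"
    using assms(2) s \<open>v \<notin> \<rho>\<close> by blast
  then have "v \<in> closed_segment b c"
    using hull_mono assms(4) by (metis segment_convex_hull subsetD)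
  then obtain t where "v = (1 - t) *\<^sub>R b + t *\<^sub>R c"
    by (auto simp: in_segment)
  then have "v - b = t *\<^sub>R (c - b)"
    by (simp add: algebra_simps)
  then have "det2 (c - b) (v - b) = 0"
    by simp
  then show False
    using d by (simp only: det2_perm(3))
qed

lemma vertex_in_triangle:
  assumes "v \<in> \<Union>T" "\<sigma> \<in> T" "v \<in> convex hull \<sigma>"
  shows "v \<in> \<sigma>"
proof -
  obtain \<tau> where t: "\<tau> \<in> T" "v \<in> \<tau>"
    using assms(1) by blast
  have "v \<in> convex hull \<sigma> \<inter> convex hull \<tau>"
    using assms(3) hull_inc[OF t(2)] by (rule IntI)
  then have "v \<in> convex hull (\<sigma> \<inter> \<tau>)"
    unfolding inter[OF assms(2) t(1)] .
  from vertex_in_hull[OF t(1) Int_lower2 t(2) this] show ?thesis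
    by (rule IntD1)
qed

text \<open>The midpoint stands for the relative interior of the edge. Triangles meet in the hull of
  their common vertices; if \<open>a\<close> were missing, this hull would lie in the side from
  \<open>b\<close> to \<open>c\<close>, which meets the line through \<open>a\<close> and
  \<open>b\<close> only in \<open>b\<close>.\<close>

lemma midpoint_in_triangle:
  assumes "\<sigma> \<in> T" "a \<in> \<sigma>" "b \<in> \<sigma>" "a \<noteq> b" "\<tau> \<in> T" "midpoint a b \<in> convex hull \<tau>"
  shows "a \<in> \<tau> \<and> b \<in> \<tau>"
proof -
  have *: "a \<in> \<tau>" if ab: "a \<in> \<sigma>" "b \<in> \<sigma>" "a \<noteq> b" "midpoint a b \<in> convex hull \<tau>" for a b
  proof (rule ccontr)
    assume "a \<notin> \<tau>"
    obtain c where s: "\<sigma> = {a, b, c}" and d: "det2 (b - a) (c - a) \<noteq> 0"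
      using third_vertex[OF assms(1) ab(1-3)] by blast
    have "midpoint a b \<in> convex hull \<sigma>"
      unfolding s in_triangle_iff
      by (rule exI[of _ "1/2"], rule exI[of _ 0]) (auto intro!: complex_eqI simp: midpoint_def field_simps)
    then have "midpoint a b \<in> convex hull (\<sigma> \<inter> \<tau>)"
      using inter[OF assms(1,5)] ab(4) by blast
    moreover have "\<sigma> \<inter> \<tau> \<subseteq> {b, c}"
      using s \<open>a \<notin> \<tau>\<close> by blast
    ultimately have "midpoint a b \<in> closed_segment b c"
      using hull_mono by (metis segment_convex_hull subsetD)
    then obtain t where "midpoint a b = (1 - t) *\<^sub>R b + t *\<^sub>R c"
      by (auto simp: in_segment)
    then have "midpoint a b - b = t *\<^sub>R (c - b)"
      by (simp add: algebra_simps)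
    moreover have "a - b = 2 *\<^sub>R (midpoint a b - b)"
      by (rule complex_eqI) (simp_all add: midpoint_def)
    ultimately have "det2 (c - b) (a - b) = 0"
      by simp
    then show False
      using d by (simp only: det2_perm(3))
  qed
  show ?thesis
    using *[of a b] *[of b a] assms by (auto simp: midpoint_sym)
qed

text \<open>Only finitely many triangles come near \<open>y\<close>; those that avoid
  \<open>y\<close> are compact, so a small ball misses them all.\<close>

lemma local_triangles:
  "\<exists>e>0. \<forall>\<sigma>\<in>T. \<forall>z\<in>convex hull \<sigma>. dist y z < e \<longrightarrow> y \<in> convex hull \<sigma>"
proof -
  obtain U where U: "open U" "y \<in> U" and fin: "finite {\<sigma>\<in>T. convex hull \<sigma> \<inter> U \<noteq> {}}"
    using locally_finite by blast
  define B where "B = \<Union>((hull) convex ` {\<sigma>\<in>T. convex hull \<sigma> \<inter> U \<noteq> {} \<and> y \<notin> convex hull \<sigma>})"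
  have "closed B"
    unfolding B_def
  proof (rule closed_Union)
    show "finite ((hull) convex ` {\<sigma>\<in>T. convex hull \<sigma> \<inter> U \<noteq> {} \<and> y \<notin> convex hull \<sigma>})"
      by (intro finite_imageI finite_subset[OF _ fin]) auto
    show "\<forall>S\<in>(hull) convex ` {\<sigma>\<in>T. convex hull \<sigma> \<inter> U \<noteq> {} \<and> y \<notin> convex hull \<sigma>}. closed S"
      using finite_triangle by (auto intro!: compact_imp_closed finite_imp_compact_convex_hull)
  qed
  moreover have "y \<notin> B"
    by (auto simp: B_def)
  ultimately have "open (U - B)" "y \<in> U - B"
    using U by auto
  then obtain e where e: "e > 0" "ball y e \<subseteq> U - B"
    using open_contains_ball by blast
  show ?thesis
  proof (intro exI[of _ e] conjI ballI impI e(1))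
    fix \<sigma> z assume z: "\<sigma> \<in> T" "z \<in> convex hull \<sigma>" "dist y z < e"
    then have "z \<in> U - B"
      using e(2) by (auto simp: subset_iff)
    then show "y \<in> convex hull \<sigma>"
      using z(1,2) unfolding B_def by blast
  qed
qed

lemma finite_star: "finite {\<sigma>\<in>T. v \<in> \<sigma>}"
proof -
  obtain U where "v \<in> U" and fin: "finite {\<sigma>\<in>T. convex hull \<sigma> \<inter> U \<noteq> {}}"
    using locally_finite by blast
  then have "{\<sigma>\<in>T. v \<in> \<sigma>} \<subseteq> {\<sigma>\<in>T. convex hull \<sigma> \<inter> U \<noteq> {}}"
    by (auto dest: hull_inc)
  then show ?thesis
    using fin finite_subset by blast
qed

lemma finite_vertices_in_compact:
  assumes "compact K"
  shows "finite (\<Union>T \<inter> K)"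
proof -
  have "\<forall>y. \<exists>U. open U \<and> y \<in> U \<and> finite {\<sigma>\<in>T. convex hull \<sigma> \<inter> U \<noteq> {}}"
    using locally_finite by blast
  from choice[OF this] obtain U where
    "\<forall>y. open (U y) \<and> y \<in> U y \<and> finite {\<sigma>\<in>T. convex hull \<sigma> \<inter> U y \<noteq> {}}" ..
  then have U: "\<And>y. open (U y)" "\<And>y. y \<in> U y"
    and fin: "\<And>y. finite {\<sigma>\<in>T. convex hull \<sigma> \<inter> U y \<noteq> {}}"
    by blast+
  obtain D where D: "D \<subseteq> K" "finite D" "K \<subseteq> (\<Union>y\<in>D. U y)"
    by (rule compactE_image[OF assms, of K U]) (use U in auto)
  have "\<Union>T \<inter> K \<subseteq> \<Union>(\<Union>y\<in>D. {\<sigma>\<in>T. convex hull \<sigma> \<inter> U y \<noteq> {}})"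
  proof
    fix v assume v: "v \<in> \<Union>T \<inter> K"
    then obtain \<sigma> y where "\<sigma> \<in> T" "v \<in> \<sigma>" "y \<in> D" "v \<in> U y"
      using D(3) by blast
    moreover from this have "v \<in> convex hull \<sigma>"
      by (simp add: hull_inc)
    ultimately show "v \<in> \<Union>(\<Union>y\<in>D. {\<sigma>\<in>T. convex hull \<sigma> \<inter> U y \<noteq> {}})"
      by blast
  qed
  moreover have "finite (\<Union>(\<Union>y\<in>D. {\<sigma>\<in>T. convex hull \<sigma> \<inter> U y \<noteq> {}}))"
    using D(2) fin finite_triangle by auto
  ultimately show ?thesis
    using finite_subset by blast
qed

text \<open>Countability is wanted because the plane minus a countable set is connected.\<close>

lemma countable_vertices: "countable (\<Union>T)"
proof -
  have "\<Union>T = (\<Union>n::nat. \<Union>T \<inter> cball 0 (real n))"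
    by (auto simp: real_arch_simple)
  moreover have "countable (\<Union>n::nat. \<Union>T \<inter> cball 0 (real n))"
    using countable_finite[OF finite_vertices_in_compact[OF compact_cball]] by (intro countable_UN) auto
  ultimately show ?thesis
    by metis
qed

text \<open>The quadratic lower bound of \<open>f\<close> beats the linear term, so the sublevel
  lies in a disc. This provides the minimum in the descent argument.\<close>

lemma finite_sublevel: "finite {v\<in>\<Union>T. f v - p \<bullet> v \<le> C}"
proof -
  have "norm v \<le> 2 * norm p + 2 * \<bar>C\<bar> + 1" if "f v - p \<bullet> v \<le> C" for v
  proof (rule ccontr)
    assume n: "\<not> norm v \<le> 2 * norm p + 2 * \<bar>C\<bar> + 1"
    have "(norm v)\<^sup>2 / 2 \<le> C + p \<bullet> v"
      using growth[of v] that by simp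
    also have "\<dots> \<le> \<bar>C\<bar> + norm p * norm v"
      using norm_cauchy_schwarz[of p v] by simp
    finally have "norm v * norm v \<le> 2 * \<bar>C\<bar> + 2 * norm p * norm v"
      by (simp add: power2_eq_square)
    also have "\<dots> \<le> 2 * \<bar>C\<bar> * norm v + 2 * norm p * norm v"
      using n mult_left_mono[of 1 "norm v" "2 * \<bar>C\<bar>"] norm_ge_zero[of p] by linarith
    also have "\<dots> = (2 * \<bar>C\<bar> + 2 * norm p) * norm v"
      by (simp add: algebra_simps)
    also have "\<dots> < norm v * norm v"
      using n norm_ge_zero[of p] by (intro mult_strict_right_mono) linarith+
    finally show False by simp
  qed
  then have "{v\<in>\<Union>T. f v - p \<bullet> v \<le> C} \<subseteq> \<Union>T \<inter> cball 0 (2 * norm p + 2 * \<bar>C\<bar> + 1)"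
    by auto
  then show ?thesis
    by (rule finite_subset) (rule finite_vertices_in_compact[OF compact_cball])
qed

section \<open>Gradients and supporting planes\<close>

definition grad :: "complex set \<Rightarrow> complex" where
  "grad \<sigma> = (SOME p. \<exists>k. \<forall>y\<in>convex hull \<sigma>. f y = p \<bullet> y + k)"

lemma grad:
  assumes "\<sigma> \<in> T" "y \<in> convex hull \<sigma>" "z \<in> convex hull \<sigma>"
  shows "f y - f z = grad \<sigma> \<bullet> (y - z)"
proof -
  have "\<exists>k. \<forall>y\<in>convex hull \<sigma>. f y = grad \<sigma> \<bullet> y + k"
    unfolding grad_def using affine[OF assms(1)] by (rule someI_ex)
  then obtain k where "\<forall>y\<in>convex hull \<sigma>. f y = grad \<sigma> \<bullet> y + k"
    by blast
  then show ?thesis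
    using assms by (simp add: inner_diff_right)
qed

lemma convexD_seg:
  assumes "0 \<le> t" "t \<le> 1"
  shows "f (x + t *\<^sub>R (y - x)) \<le> f x + t * (f y - f x)"
  using convex_onD[OF convex assms, of x y] by (simp add: algebra_simps)

text \<open>Local affinity becomes global support by convexity: on the segment from an interior
  point of the triangle to \<open>y\<close>, \<open>f\<close> starts with slope
  \<open>grad \<sigma>\<close>, and the slope of the whole chord is at least as large.\<close>

lemma grad_support:
  assumes "\<sigma> \<in> T" "z \<in> convex hull \<sigma>"
  shows "f z + grad \<sigma> \<bullet> (y - z) \<le> f y"
proof -
  obtain a b c where s: "\<sigma> = {a, b, c}" and d: "det2 (b - a) (c - a) \<noteq> 0"
    using triangle[OF assms(1)] by blast
  obtain g t where t: "t > 0" "t \<le> 1" and g: "g \<in> convex hull \<sigma>" "g + t *\<^sub>R (y - g) \<in> convex hull \<sigma>"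
    using centroid_push[OF d, of y] unfolding s by metis
  have "f (g + t *\<^sub>R (y - g)) - f g = t * (grad \<sigma> \<bullet> (y - g))"
    using grad[OF assms(1) g(2) g(1)] by simp
  then have "t * (grad \<sigma> \<bullet> (y - g)) \<le> t * (f y - f g)"
    using convexD_seg[of t g y] t by linarith
  then have "grad \<sigma> \<bullet> (y - g) \<le> f y - f g"
    by (rule mult_left_le_imp_le[OF _ t(1)])
  then show ?thesis
    using grad[OF assms g(1)] by (simp add: inner_diff_right)
qed

text \<open>The strict supporting slope is the mean of the gradients around the vertex.\<close>

lemma strict_support:
  assumes "v \<in> \<Union>T"
  obtains p where "\<And>y. y \<noteq> v \<Longrightarrow> f v + p \<bullet> (y - v) < f y"
proof
  define S where "S = {\<sigma>\<in>T. v \<in> \<sigma>}"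
  have S: "finite S" "S \<noteq> {}"
    using finite_star assms by (auto simp: S_def)
  define p where "p = (1 / card S) *\<^sub>R (\<Sum>\<sigma>\<in>S. grad \<sigma>)"
  fix y assume y: "y \<noteq> v"
  have ge: "f y - f v - grad \<sigma> \<bullet> (y - v) \<ge> 0" if "\<sigma> \<in> S" for \<sigma>
    using grad_support[of \<sigma> v y] that by (auto simp: S_def hull_inc)
  \<comment> \<open>If all supporting planes at \<open>v\<close> touched the graph over
    \<open>y\<close>, \<open>f\<close> would have that same slope on a short segment in the opposite
    direction. Together with the convexity bound towards \<open>y\<close> this contradicts
    \<open>strict\<close>.\<close>
  have "\<exists>\<sigma>\<in>S. f y - f v - grad \<sigma> \<bullet> (y - v) \<noteq> 0"
  proof (rule ccontr)
    assume "\<not> ?thesis"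
    then have eq: "f y - f v = grad \<sigma> \<bullet> (y - v)" if "\<sigma> \<in> S" for \<sigma>
      using that by auto
    obtain e where e: "e > 0" and
      loc: "\<And>\<sigma> z. \<sigma> \<in> T \<Longrightarrow> dist v z < e \<Longrightarrow> z \<in> convex hull \<sigma> \<Longrightarrow> v \<in> convex hull \<sigma>"
      using local_triangles[of v] by blast
    define t where "t = min 1 (e / (2 * norm (y - v)))"
    have t: "t > 0" "t \<le> 1" "t * norm (y - v) < e"
      using small_scale[OF e, of "y - v"] y unfolding t_def right_minus_eq by blast+
    obtain \<sigma> where s: "\<sigma> \<in> T" "v - t *\<^sub>R (y - v) \<in> convex hull \<sigma>"
      using cover by blast
    have "v \<in> convex hull \<sigma>"
      using loc[OF s(1) _ s(2)] t by (simp add: dist_norm)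
    then have "\<sigma> \<in> S" "v \<in> convex hull \<sigma>"
      using vertex_in_triangle[OF assms s(1)] s(1) by (auto simp: S_def)
    then have "f (v - t *\<^sub>R (y - v)) - f v = - t * (f y - f v)"
      using grad[OF s(1,2), of v] eq by simp
    moreover have "f (v + t *\<^sub>R (y - v)) \<le> f v + t * (f y - f v)"
      using convexD_seg t by simp
    ultimately show False
      using strict[OF assms, of "t *\<^sub>R (y - v)"] t y by simp
  qed
  then obtain \<tau> where "\<tau> \<in> S" "f y - f v - grad \<tau> \<bullet> (y - v) \<noteq> 0"
    by blast
  then have "0 < (\<Sum>\<sigma>\<in>S. f y - f v - grad \<sigma> \<bullet> (y - v))"
    using S ge[of \<tau>] by (intro sum_pos2[of _ \<tau>] ge) auto
  also have "\<dots> = card S * (f y - f v) - (\<Sum>\<sigma>\<in>S. grad \<sigma>) \<bullet> (y - v)"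
    by (simp add: sum_subtractf inner_sum_left)
  also have "\<dots> = card S * (f y - f v - p \<bullet> (y - v))"
    using S by (simp add: p_def algebra_simps)
  finally show "f v + p \<bullet> (y - v) < f y"
    using S by (simp add: zero_less_mult_iff card_gt_0_iff)
qed

end

lemma det2_zero_imp_scaleR:
  assumes "det2 u w = 0" "u \<noteq> 0"
  obtains s where "w = s *\<^sub>R u"
proof
  have "w = (det2 w (\<i> * u) / det2 u (\<i> * u)) *\<^sub>R u + (det2 u w / det2 u (\<i> * u)) *\<^sub>R (\<i> * u)"
    using assms(2) by (intro det2_expand) (simp add: det2_i_mult)
  then show "w = (det2 w (\<i> * u) / det2 u (\<i> * u)) *\<^sub>R u"
    by (simp only: assms(1) div_0 scaleR_zero_left add_0_right)
qed

context convex_triangulated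
begin

text \<open>Existence: a point slightly left of the midpoint is covered by a triangle, which then
  has the whole edge, and its third vertex is on the same side as the point. Uniqueness: two such
  triangles share points off the line of the edge, whereas distinct ones would meet only in the
  edge.\<close>

lemma ex1_left:
  assumes "\<sigma> \<in> T" "a \<in> \<sigma>" "b \<in> \<sigma>" "a \<noteq> b"
  shows "\<exists>!\<tau>. \<tau> \<in> T \<and> left_of a b \<tau>"
proof (rule ex_ex1I)
  have off: "det2 (b - a) (midpoint a b + t *\<^sub>R (\<i> * (b - a)) - a) = t * (norm (b - a))\<^sup>2" for t
  proof -
    have "midpoint a b + t *\<^sub>R (\<i> * (b - a)) - a = (1/2) *\<^sub>R (b - a) + t *\<^sub>R (\<i> * (b - a))"
      by (rule complex_eqI) (simp_all add: midpoint_def field_simps)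
    then show ?thesis
      by (simp only: det2_linear det2_self det2_i_mult)
  qed
  obtain e where e: "e > 0" and loc: "\<And>\<sigma> z. \<sigma> \<in> T \<Longrightarrow> dist (midpoint a b) z < e \<Longrightarrow>
      z \<in> convex hull \<sigma> \<Longrightarrow> midpoint a b \<in> convex hull \<sigma>"
    using local_triangles[of "midpoint a b"] by blast
  define t where "t = e / (2 * norm (b - a))"
  define z where "z = midpoint a b + t *\<^sub>R (\<i> * (b - a))"
  have t: "t > 0" "t * norm (b - a) < e"
    using e assms(4) by (auto simp: t_def field_simps)
  obtain \<tau> where \<tau>: "\<tau> \<in> T" "z \<in> convex hull \<tau>"
    using cover by blast
  have "dist (midpoint a b) z < e"
    using t by (simp add: z_def dist_norm norm_mult)
  then have "a \<in> \<tau> \<and> b \<in> \<tau>"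
    using midpoint_in_triangle[OF assms \<tau>(1)] loc[OF \<tau>(1) _ \<tau>(2)] by blast
  then obtain c where c: "\<tau> = {a, b, c}"
    using third_vertex[OF \<tau>(1)] assms(4) by metis
  then obtain u v where uv: "v \<ge> 0" "z = a + u *\<^sub>R (b - a) + v *\<^sub>R (c - a)"
    using \<tau>(2) unfolding c in_triangle_iff by blast
  have "z - a = u *\<^sub>R (b - a) + v *\<^sub>R (c - a)"
    using uv by simp
  then have "det2 (b - a) (z - a) = v * det2 (b - a) (c - a)"
    by (simp only: det2_linear det2_self)
  moreover have "det2 (b - a) (z - a) > 0"
    using t assms(4) by (simp add: z_def off)
  ultimately have "det2 (b - a) (c - a) > 0"
    using uv(1) by (simp add: zero_less_mult_iff)
  then show "\<exists>\<tau>. \<tau> \<in> T \<and> left_of a b \<tau>"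
    using \<tau>(1) c left_of_def by blast
next
  fix \<tau> \<tau>' assume 1: "\<tau> \<in> T \<and> left_of a b \<tau>" and 2: "\<tau>' \<in> T \<and> left_of a b \<tau>'"
  obtain c where c: "\<tau> = {a, b, c}" "det2 (b - a) (c - a) > 0"
    using 1 unfolding left_of_def by blast
  obtain c' where c': "\<tau>' = {a, b, c'}" "det2 (b - a) (c' - a) > 0"
    using 2 unfolding left_of_def by blast
  obtain d where d: "d > 0"
    "\<And>t. 0 < t \<Longrightarrow> t < d \<Longrightarrow> midpoint a b + t *\<^sub>R (\<i> * (b - a)) \<in> convex hull \<tau>"
    using edge_midpoint_push[OF c(2)] unfolding c(1) by blast
  obtain d' where d': "d' > 0"
    "\<And>t. 0 < t \<Longrightarrow> t < d' \<Longrightarrow> midpoint a b + t *\<^sub>R (\<i> * (b - a)) \<in> convex hull \<tau>'"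
    using edge_midpoint_push[OF c'(2)] unfolding c'(1) by blast
  define t where "t = min d d' / 2"
  define z where "z = midpoint a b + t *\<^sub>R (\<i> * (b - a))"
  have t: "0 < t" "t < d" "t < d'"
    using d d' by (auto simp: t_def)
  have z: "z \<in> convex hull (\<tau> \<inter> \<tau>')"
    using d(2)[OF t(1,2)] d'(2)[OF t(1,3)] inter 1 2 by (auto simp: z_def)
  show "\<tau> = \<tau>'"
  proof (rule ccontr)
    assume "\<tau> \<noteq> \<tau>'"
    then have "\<tau> \<inter> \<tau>' \<subseteq> {a, b}"
      using c c' by auto
    then have "z \<in> closed_segment a b"
      using z hull_mono by (metis segment_convex_hull subsetD)
    then obtain s where "z = (1 - s) *\<^sub>R a + s *\<^sub>R b"
      by (auto simp: in_segment)
    then have "z - a = s *\<^sub>R (b - a)"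
      by (simp add: algebra_simps)
    then have "det2 (b - a) (z - a) = 0"
      by simp
    moreover have "z - a = (1/2) *\<^sub>R (b - a) + t *\<^sub>R (\<i> * (b - a))"
      by (rule complex_eqI) (simp_all add: z_def midpoint_def field_simps)
    then have "det2 (b - a) (z - a) = t * (norm (b - a))\<^sup>2"
      by (simp only: det2_linear det2_self det2_i_mult)
    ultimately show False
      using t assms(4) by simp
  qed
qed

section \<open>Oriented edges around a vertex and creases\<close>

definition star :: "complex \<Rightarrow> complex set set" where
  "star v = {\<sigma>\<in>T. v \<in> \<sigma>}"

definition nbrs :: "complex \<Rightarrow> complex set" where
  "nbrs v = \<Union>(star v) - {v}"

text \<open>The triangle to the left of a directed edge. The one on the right is obtained by
  reversing the edge, as \<open>wing b a\<close>.\<close>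

definition wing :: "complex \<Rightarrow> complex \<Rightarrow> complex set" where
  "wing a b = (THE \<tau>. \<tau> \<in> T \<and> left_of a b \<tau>)"

lemma wing:
  assumes "\<sigma> \<in> T" "a \<in> \<sigma>" "b \<in> \<sigma>" "a \<noteq> b"
  shows "wing a b \<in> T" "left_of a b (wing a b)"
    "\<And>\<tau>. \<tau> \<in> T \<Longrightarrow> left_of a b \<tau> \<Longrightarrow> wing a b = \<tau>"
proof -
  have "wing a b \<in> T \<and> left_of a b (wing a b)"
    unfolding wing_def by (rule theI') (rule ex1_left[OF assms])
  then show "wing a b \<in> T" "left_of a b (wing a b)"
    by blast+
  show "wing a b = \<tau>" if "\<tau> \<in> T" "left_of a b \<tau>" for \<tau>
    unfolding wing_def using that by (intro the1_equality ex1_left[OF assms] conjI)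
qed

lemma finite_nbrs: "finite (nbrs v)"
  unfolding nbrs_def star_def
  using finite_triangle by (intro finite_Diff finite_Union finite_star) blast

lemma nbrsE:
  assumes "j \<in> nbrs v"
  obtains \<sigma> where "\<sigma> \<in> T" "v \<in> \<sigma>" "j \<in> \<sigma>" "j \<noteq> v"
  using assms unfolding nbrs_def star_def by blast

lemma wing_nbrs:
  assumes "j \<in> nbrs v"
  shows "wing v j \<in> T" "left_of v j (wing v j)" "wing j v \<in> T" "left_of j v (wing j v)"
proof -
  obtain \<sigma> where s: "\<sigma> \<in> T" "v \<in> \<sigma>" "j \<in> \<sigma>" "j \<noteq> v"
    using nbrsE[OF assms] by blast
  show "wing v j \<in> T" "left_of v j (wing v j)" "wing j v \<in> T" "left_of j v (wing j v)"
    by (rule wing(1,2)[OF s(1,2,3) s(4)[symmetric]] wing(1,2)[OF s(1,3,2,4)])+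
qed

text \<open>This and its companion replace a cyclic order of the triangles around \<open>v\<close>:
  listed counterclockwise as \<open>v\<close>, \<open>b\<close>, \<open>c\<close>, a triangle lies
  left of the edge from \<open>v\<close> to \<open>b\<close> and right of the edge from
  \<open>v\<close> to \<open>c\<close>. Two edges with the same left triangle would give it opposite
  orientations.\<close>

lemma bij_wing_left: "bij_betw (wing v) (nbrs v) (star v)"
proof (rule bij_betw_imageI)
  show "inj_on (wing v) (nbrs v)"
  proof (rule inj_onI)
    fix j j' assume j: "j \<in> nbrs v" "j' \<in> nbrs v" "wing v j = wing v j'"
    obtain c where c: "wing v j = {v, j, c}" "det2 (j - v) (c - v) > 0"
      using wing_nbrs(2)[OF j(1)] unfolding left_of_def by blast
    obtain c' where c': "wing v j = {v, j', c'}" "det2 (j' - v) (c' - v) > 0"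
      using wing_nbrs(2)[OF j(2)] j(3) unfolding left_of_def by blast
    show "j = j'"
    proof (rule ccontr)
      assume ne: "j \<noteq> j'"
      have "j' \<noteq> v" "j \<noteq> v"
        using j by (auto simp: nbrs_def)
      then have "j' = c" "c' = j"
        using c(1) c'(1) ne by blast+
      then show False
        using c(2) c'(2) det2_swap[of "j - v" "c - v"] by simp
    qed
  qed
  show "wing v ` nbrs v = star v"
  proof (intro equalityI subsetI)
    fix \<tau> assume "\<tau> \<in> wing v ` nbrs v"
    then show "\<tau> \<in> star v"
      using wing_nbrs unfolding star_def left_of_def by blast
  next
    fix \<tau> assume "\<tau> \<in> star v"
    then have \<tau>: "\<tau> \<in> T" "v \<in> \<tau>"
      by (auto simp: star_def)
    obtain b c where bc: "\<tau> = {v, b, c}" "det2 (b - v) (c - v) > 0"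
      using triangle_at[OF \<tau>] by blast
    have "b \<noteq> v"
      using bc by auto
    then have "b \<in> nbrs v" "wing v b = \<tau>"
      using bc \<tau> wing(3)[of \<tau> v b \<tau>] by (auto simp: nbrs_def star_def left_of_def)
    then show "\<tau> \<in> wing v ` nbrs v"
      by blast
  qed
qed

lemma bij_wing_right: "bij_betw (\<lambda>j. wing j v) (nbrs v) (star v)"
proof (rule bij_betw_imageI)
  show "inj_on (\<lambda>j. wing j v) (nbrs v)"
  proof (rule inj_onI)
    fix j j' assume j: "j \<in> nbrs v" "j' \<in> nbrs v" "wing j v = wing j' v"
    obtain c where c: "wing j v = {j, v, c}" "det2 (v - j) (c - j) > 0"
      using wing_nbrs(4)[OF j(1)] unfolding left_of_def by blast
    obtain c' where c': "wing j v = {j', v, c'}" "det2 (v - j') (c' - j') > 0"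
      using wing_nbrs(4)[OF j(2)] j(3) unfolding left_of_def by blast
    show "j = j'"
    proof (rule ccontr)
      assume ne: "j \<noteq> j'"
      have "j' \<noteq> v" "j \<noteq> v"
        using j by (auto simp: nbrs_def)
      then have "j' = c" "c' = j"
        using c(1) c'(1) ne by blast+
      then show False
        using c(2) c'(2) det2_perm[where a = v and b = j and c = c] by simp
    qed
  qed
  show "(\<lambda>j. wing j v) ` nbrs v = star v"
  proof (intro equalityI subsetI)
    fix \<tau> assume "\<tau> \<in> (\<lambda>j. wing j v) ` nbrs v"
    then show "\<tau> \<in> star v"
      using wing_nbrs unfolding star_def left_of_def by blast
  next
    fix \<tau> assume "\<tau> \<in> star v"
    then have \<tau>: "\<tau> \<in> T" "v \<in> \<tau>"
      by (auto simp: star_def)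
    obtain b c where bc: "\<tau> = {v, b, c}" "det2 (b - v) (c - v) > 0"
      using triangle_at[OF \<tau>] by blast
    have "c \<noteq> v" "left_of c v \<tau>"
      using bc det2_perm[where a = v and b = b and c = c] by (auto simp: left_of_def intro!: exI[of _ b])
    then have "c \<in> nbrs v" "wing c v = \<tau>"
      using bc \<tau> wing(3)[of \<tau> c v \<tau>] by (auto simp: nbrs_def star_def)
    then show "\<tau> \<in> (\<lambda>j. wing j v) ` nbrs v"
      by blast
  qed
qed

text \<open>The coefficient of the gradient jump along the quarter turn of the edge
  \<open>u = j - v\<close>; \<open>det2\<close> extracts it, since \<open>det2 u (\<i> * u)\<close>
  is the squared length of \<open>u\<close>.\<close>

definition crease :: "complex \<Rightarrow> complex \<Rightarrow> real" where
  "crease v j = det2 (j - v) (grad (wing v j) - grad (wing j v)) / (norm (j - v))\<^sup>2"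

text \<open>The two affine pieces agree along the edge, so the jump is orthogonal to it. The sign
  comes from the supporting plane of the right triangle, which lies below the graph at the third
  vertex of the left one.\<close>

lemma crease:
  assumes "j \<in> nbrs v"
  shows "grad (wing v j) - grad (wing j v) = crease v j *\<^sub>R (\<i> * (j - v))" "crease v j \<ge> 0"
proof -
  note w = wing_nbrs[OF assms]
  obtain k where k: "wing v j = {v, j, k}" "det2 (j - v) (k - v) > 0"
    using w(2) unfolding left_of_def by blast
  have R: "v \<in> convex hull (wing j v)" "j \<in> convex hull (wing j v)"
    using w(4) unfolding left_of_def by (blast intro: hull_inc)+
  have L: "v \<in> convex hull (wing v j)" "j \<in> convex hull (wing v j)" "k \<in> convex hull (wing v j)"
    using k by (auto simp: hull_inc)
  have ne: "j - v \<noteq> 0"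
    using assms by (auto simp: nbrs_def)
  have "(grad (wing v j) - grad (wing j v)) \<bullet> (j - v) = 0"
    using grad[OF w(1) L(2,1)] grad[OF w(3) R(2,1)] by (simp add: inner_diff_left)
  then obtain r where r: "grad (wing v j) - grad (wing j v) = r *\<^sub>R (\<i> * (j - v))"
    using orthogonal_imp_i_mult ne by blast
  then have "crease v j = r"
    using ne unfolding crease_def r det2_linear det2_i_mult by simp
  then show "grad (wing v j) - grad (wing j v) = crease v j *\<^sub>R (\<i> * (j - v))"
    using r by simp
  have "(grad (wing v j) - grad (wing j v)) \<bullet> (k - v) \<ge> 0"
    using grad_support[OF w(3) R(1), of k] grad[OF w(1) L(3,1)] by (simp add: inner_diff_left)
  then have "r * det2 (j - v) (k - v) \<ge> 0"
    unfolding r by (simp only: inner_scaleR_left inner_i_mult)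
  then show "crease v j \<ge> 0"
    using k(2) \<open>crease v j = r\<close> by (simp add: zero_le_mult_iff)
qed

text \<open>
  As in the simplex method, an affine function that is not minimal at a vertex decreases along some
  edge. Edges inside a flat face are excluded by choosing an extreme point of the optimal face of
  the vertex figure.
\<close>

lemma improving_edge:
  assumes v: "v \<in> \<Union>T" and y: "f y - p \<bullet> y < f v - p \<bullet> v"
  obtains j where "j \<in> nbrs v" "crease v j \<noteq> 0" "f j - p \<bullet> j < f v - p \<bullet> v"
proof -
  obtain p0 where p0: "\<And>y. y \<noteq> v \<Longrightarrow> f v + p0 \<bullet> (y - v) < f y"
    using strict_support[OF v] by blast
  \<comment> \<open>\<open>a\<close> is the height over a strict supporting plane, so dividing by it
    cuts the cone at \<open>v\<close> by a plane: the points \<open>x z\<close> belong to the vertex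
    figure. \<open>H\<close> is the change of the objective from \<open>v\<close>, and
    \<open>\<rho>\<close> is its value after the same normalisation.\<close>
  define a where "a = (\<lambda>z. f z - f v - p0 \<bullet> (z - v))"
  define H where "H = (\<lambda>z. f z - f v - p \<bullet> (z - v))"
  define \<rho> where "\<rho> = (\<lambda>z. H z / a z)"
  define x where "x = (\<lambda>z. (1 / a z) *\<^sub>R (z - v))"
  have a_pos: "a z > 0" if "z \<noteq> v" for z
    using p0[OF that] by (simp add: a_def)
  have neg_iff: "H z < 0 \<longleftrightarrow> f z - p \<bullet> z < f v - p \<bullet> v" for z
    by (auto simp: H_def inner_diff_right)
  \<comment> \<open>Convexity allows moving \<open>y\<close> close to \<open>v\<close> while
    \<open>H\<close> stays negative. On the triangle at \<open>v\<close> reached there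
    \<open>H\<close> is linear, so it is negative at one of the two other vertices.\<close>
  have "\<exists>j\<in>nbrs v. H j < 0"
  proof -
    obtain e where e: "e > 0" and
      loc: "\<And>\<sigma> z. \<sigma> \<in> T \<Longrightarrow> dist v z < e \<Longrightarrow> z \<in> convex hull \<sigma> \<Longrightarrow> v \<in> convex hull \<sigma>"
      using local_triangles[of v] by blast
    have "y \<noteq> v"
      using y by auto
    define t where "t = min 1 (e / (2 * norm (y - v)))"
    have t: "t > 0" "t \<le> 1" "t * norm (y - v) < e"
      using small_scale[OF e, of "y - v"] \<open>y \<noteq> v\<close> unfolding t_def right_minus_eq by blast+
    define y' where "y' = v + t *\<^sub>R (y - v)"
    have "f y' \<le> f v + t * (f y - f v)"
      using convexD_seg t by (simp add: y'_def)
    then have "H y' \<le> t * H y"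
      by (simp add: H_def y'_def algebra_simps)
    also have "\<dots> < 0"
      using t y neg_iff by (simp add: mult_pos_neg)
    finally have Hy': "H y' < 0" .
    obtain \<sigma> where s: "\<sigma> \<in> T" "y' \<in> convex hull \<sigma>"
      using cover by blast
    have "v \<in> convex hull \<sigma>"
      using loc[OF s(1) _ s(2)] t by (simp add: dist_norm y'_def)
    then have "v \<in> \<sigma>"
      using vertex_in_triangle[OF v s(1)] by simp
    then obtain b c where bc: "\<sigma> = {v, b, c}" "det2 (b - v) (c - v) > 0"
      using triangle_at[OF s(1)] by blast
    have "b \<noteq> v" "c \<noteq> v"
      using bc by auto
    then have N: "b \<in> nbrs v" "c \<in> nbrs v"
      using s(1) \<open>v \<in> \<sigma>\<close> bc(1) by (auto simp: nbrs_def star_def)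
    obtain \<mu> \<nu> where mn: "0 \<le> \<mu>" "0 \<le> \<nu>" "y' = v + \<mu> *\<^sub>R (b - v) + \<nu> *\<^sub>R (c - v)"
      using s(2) unfolding bc(1) in_triangle_iff by blast
    have lin: "H z = (grad \<sigma> - p) \<bullet> (z - v)" if "z \<in> convex hull \<sigma>" for z
      using grad[OF s(1) that \<open>v \<in> convex hull \<sigma>\<close>] by (simp add: H_def inner_diff_left)
    have "y' - v = \<mu> *\<^sub>R (b - v) + \<nu> *\<^sub>R (c - v)"
      using mn by simp
    moreover have "b \<in> convex hull \<sigma>" "c \<in> convex hull \<sigma>"
      using bc(1) by (auto simp: hull_inc)
    ultimately have "H y' = \<mu> * H b + \<nu> * H c"
      using s(2) by (simp only: lin inner_add_right inner_scaleR_right)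
    then have "H b < 0 \<or> H c < 0"
      using Hy' mn(1,2) by (smt (verit) mult_nonneg_nonneg)
    then show ?thesis
      using N by blast
  qed
  then obtain j0 where j0: "j0 \<in> nbrs v" "H j0 < 0"
    by blast
  define m where "m = Min (\<rho> ` nbrs v)"
  have m_le: "m \<le> \<rho> j" if "j \<in> nbrs v" for j
    using that finite_nbrs by (simp add: m_def)
  define M where "M = {j\<in>nbrs v. \<rho> j = m}"
  have "m \<in> \<rho> ` nbrs v"
    unfolding m_def using finite_nbrs j0 by (intro Min_in) auto
  then have M: "finite M" "M \<noteq> {}"
    using finite_nbrs by (auto simp: M_def)
  \<comment> \<open>Extremality among the minimisers is obtained by maximising the norm.\<close>
  obtain j where j: "j \<in> M" and jmax: "\<And>i. i \<in> M \<Longrightarrow> norm (x i) \<le> norm (x j)"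
  proof -
    have "Max ((\<lambda>i. norm (x i)) ` M) \<in> (\<lambda>i. norm (x i)) ` M"
      using M by (intro Max_in) auto
    then obtain j where "j \<in> M" "Max ((\<lambda>i. norm (x i)) ` M) = norm (x j)"
      by blast
    moreover have "norm (x i) \<le> Max ((\<lambda>i. norm (x i)) ` M)" if "i \<in> M" for i
      using M that by simp
    ultimately show ?thesis
      using that by metis
  qed
  have jN: "j \<in> nbrs v" and jm: "\<rho> j = m"
    using j by (auto simp: M_def)
  have nbr_ne: "i \<noteq> v" if "i \<in> nbrs v" for i
    using that by (auto simp: nbrs_def)
  have "m < 0"
    using m_le[OF j0(1)] j0(2) a_pos[OF nbr_ne[OF j0(1)]] by (simp add: \<rho>_def divide_neg_pos order_le_less_trans)
  then have "H j < 0"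
    using jm a_pos[OF nbr_ne[OF jN]] by (auto simp: \<rho>_def divide_less_0_iff)
  moreover have "crease v j \<noteq> 0"
  proof
    \<comment> \<open>Both triangles at the edge then lie in one plane, and \<open>x j\<close> is a
      convex combination of \<open>x k\<close> and \<open>x l\<close> with positive weights.
      Minimality puts \<open>k\<close> and \<open>l\<close> in \<open>M\<close>, and maximality of
      the norm forces \<open>x k = x j\<close>, against \<open>A > 0\<close>.\<close>
    assume "crease v j = 0"
    define g where "g = grad (wing v j)"
    have g': "grad (wing j v) = g"
      using crease(1)[OF jN] \<open>crease v j = 0\<close> by (simp add: g_def)
    note w = wing_nbrs[OF jN]
    obtain k where k: "wing v j = {v, j, k}" "det2 (j - v) (k - v) > 0"
      using w(2) unfolding left_of_def by blast
    obtain l where l: "wing j v = {j, v, l}" "det2 (v - j) (l - j) > 0"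
      using w(4) unfolding left_of_def by blast
    have l2: "det2 (j - v) (l - v) < 0"
      using l(2) det2_perm[where a = v and b = j and c = l] by simp
    have kl: "k \<in> nbrs v" "l \<in> nbrs v"
      using k l l2 w by (auto simp: nbrs_def star_def)
    have lin: "f z - f v = g \<bullet> (z - v)" if "z \<in> {j, k, l}" for z
    proof -
      have "z \<in> wing v j \<or> z \<in> wing j v"
        using that unfolding k(1) l(1) by blast
      then show ?thesis
      proof
        assume "z \<in> wing v j"
        moreover have "v \<in> wing v j"
          unfolding k(1) by simp
        ultimately show ?thesis
          unfolding g_def by (intro grad[OF w(1)] hull_inc)
      next
        assume "z \<in> wing j v"
        moreover have "v \<in> wing j v"
          unfolding l(1) by simp
        ultimately show ?thesis
          unfolding g'[symmetric] by (intro grad[OF w(3)] hull_inc)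
      qed
    qed
    have one: "(g - p0) \<bullet> x z = 1" and rho: "\<rho> z = (g - p) \<bullet> x z" if "z \<in> {j, k, l}" for z
    proof -
      have "z \<noteq> v"
        using that jN kl nbr_ne by blast
      then have "a z \<noteq> 0"
        using a_pos[of z] by simp
      moreover have "a z = (g - p0) \<bullet> (z - v)" "H z = (g - p) \<bullet> (z - v)"
        using lin[OF that] by (simp_all add: a_def H_def inner_diff_left)
      ultimately show "(g - p0) \<bullet> x z = 1" "\<rho> z = (g - p) \<bullet> x z"
        unfolding x_def \<rho>_def by (simp_all only: inner_scaleR_right) simp_all
    qed
    define A where "A = det2 (x j) (x k)"
    define B where "B = - det2 (x j) (x l)"
    have A: "A > 0"
      using k(2) a_pos nbr_ne jN kl by (simp add: A_def x_def del: det2_linear(1,2))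
    have B: "B > 0"
      using l2 a_pos nbr_ne jN kl by (simp add: B_def x_def del: det2_linear(1,2) add: divide_neg_pos)
    have "x j \<noteq> 0"
      using one[of j] by auto
    have "det2 (x j) (B *\<^sub>R x k + A *\<^sub>R x l) = 0"
      by (simp only: det2_linear) (simp add: A_def B_def)
    then obtain s where s: "B *\<^sub>R x k + A *\<^sub>R x l = s *\<^sub>R x j"
      using det2_zero_imp_scaleR \<open>x j \<noteq> 0\<close> by blast
    then have "(g - p0) \<bullet> (B *\<^sub>R x k + A *\<^sub>R x l) = (g - p0) \<bullet> (s *\<^sub>R x j)"
      by simp
    then have "s = B + A"
      using one by (simp only: inner_add_right inner_scaleR_right) simp
    have "(g - p) \<bullet> (B *\<^sub>R x k + A *\<^sub>R x l) = (g - p) \<bullet> (s *\<^sub>R x j)"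
      using s by simp
    then have "B * \<rho> k + A * \<rho> l = s * m"
      by (simp only: inner_add_right inner_scaleR_right rho insertI1 insertI2 flip: jm)
    then have "B * (\<rho> k - m) + A * (\<rho> l - m) = 0"
      by (simp add: \<open>s = B + A\<close> algebra_simps)
    moreover have "B * (\<rho> k - m) \<ge> 0" "A * (\<rho> l - m) \<ge> 0"
      using A B m_le kl by simp_all
    ultimately have "B * (\<rho> k - m) = 0" "A * (\<rho> l - m) = 0"
      by linarith+
    then have "k \<in> M" "l \<in> M"
      using A B kl by (auto simp: M_def)
    define q where "q = x j \<bullet> x j"
    have le: "x i \<bullet> x j \<le> q" if "i \<in> M" for i
    proof -
      have "x i \<bullet> x j \<le> norm (x i) * norm (x j)"
        by (rule norm_cauchy_schwarz)
      also have "\<dots> \<le> norm (x j) * norm (x j)"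
        by (intro mult_right_mono jmax that) simp
      finally show ?thesis
        by (simp add: q_def dot_square_norm power2_eq_square)
    qed
    have "(B *\<^sub>R x k + A *\<^sub>R x l) \<bullet> x j = (B + A) * q"
      unfolding s \<open>s = B + A\<close> q_def by simp
    then have "B * (q - x k \<bullet> x j) + A * (q - x l \<bullet> x j) = 0"
      by (simp add: inner_add_left algebra_simps)
    moreover have "B * (q - x k \<bullet> x j) \<ge> 0" "A * (q - x l \<bullet> x j) \<ge> 0"
      using A B le \<open>k \<in> M\<close> \<open>l \<in> M\<close> by simp_all
    ultimately have "B * (q - x k \<bullet> x j) = 0"
      by linarith
    then have kq: "x k \<bullet> x j = q"
      using B by simp
    have "x k \<bullet> x k \<le> q"
      using jmax[OF \<open>k \<in> M\<close>] by (simp add: q_def dot_square_norm power_mono)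
    then have "(x k - x j) \<bullet> (x k - x j) \<le> 0"
      using kq by (simp add: inner_diff_left inner_diff_right inner_commute[of "x j" "x k"] flip: q_def)
    then have "(norm (x k - x j))\<^sup>2 \<le> 0"
      by (simp only: power2_norm_eq_inner)
    then have "x k = x j"
      by simp
    then show False
      using A by (simp add: A_def)
  qed
  ultimately show thesis
    using that jN neg_iff by blast
qed

section \<open>Propagation across edges\<close>

lemma closed_Union_hulls:
  assumes "T' \<subseteq> T"
  shows "closed (\<Union>((hull) convex ` T'))"
  unfolding closed_def open_contains_ball
proof
  fix y assume y: "y \<in> - \<Union>((hull) convex ` T')"
  obtain e where e: "e > 0" and
    loc: "\<And>\<sigma> z. \<sigma> \<in> T \<Longrightarrow> dist y z < e \<Longrightarrow> z \<in> convex hull \<sigma> \<Longrightarrow> y \<in> convex hull \<sigma>"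
    using local_triangles[of y] by blast
  have "ball y e \<subseteq> - \<Union>((hull) convex ` T')"
    using loc assms y by (auto simp: subset_iff)
  then show "\<exists>e>0. ball y e \<subseteq> - \<Union>((hull) convex ` T')"
    using e by blast
qed

text \<open>The plane without the countably many vertices is connected. It is covered by two closed
  sets, the triangles with value \<open>h \<sigma>\<close> and the others. If these met outside the
  vertices, two triangles with different values would share an edge.\<close>

lemma constant_on_triangles:
  assumes edge: "\<And>\<sigma> \<tau> i j. \<sigma> \<in> T \<Longrightarrow> \<tau> \<in> T \<Longrightarrow> i \<in> \<sigma> \<inter> \<tau> \<Longrightarrow> j \<in> \<sigma> \<inter> \<tau> \<Longrightarrow> i \<noteq> j \<Longrightarrow> h \<sigma> = h \<tau>"
    and "\<sigma> \<in> T" "\<tau> \<in> T"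
  shows "h \<sigma> = h \<tau>"
proof (rule ccontr)
  assume ne: "h \<sigma> \<noteq> h \<tau>"
  define A where "A = \<Union>((hull) convex ` {\<rho>\<in>T. h \<rho> = h \<sigma>})"
  define B where "B = \<Union>((hull) convex ` {\<rho>\<in>T. h \<rho> \<noteq> h \<sigma>})"
  \<comment> \<open>Both closed sets must reach outside the vertex set; an edge midpoint
    does.\<close>
  have nonvertex: "\<exists>x\<in>convex hull \<rho>. x \<notin> \<Union>T" if "\<rho> \<in> T" for \<rho>
  proof -
    obtain a where "a \<in> \<rho>"
      using triangle[OF \<open>\<rho> \<in> T\<close>] by blast
    obtain b c where bc: "\<rho> = {a, b, c}" "det2 (b - a) (c - a) > 0"
      using triangle_at[OF \<open>\<rho> \<in> T\<close> \<open>a \<in> \<rho>\<close>] by blast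
    have "a \<noteq> b"
      using bc by auto
    have m: "midpoint a b \<in> convex hull {a, b}"
      by (simp flip: segment_convex_hull)
    then have m': "midpoint a b \<in> convex hull \<rho>"
      using hull_mono[of "{a, b}" \<rho> convex] bc(1) by blast
    have "midpoint a b \<notin> \<Union>T"
    proof
      assume "midpoint a b \<in> \<Union>T"
      then have "midpoint a b \<in> {a, b}"
        using vertex_in_hull[OF that _ vertex_in_triangle[OF _ that m'] m] bc(1) by blast
      then show False
        using \<open>a \<noteq> b\<close> by simp
    qed
    then show ?thesis
      using m' by blast
  qed
  have "closed A" "closed B"
    by (auto simp: A_def B_def intro!: closed_Union_hulls)
  moreover have "- \<Union>T \<subseteq> A \<union> B"
    using cover by (fastforce simp: A_def B_def)
  moreover have "A \<inter> B \<inter> - \<Union>T = {}"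
  proof (rule ccontr)
    assume "A \<inter> B \<inter> - \<Union>T \<noteq> {}"
    then obtain y where AB: "y \<in> A" "y \<in> B" and y: "y \<notin> \<Union>T"
      by blast
    obtain \<rho> where \<rho>: "\<rho> \<in> T" "h \<rho> = h \<sigma>" "y \<in> convex hull \<rho>"
      using AB(1) unfolding A_def by blast
    obtain \<rho>' where \<rho>': "\<rho>' \<in> T" "h \<rho>' \<noteq> h \<sigma>" "y \<in> convex hull \<rho>'"
      using AB(2) unfolding B_def by blast
    have r: "\<rho> \<in> T" "\<rho>' \<in> T" "h \<rho> \<noteq> h \<rho>'"
      using \<rho> \<rho>' by simp_all
    have hull: "y \<in> convex hull (\<rho> \<inter> \<rho>')"
      unfolding inter[OF r(1,2), symmetric] using \<rho>(3) \<rho>'(3) by (rule IntI)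
    then have "\<rho> \<inter> \<rho>' \<noteq> {}"
      by auto
    then obtain i where i: "i \<in> \<rho> \<inter> \<rho>'"
      by blast
    then have "\<rho> \<inter> \<rho>' = {i}"
      using edge[OF r(1,2) i] r(3) by blast
    then have "y = i"
      using hull by simp
    then show False
      using i r(1) y by blast
  qed
  moreover have "A \<inter> - \<Union>T \<noteq> {}"
    using nonvertex[OF assms(2)] assms(2) unfolding A_def by blast
  moreover have "B \<inter> - \<Union>T \<noteq> {}"
    using nonvertex[OF assms(3)] assms(3) ne[symmetric] unfolding B_def by blast
  moreover have "connected (- \<Union>T)"
    by (intro path_connected_imp_connected path_connected_complement_countable countable_vertices) simp
  ultimately show False
    unfolding connected_closed by blast
qed

end

text \<open>\<open>flex\<close> says that the velocities \<open>(\<eta> i, \<beta> i)\<close> of the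
  points \<open>(i, f i)\<close> preserve the edges to first order in the indefinite form
  \<open>|dy|^2 - ds^2\<close>. \<open>attains_max\<close> takes the place of compactness.\<close>

locale flexed_triangulated = convex_triangulated +
  fixes \<beta> :: "complex \<Rightarrow> real" and \<eta> :: "complex \<Rightarrow> complex"
  assumes flex: "\<sigma> \<in> T \<Longrightarrow> i \<in> \<sigma> \<Longrightarrow> j \<in> \<sigma> \<Longrightarrow> (\<beta> i - \<beta> j) * (f i - f j) = (\<eta> i - \<eta> j) \<bullet> (i - j)"
    and attains_max: "\<exists>v\<in>\<Union>T. \<forall>w\<in>\<Union>T. \<beta> w \<le> \<beta> v"
begin

text \<open>Along the sides \<open>f\<close> has slope \<open>grad \<sigma>\<close>, so subtracting
  the gradient term leaves velocities that preserve the lengths of the plane triangle. Such a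
  triangle can only translate and rotate.\<close>

lemma ex_rotation:
  assumes "\<sigma> \<in> T"
  shows "\<exists>r w. \<forall>i\<in>\<sigma>. \<eta> i = w + \<beta> i *\<^sub>R grad \<sigma> + r *\<^sub>R (\<i> * i)"
proof -
  obtain a b c where s: "\<sigma> = {a, b, c}" and d: "det2 (b - a) (c - a) \<noteq> 0"
    using triangle[OF assms] by blast
  define m where "m = (\<lambda>i. \<eta> i - \<beta> i *\<^sub>R grad \<sigma>)"
  have orth: "(m i - m j) \<bullet> (i - j) = 0" if "i \<in> \<sigma>" "j \<in> \<sigma>" for i j
  proof -
    have "f i - f j = grad \<sigma> \<bullet> (i - j)"
      using that by (intro grad[OF assms] hull_inc)
    then have "(\<beta> i - \<beta> j) * (grad \<sigma> \<bullet> (i - j)) = (\<eta> i - \<eta> j) \<bullet> (i - j)"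
      using flex[OF assms that] by simp
    moreover have "m i - m j = (\<eta> i - \<eta> j) - (\<beta> i - \<beta> j) *\<^sub>R grad \<sigma>"
      by (simp add: m_def algebra_simps)
    ultimately show ?thesis
      by (simp add: inner_diff_left)
  qed
  have "b - a \<noteq> 0" "c - a \<noteq> 0"
    using d by auto
  \<comment> \<open>The two sides at \<open>a\<close> give rotation rates \<open>r\<close> and
    \<open>r'\<close>; the third side forces them to agree.\<close>
  obtain r where r: "m b - m a = r *\<^sub>R (\<i> * (b - a))"
    using orthogonal_imp_i_mult[OF orth \<open>b - a \<noteq> 0\<close>] s by blast
  obtain r' where r': "m c - m a = r' *\<^sub>R (\<i> * (c - a))"
    using orthogonal_imp_i_mult[OF orth \<open>c - a \<noteq> 0\<close>] s by blast
  have "(m b - m c) \<bullet> (b - c) = 0"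
    using orth s by blast
  moreover have "m b - m c = r *\<^sub>R (\<i> * (b - a)) - r' *\<^sub>R (\<i> * (c - a))" "b - c = (b - a) - (c - a)"
    by (simp_all flip: r r')
  ultimately have "(r *\<^sub>R (\<i> * (b - a)) - r' *\<^sub>R (\<i> * (c - a))) \<bullet> ((b - a) - (c - a)) = 0"
    by metis
  then have "r * (- det2 (b - a) (c - a)) - r' * det2 (c - a) (b - a) = 0"
    by (simp only: inner_diff_left inner_diff_right[of _ "b - a"] inner_scaleR_left inner_i_mult det2_self)
  then have "(r' - r) * det2 (b - a) (c - a) = 0"
    by (simp only: det2_swap[of "c - a"]) (simp add: algebra_simps)
  then have "r' = r"
    using d by simp
  have "\<eta> i = (m a - r *\<^sub>R (\<i> * a)) + \<beta> i *\<^sub>R grad \<sigma> + r *\<^sub>R (\<i> * i)" if "i \<in> \<sigma>" for i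
  proof -
    have "m i = m a + r *\<^sub>R (\<i> * (i - a))"
      using that r r' \<open>r' = r\<close> unfolding s by (auto simp: algebra_simps)
    then show ?thesis
      by (simp add: m_def algebra_simps)
  qed
  then show ?thesis
    by blast
qed

definition rotation :: "complex set \<Rightarrow> real" where
  "rotation \<sigma> = (SOME r. \<exists>w. \<forall>i\<in>\<sigma>. \<eta> i = w + \<beta> i *\<^sub>R grad \<sigma> + r *\<^sub>R (\<i> * i))"

lemma rotation:
  assumes "\<sigma> \<in> T"
  obtains w where "\<And>i. i \<in> \<sigma> \<Longrightarrow> \<eta> i = w + \<beta> i *\<^sub>R grad \<sigma> + rotation \<sigma> *\<^sub>R (\<i> * i)"
proof -
  have "\<exists>w. \<forall>i\<in>\<sigma>. \<eta> i = w + \<beta> i *\<^sub>R grad \<sigma> + rotation \<sigma> *\<^sub>R (\<i> * i)"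
    unfolding rotation_def by (rule someI_ex) (rule ex_rotation[OF assms])
  then show thesis
    using that by blast
qed

text \<open>\<open>\<eta> j - \<eta> v\<close> is computed in both triangles at the edge. The
  gradient jump is a multiple of the quarter turn of the edge, so only coefficients of that vector
  remain to be compared.\<close>

lemma rotation_jump:
  assumes "j \<in> nbrs v"
  shows "rotation (wing v j) - rotation (wing j v) = crease v j * (\<beta> v - \<beta> j)"
proof -
  note w = wing_nbrs[OF assms]
  have L: "v \<in> wing v j" "j \<in> wing v j" and R: "v \<in> wing j v" "j \<in> wing j v"
    using w(2,4) unfolding left_of_def by blast+
  obtain a where "\<And>i. i \<in> wing v j \<Longrightarrow> \<eta> i = a + \<beta> i *\<^sub>R grad (wing v j) + rotation (wing v j) *\<^sub>R (\<i> * i)"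
    using rotation[OF w(1)] by blast
  from this[OF L(1)] this[OF L(2)] have 1: "\<eta> j - \<eta> v = (\<beta> j - \<beta> v) *\<^sub>R grad (wing v j) + rotation (wing v j) *\<^sub>R (\<i> * (j - v))"
    by (simp add: algebra_simps)
  obtain b where "\<And>i. i \<in> wing j v \<Longrightarrow> \<eta> i = b + \<beta> i *\<^sub>R grad (wing j v) + rotation (wing j v) *\<^sub>R (\<i> * i)"
    using rotation[OF w(3)] by blast
  from this[OF R(1)] this[OF R(2)] have 2: "\<eta> j - \<eta> v = (\<beta> j - \<beta> v) *\<^sub>R grad (wing j v) + rotation (wing j v) *\<^sub>R (\<i> * (j - v))"
    by (simp add: algebra_simps)
  have "(\<beta> j - \<beta> v) *\<^sub>R (grad (wing v j) - grad (wing j v))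
      + (rotation (wing v j) - rotation (wing j v)) *\<^sub>R (\<i> * (j - v)) = 0"
  proof -
    have *: "a - c + (b - d) = 0" if "a + b = c + d" for a b c d :: complex
      using that by (simp add: algebra_simps)
    show ?thesis
      unfolding scaleR_diff_right[of "\<beta> j - \<beta> v"] scaleR_diff_left[of "rotation (wing v j)"]
      by (rule *) (simp only: flip: 1 2)
  qed
  then have "((\<beta> j - \<beta> v) * crease v j + (rotation (wing v j) - rotation (wing j v))) *\<^sub>R (\<i> * (j - v)) = 0"
    unfolding crease(1)[OF assms] by (simp only: scaleR_scaleR scaleR_add_left)
  moreover have "j \<noteq> v"
    using assms unfolding nbrs_def by blast
  ultimately have "(\<beta> j - \<beta> v) * crease v j + (rotation (wing v j) - rotation (wing j v)) = 0"
    by simp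
  then show ?thesis
    by (simp add: algebra_simps)
qed

text \<open>
  The rotation numbers of the triangles around \<open>v\<close> telescope: each triangle lies to the left of
  exactly one edge at \<open>v\<close> and to the right of exactly one.
\<close>

lemma harmonic: "(\<Sum>j\<in>nbrs v. crease v j * (\<beta> v - \<beta> j)) = 0"
proof -
  have "(\<Sum>j\<in>nbrs v. crease v j * (\<beta> v - \<beta> j)) = (\<Sum>j\<in>nbrs v. rotation (wing v j) - rotation (wing j v))"
    by (intro sum.cong refl) (simp add: rotation_jump)
  also have "\<dots> = (\<Sum>j\<in>nbrs v. rotation (wing v j)) - (\<Sum>j\<in>nbrs v. rotation (wing j v))"
    by (rule sum_subtractf)
  also have "(\<Sum>j\<in>nbrs v. rotation (wing v j)) = sum rotation (star v)"
    by (rule sum.reindex_bij_betw[OF bij_wing_left])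
  also have "(\<Sum>j\<in>nbrs v. rotation (wing j v)) = sum rotation (star v)"
    by (rule sum.reindex_bij_betw[OF bij_wing_right])
  finally show ?thesis
    by simp
qed

text \<open>If \<open>\<beta> j\<close> is not maximal, let \<open>l\<close> be \<open>f\<close>
  minus a linear function with its only minimum at \<open>j\<close>, and let \<open>i\<close>
  minimise \<open>l\<close> among the vertices of maximal \<open>\<beta>\<close>. An improving edge
  of nonzero crease leads from \<open>i\<close> to some \<open>k\<close> with smaller
  \<open>l\<close>; harmonicity at a maximum gives \<open>\<beta> k = \<beta> i\<close>,
  contradicting the choice of \<open>i\<close>.\<close>

lemma \<beta>_constant:
  obtains k where "\<And>v. v \<in> \<Union>T \<Longrightarrow> \<beta> v = k"
proof -
  obtain v0 where v0: "v0 \<in> \<Union>T" "\<And>w. w \<in> \<Union>T \<Longrightarrow> \<beta> w \<le> \<beta> v0"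
    using attains_max by blast
  have "\<beta> j = \<beta> v0" if j: "j \<in> \<Union>T" for j
  proof (rule ccontr)
    assume ne: "\<beta> j \<noteq> \<beta> v0"
    obtain p where p: "\<And>y. y \<noteq> j \<Longrightarrow> f j + p \<bullet> (y - j) < f y"
      using strict_support[OF j] by blast
    define l where "l = (\<lambda>y. f y - p \<bullet> y)"
    \<comment> \<open>The bound by \<open>l v0\<close> makes the set finite without losing the
      minimum.\<close>
    define M where "M = {v\<in>\<Union>T. \<beta> v = \<beta> v0 \<and> l v \<le> l v0}"
    have "finite M"
      by (rule finite_subset[OF _ finite_sublevel[of p "l v0"]]) (auto simp: M_def l_def)
    moreover have "v0 \<in> M"
      using v0(1) by (simp add: M_def)
    ultimately have "Min (l ` M) \<in> l ` M" "\<And>v. v \<in> M \<Longrightarrow> Min (l ` M) \<le> l v"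
      by (auto intro!: Min_in)
    then obtain i where i: "i \<in> M" and imin: "\<And>v. v \<in> M \<Longrightarrow> l i \<le> l v"
      by force
    have iT: "i \<in> \<Union>T" and \<beta>i: "\<beta> i = \<beta> v0"
      using i by (auto simp: M_def)
    have "i \<noteq> j"
      using \<beta>i ne by blast
    then have "l j < l i"
      using p[of i] by (simp add: l_def inner_diff_right)
    then obtain k where k: "k \<in> nbrs i" "crease i k \<noteq> 0" "l k < l i"
      using improving_edge[OF iT, of j p] unfolding l_def by blast
    have T: "x \<in> \<Union>T" if "x \<in> nbrs i" for x
      using that unfolding nbrs_def star_def by blast
    have "crease i k * (\<beta> i - \<beta> k) = 0"
    proof -
      have "\<forall>x\<in>nbrs i. crease i x * (\<beta> i - \<beta> x) = 0"
        using harmonic[of i] crease(2) T v0(2) \<beta>i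
        by (subst (asm) sum_nonneg_eq_0_iff[OF finite_nbrs]) auto
      then show ?thesis
        using k(1) by blast
    qed
    then have "\<beta> k = \<beta> v0"
      using k(2) \<beta>i by simp
    then have "k \<in> M"
      using k(1,3) i T by (auto simp: M_def)
    then show False
      using imin k(3) by fastforce
  qed
  then show thesis
    using that by blast
qed

text \<open>For constant \<open>\<beta>\<close> the gradient term on a triangle is part of its
  translation. An infinitesimal plane motion is determined by its values at two points, so the
  motions of triangles sharing an edge agree.\<close>

theorem flex_trivial:
  obtains k w r where "\<And>v. v \<in> \<Union>T \<Longrightarrow> \<beta> v = k" "\<And>v. v \<in> \<Union>T \<Longrightarrow> \<eta> v = w + r *\<^sub>R (\<i> * v)"
proof -
  obtain k where k: "\<And>v. v \<in> \<Union>T \<Longrightarrow> \<beta> v = k"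
    using \<beta>_constant by blast
  define motion where "motion = (\<lambda>\<sigma> (r, w). \<forall>i\<in>\<sigma>. \<eta> i = w + r *\<^sub>R (\<i> * i))"
  define h where "h = (\<lambda>\<sigma>. SOME rw. motion \<sigma> rw)"
  have h: "motion \<sigma> (h \<sigma>)" if "\<sigma> \<in> T" for \<sigma>
  proof -
    obtain w where w: "\<And>i. i \<in> \<sigma> \<Longrightarrow> \<eta> i = w + \<beta> i *\<^sub>R grad \<sigma> + rotation \<sigma> *\<^sub>R (\<i> * i)"
      using rotation[OF \<open>\<sigma> \<in> T\<close>] by blast
    have "\<eta> i = (w + k *\<^sub>R grad \<sigma>) + rotation \<sigma> *\<^sub>R (\<i> * i)" if "i \<in> \<sigma>" for i
      using w[OF that] k[of i] that \<open>\<sigma> \<in> T\<close> by auto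
    then have "motion \<sigma> (rotation \<sigma>, w + k *\<^sub>R grad \<sigma>)"
      by (simp add: motion_def)
    then show ?thesis
      unfolding h_def by (rule someI)
  qed
  have eq: "h \<sigma> = h \<tau>" if st: "\<sigma> \<in> T" "\<tau> \<in> T" "i \<in> \<sigma> \<inter> \<tau>" "j \<in> \<sigma> \<inter> \<tau>" "i \<noteq> j" for \<sigma> \<tau> i j
  proof -
    obtain r w where rw: "h \<sigma> = (r, w)"
      by fastforce
    obtain r' w' where rw': "h \<tau> = (r', w')"
      by fastforce
    have e: "\<eta> i = w + r *\<^sub>R (\<i> * i)" "\<eta> j = w + r *\<^sub>R (\<i> * j)"
      "\<eta> i = w' + r' *\<^sub>R (\<i> * i)" "\<eta> j = w' + r' *\<^sub>R (\<i> * j)"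
      using h[OF st(1)] h[OF st(2)] st(3,4) by (auto simp: rw rw' motion_def)
    have "(r - r') *\<^sub>R (\<i> * (i - j)) = (r *\<^sub>R (\<i> * i) - r *\<^sub>R (\<i> * j)) - (r' *\<^sub>R (\<i> * i) - r' *\<^sub>R (\<i> * j))"
      by (simp add: algebra_simps)
    also have "\<dots> = (\<eta> i - \<eta> j) - (\<eta> i - \<eta> j)"
      using e by (metis add_diff_cancel_left)
    finally have "r = r'"
      using st(5) by simp
    then have "w = w'"
      using e(1,3) by simp
    then show ?thesis
      using \<open>r = r'\<close> by (simp add: rw rw')
  qed
  obtain \<sigma>0 where s0: "\<sigma>0 \<in> T"
    using cover by blast
  obtain r w where rw: "h \<sigma>0 = (r, w)"
    by fastforce
  have "\<eta> v = w + r *\<^sub>R (\<i> * v)" if vT: "v \<in> \<Union>T" for v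
  proof -
    obtain \<sigma> where s: "\<sigma> \<in> T" "v \<in> \<sigma>"
      using vT by blast
    have "h \<sigma> = (r, w)"
      using constant_on_triangles[of h, OF eq s(1) s0] rw by simp
    then show ?thesis
      using h[OF s(1)] s(2) by (simp add: motion_def)
  qed
  then show thesis
    using that k by blast
qed

end

section \<open>Minkowski space and Killing fields\<close>

lemma mink_commute: "mink x y = mink y x"
  by (simp add: mink_def)

lemma mink_add: "mink (x + y) z = mink x z + mink y z" "mink z (x + y) = mink z x + mink z y"
  by (simp_all add: mink_def algebra_simps)

lemma mink_scaleR: "mink (a *\<^sub>R x) y = a * mink x y" "mink x (a *\<^sub>R y) = a * mink x y"
  by (simp_all add: mink_def algebra_simps)

lemma mink_minus: "mink (- x) y = - mink x y" "mink x (- y) = - mink x y"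
  by (simp_all add: mink_def)

lemma mink_diff: "mink (x - y) z = mink x z - mink y z" "mink z (x - y) = mink z x - mink z y"
  by (simp_all add: mink_def algebra_simps)

lemma mink_zero [simp]: "mink 0 y = 0" "mink x 0 = 0"
  by (simp_all add: mink_def)

lemmas mink_linear = mink_add mink_diff mink_minus mink_scaleR

lemma linear_mink_left: "linear (\<lambda>x. mink x y)"
  by (rule linearI) (simp_all add: mink_linear)

lemma bounded_bilinear_mink: "bounded_bilinear mink"
  unfolding bilinear_conv_bounded_bilinear[symmetric] bilinear_def
  by (auto intro!: linearI simp: mink_linear)

lemma H3_future: "x \<in> H3 \<Longrightarrow> x$4 > 0" and H3_norm: "x \<in> H3 \<Longrightarrow> mink x x = -1"
  by (simp_all add: H3_def)

text \<open>Lagrange's identity writes the difference as a sum of squares.\<close>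

lemma cauchy_schwarz_3:
  fixes a b c x y z :: real
  shows "(a * x + b * y + c * z)\<^sup>2 \<le> (a\<^sup>2 + b\<^sup>2 + c\<^sup>2) * (x\<^sup>2 + y\<^sup>2 + z\<^sup>2)"
proof -
  have "(a\<^sup>2 + b\<^sup>2 + c\<^sup>2) * (x\<^sup>2 + y\<^sup>2 + z\<^sup>2) - (a * x + b * y + c * z)\<^sup>2
      = (a * y - b * x)\<^sup>2 + (a * z - c * x)\<^sup>2 + (b * z - c * y)\<^sup>2"
    by algebra
  then show ?thesis
    by (smt (verit) zero_le_power2)
qed

lemma mink_H3_ideal:
  assumes "x \<in> H3" "ideal_point c"
  shows "mink x c < 0"
proof -
  have x: "(x$1)\<^sup>2 + (x$2)\<^sup>2 + (x$3)\<^sup>2 = (x$4)\<^sup>2 - 1" "x$4 > 0"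
    using assms(1) by (auto simp: H3_def mink_def power2_eq_square)
  have c: "(c$1)\<^sup>2 + (c$2)\<^sup>2 + (c$3)\<^sup>2 = (c$4)\<^sup>2" "c$4 > 0"
    using assms(2) by (auto simp: ideal_point_def mink_def power2_eq_square)
  have "(x$1 * c$1 + x$2 * c$2 + x$3 * c$3)\<^sup>2 \<le> ((x$4)\<^sup>2 - 1) * (c$4)\<^sup>2"
    using cauchy_schwarz_3[of "x$1" "c$1" "x$2" "c$2" "x$3" "c$3"] unfolding x c .
  also have "\<dots> < (x$4)\<^sup>2 * (c$4)\<^sup>2"
    using c(2) by (intro mult_strict_right_mono) auto
  also have "\<dots> = (x$4 * c$4)\<^sup>2"
    by (simp add: power_mult_distrib)
  finally have "x$1 * c$1 + x$2 * c$2 + x$3 * c$3 < x$4 * c$4"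
    by (rule power_less_imp_less_base) (use x c in simp)
  then show ?thesis
    by (simp add: mink_def)
qed

text \<open>Reversed Cauchy-Schwarz inequality. It puts \<open>- mink x y\<close> into the range
  where \<open>cosh\<close> undoes \<open>arcosh\<close>, so that isometries preserve
  \<open>mink\<close>.\<close>

lemma mink_H3_le:
  assumes "x \<in> H3" "y \<in> H3"
  shows "mink x y \<le> -1"
proof -
  have x: "(x$1)\<^sup>2 + (x$2)\<^sup>2 + (x$3)\<^sup>2 = (x$4)\<^sup>2 - 1" "x$4 > 0"
    using assms(1) by (auto simp: H3_def mink_def power2_eq_square)
  have y: "(y$1)\<^sup>2 + (y$2)\<^sup>2 + (y$3)\<^sup>2 = (y$4)\<^sup>2 - 1" "y$4 > 0"
    using assms(2) by (auto simp: H3_def mink_def power2_eq_square)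
  have "(x$4)\<^sup>2 - 1 \<ge> 0" "(y$4)\<^sup>2 - 1 \<ge> 0"
    by (simp_all flip: x(1) y(1))
  then have "1 \<le> x$4" "1 \<le> y$4"
    using power2_le_imp_le[of 1 "x$4"] power2_le_imp_le[of 1 "y$4"] x(2) y(2) by simp_all
  then have xy: "1 \<le> x$4 * y$4"
    using mult_mono[of 1 "x$4" 1 "y$4"] by simp
  have "(x$1 * y$1 + x$2 * y$2 + x$3 * y$3)\<^sup>2 \<le> ((x$4)\<^sup>2 - 1) * ((y$4)\<^sup>2 - 1)"
    using cauchy_schwarz_3[of "x$1" "y$1" "x$2" "y$2" "x$3" "y$3"] unfolding x y .
  also have "\<dots> = (x$4 * y$4 - 1)\<^sup>2 - (x$4 - y$4)\<^sup>2"
    by algebra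
  also have "\<dots> \<le> (x$4 * y$4 - 1)\<^sup>2"
    by simp
  finally have "x$1 * y$1 + x$2 * y$2 + x$3 * y$3 \<le> x$4 * y$4 - 1"
    by (rule power2_le_imp_le) (use xy in simp)
  then show ?thesis
    by (simp add: mink_def)
qed

text \<open>The hyperboloid spans the ambient space.\<close>

lemma linear_eq_0_on_H3:
  fixes f :: "real^4 \<Rightarrow> 'a::real_vector"
  assumes "linear f" "\<And>x. x \<in> H3 \<Longrightarrow> f x = 0"
  shows "f x = 0"
proof -
  have 4: "axis 4 1 \<in> H3"
    by (simp add: H3_def mink_def axis_def)
  have b: "f (axis i 1) = 0" for i :: 4
  proof (cases "i = 4")
    case True
    then show ?thesis using 4 assms(2) by simp
  next
    case False
    \<comment> \<open>The triple 3, 4, 5 gives \<open>(5/4)^2 - (3/4)^2 = 1\<close>.\<close>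
    then have "(3/4) *\<^sub>R axis i 1 + (5/4) *\<^sub>R axis 4 1 \<in> H3"
      using exhaust_4[of i] by (auto simp: H3_def mink_def axis_def)
    then have "f ((3/4) *\<^sub>R axis i 1 + (5/4) *\<^sub>R axis 4 1) = 0"
      by (rule assms(2))
    then show ?thesis
      using assms(2)[OF 4] by (simp add: linear_add[OF assms(1)] linear_scale[OF assms(1)])
  qed
  have "x = (\<Sum>i\<in>UNIV. x$i *\<^sub>R axis i 1)"
    using basis_expansion[of x] by (simp add: scalar_mult_eq_scaleR)
  then have "f x = (\<Sum>i\<in>UNIV. x$i *\<^sub>R f (axis i 1))"
    by (metis (no_types, lifting) assms(1) linear_scale linear_sum sum.cong)
  then show ?thesis
    by (simp add: b)
qed

lemma mink_nondegenerate:
  assumes "\<And>y. y \<in> H3 \<Longrightarrow> mink x y = mink x' y"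
  shows "x = x'"
proof -
  have "mink y (x - x') = 0" for y
  proof (rule linear_eq_0_on_H3[OF linear_mink_left])
    fix y assume "y \<in> H3"
    then show "mink y (x - x') = 0"
      using assms by (simp add: mink_linear mink_commute[of y])
  qed
  from this[of "axis 1 1"] this[of "axis 2 1"] this[of "axis 3 1"] this[of "axis 4 1"]
  show ?thesis
    by (simp add: vec_eq_iff forall_4 mink_def axis_def)
qed

lemma hyp_isometry_mink:
  assumes "hyp_isometry A" "x \<in> H3" "y \<in> H3"
  shows "mink (A *v x) (A *v y) = mink x y"
proof -
  have "A *v x \<in> H3" "A *v y \<in> H3"
    using assms unfolding hyp_isometry_def by blast+
  then have *: "1 \<le> - mink (A *v x) (A *v y)" "1 \<le> - mink x y"
    using mink_H3_le assms(2,3) by force+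
  have "arcosh (- mink (A *v x) (A *v y)) = arcosh (- mink x y)"
    using assms unfolding hyp_isometry_def hyp_dist_def by blast
  then have "cosh (arcosh (- mink (A *v x) (A *v y))) = cosh (arcosh (- mink x y))"
    by simp
  then show ?thesis
    using * by simp
qed

text \<open>Preserving \<open>mink\<close> makes the map injective, hence bijective. The preimage of
  a point of \<open>H3\<close> lies on one of the two sheets, and not on the lower one, whose points
  are sent to the lower sheet.\<close>

lemma hyp_isometryI:
  assumes mink: "\<And>x y. mink (A *v x) (A *v y) = mink x y" and sub: "\<And>x. x \<in> H3 \<Longrightarrow> A *v x \<in> H3"
  shows "hyp_isometry A"
proof -
  have "inj ((*v) A)"
  proof (rule injI)
    fix x y assume "A *v x = A *v y"
    then have "mink x z = mink y z" for z
      using mink[of x z] mink[of y z] by simp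
    then show "x = y"
      by (rule mink_nondegenerate)
  qed
  then have surj: "surj ((*v) A)"
    by (intro linear_injective_imp_surjective) simp_all
  have "y \<in> (*v) A ` H3" if y: "y \<in> H3" for y
  proof -
    obtain x where x: "y = A *v x"
      using surj by blast
    have n: "mink x x = -1"
      using H3_norm[OF y] mink[of x x] x by simp
    have "x$4 > 0"
    proof (rule ccontr)
      assume "\<not> x$4 > 0"
      moreover have "x$4 \<noteq> 0"
      proof
        assume "x$4 = 0"
        then have "mink x x = (x$1)\<^sup>2 + (x$2)\<^sup>2 + (x$3)\<^sup>2"
          by (simp add: mink_def power2_eq_square)
        then show False
          using n by (smt (verit) zero_le_power2)
      qed
      ultimately have "- x \<in> H3"
        using n by (simp add: H3_def mink_linear)
      then have "- y \<in> H3"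
        using sub[of "- x"] x by (simp add: linear_neg)
      then show False
        using H3_future[OF y] H3_future[of "- y"] by simp
    qed
    then show ?thesis
      using n x by (auto simp: H3_def)
  qed
  then have "(*v) A ` H3 = H3"
    using sub by blast
  then show ?thesis
    by (simp add: hyp_isometry_def hyp_dist_def mink)
qed

section \<open>Killing fields and skew linear maps\<close>

lemma killing_field_skew:
  assumes "killing_field X" "x \<in> H3" "y \<in> H3"
  shows "mink (X x) y + mink x (X y) = 0"
proof -
  obtain \<phi> where \<phi>: "\<phi> 0 = mat 1" "\<And>t. hyp_isometry (\<phi> t)"
    and d: "\<And>x t. x \<in> H3 \<Longrightarrow> ((\<lambda>s. \<phi> s *v x) has_vector_derivative X (\<phi> t *v x)) (at t)"
    using assms(1) unfolding killing_field_def by blast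
  \<comment> \<open>The flow preserves \<open>mink\<close> of two points; differentiating at time 0
    gives a two-point form of the Killing equation, free of covariant derivatives.\<close>
  have "((\<lambda>s. mink (\<phi> s *v x) (\<phi> s *v y)) has_vector_derivative
      mink (\<phi> 0 *v x) (X (\<phi> 0 *v y)) + mink (X (\<phi> 0 *v x)) (\<phi> 0 *v y)) (at 0)"
    by (rule bounded_bilinear.has_vector_derivative[OF bounded_bilinear_mink]) (intro d assms)+
  moreover have "(\<lambda>s. mink (\<phi> s *v x) (\<phi> s *v y)) = (\<lambda>s. mink x y)"
    using hyp_isometry_mink[OF \<phi>(2) assms(2,3)] by blast
  ultimately have "((\<lambda>s. mink x y) has_vector_derivative mink x (X y) + mink (X x) y) (at 0)"
    by (simp add: \<phi>(1))
  then have "mink x (X y) + mink (X x) y = 0"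
    by (rule vector_derivative_unique_at) (rule has_vector_derivative_const)
  then show ?thesis
    by simp
qed

text \<open>The matrix exponential, as an entrywise power series.\<close>

lemma ex_linear_flow:
  fixes B :: "real^'n::finite^'n"
  obtains \<Phi> :: "real \<Rightarrow> real^'n^'n" where "\<Phi> 0 = mat 1"
    "\<And>x t. ((\<lambda>s. \<Phi> s *v x) has_vector_derivative B *v (\<Phi> t *v x)) (at t)"
proof -
  define M where "M = (\<lambda>n. ((**) B ^^ n) (mat 1))"
  have M0: "M 0 = mat 1" and MS: "\<And>n. M (Suc n) = B ** M n"
    by (simp_all add: M_def)
  \<comment> \<open>The sum of all absolute entries bounds every row sum, so the entries of the
    \<open>n\<close>-th power are at most \<open>C ^ n\<close> and the series converges
    everywhere.\<close>
  define C where "C = (\<Sum>i\<in>UNIV. \<Sum>j\<in>UNIV. \<bar>B$i$j\<bar>)"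
  have C: "(\<Sum>j\<in>UNIV. \<bar>B$i$j\<bar>) \<le> C" for i
    unfolding C_def by (rule member_le_sum) (auto intro: sum_nonneg)
  have "C \<ge> 0"
    by (auto simp: C_def intro!: sum_nonneg)
  have bound: "\<bar>M n $ i $ j\<bar> \<le> C ^ n" for n i j
  proof (induction n arbitrary: i j)
    case 0
    then show ?case by (simp add: M0 mat_def)
  next
    case (Suc n)
    have "\<bar>M (Suc n) $ i $ j\<bar> \<le> (\<Sum>k\<in>UNIV. \<bar>B$i$k * M n $ k $ j\<bar>)"
      by (simp add: MS matrix_matrix_mult_def sum_abs)
    also have "\<dots> \<le> (\<Sum>k\<in>UNIV. \<bar>B$i$k\<bar> * C ^ n)"
      by (intro sum_mono) (auto simp: abs_mult intro: mult_left_mono Suc)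
    also have "\<dots> \<le> C * C ^ n"
      using C \<open>C \<ge> 0\<close> by (auto simp flip: sum_distrib_right intro!: mult_right_mono)
    finally show ?case by simp
  qed
  define c where "c = (\<lambda>i j n. M n $ i $ j / fact n)"
  have summable: "summable (\<lambda>n. c i j n * t ^ n)" for i j and t :: real
  proof (rule summable_comparison_test')
    show "summable (\<lambda>n. (C * \<bar>t\<bar>) ^ n / fact n)"
      using summable_exp[of "C * \<bar>t\<bar>"] by (simp add: divide_inverse mult.commute)
    show "norm (c i j n * t ^ n) \<le> (C * \<bar>t\<bar>) ^ n / fact n" if "n \<ge> 0" for n
      using bound[of n i j]
      by (auto simp: c_def abs_mult power_abs power_mult_distrib intro!: divide_right_mono mult_right_mono)
  qed
  define \<Phi> :: "real \<Rightarrow> real^'n^'n" where "\<Phi> = (\<lambda>t. \<chi> i j. \<Sum>n. c i j n * t ^ n)"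
  have deriv: "((\<lambda>s. \<Phi> s $ i $ j) has_real_derivative (B ** \<Phi> t) $ i $ j) (at t)" for i j t
  proof -
    have "diffs (c i j) n * t ^ n = (\<Sum>k\<in>UNIV. B$i$k * (c k j n * t ^ n))" for n
      by (simp add: diffs_def c_def MS matrix_matrix_mult_def sum_divide_distrib sum_distrib_right
          sum_distrib_left mult.assoc del: of_nat_Suc)
    then have "(\<Sum>n. diffs (c i j) n * t ^ n) = (\<Sum>n. \<Sum>k\<in>UNIV. B$i$k * (c k j n * t ^ n))"
      by simp
    also have "\<dots> = (\<Sum>k\<in>UNIV. \<Sum>n. B$i$k * (c k j n * t ^ n))"
      by (intro suminf_sum summable_mult summable)
    also have "\<dots> = (B ** \<Phi> t) $ i $ j"
      by (simp add: matrix_matrix_mult_def \<Phi>_def suminf_mult summable)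
    finally show ?thesis
      using termdiffs_strong_converges_everywhere[of "c i j" t] summable by (simp add: \<Phi>_def)
  qed
  show thesis
  proof
    have "(\<Sum>n. c i j n * 0 ^ n) = mat 1 $ i $ j" for i j
      using powser_zero[of "c i j"] by (simp add: c_def M0)
    then show "\<Phi> 0 = mat 1"
      by (simp add: \<Phi>_def vec_eq_iff)
    show "((\<lambda>s. \<Phi> s *v x) has_vector_derivative B *v (\<Phi> t *v x)) (at t)" for x t
      unfolding has_vector_derivative_def
    proof (subst has_derivative_componentwise_within, intro ballI)
      fix b :: "real^'n" assume "b \<in> Basis"
      then obtain i where b: "b = axis i 1"
        by (auto simp: Basis_vec_def)
      have "((\<lambda>s. \<Sum>j\<in>UNIV. \<Phi> s $ i $ j * x $ j) has_real_derivative (\<Sum>j\<in>UNIV. (B ** \<Phi> t) $ i $ j * x $ j)) (at t)"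
        by (intro DERIV_sum DERIV_cmult_right deriv)
      then have "((\<lambda>s. (\<Phi> s *v x) $ i) has_real_derivative (B *v (\<Phi> t *v x)) $ i) (at t)"
        by (simp add: matrix_vector_mul_assoc) (simp add: matrix_vector_mult_def)
      moreover have "(\<lambda>s. s * (B *v (\<Phi> t *v x)) $ i) = (*) ((B *v (\<Phi> t *v x)) $ i)"
        by (simp add: fun_eq_iff mult.commute)
      ultimately show "((\<lambda>s. (\<Phi> s *v x) \<bullet> b) has_derivative (\<lambda>s. (s *\<^sub>R (B *v (\<Phi> t *v x))) \<bullet> b)) (at t)"
        by (simp add: b inner_axis has_field_derivative_def)
    qed
  qed
qed

text \<open>The flow of a skew matrix preserves \<open>mink\<close>. It cannot leave the upper
  sheet, since the last coordinate varies continuously in time and never vanishes on vectors with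
  \<open>mink x x = -1\<close>.\<close>

lemma killing_field_skew_matrix:
  assumes skew: "\<And>x y. mink (B *v x) y + mink x (B *v y) = 0"
  shows "killing_field ((*v) B)"
proof -
  obtain \<Phi> :: "real \<Rightarrow> real^4^4" where \<Phi>0: "\<Phi> 0 = mat 1"
    and d: "\<And>x t. ((\<lambda>s. \<Phi> s *v x) has_vector_derivative B *v (\<Phi> t *v x)) (at t)"
    using ex_linear_flow[of B] by blast
  have "((\<lambda>s. mink (\<Phi> s *v x) (\<Phi> s *v y)) has_vector_derivative 0) (at t)" for x y t
    using bounded_bilinear.has_vector_derivative[OF bounded_bilinear_mink d[of x t] d[of y t]] skew
    by (simp add: add.commute)
  then have der: "((\<lambda>s. mink (\<Phi> s *v x) (\<Phi> s *v y)) has_real_derivative 0) (at t)" for x y t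
    by (simp add: has_real_derivative_iff_has_vector_derivative)
  have mink: "mink (\<Phi> t *v x) (\<Phi> t *v y) = mink x y" for t x y
    using DERIV_isconst_all[of "\<lambda>s. mink (\<Phi> s *v x) (\<Phi> s *v y)" t 0] der \<Phi>0 by simp
  have "\<Phi> t *v x \<in> H3" if x: "x \<in> H3" for t x
  proof -
    have n: "mink (\<Phi> s *v x) (\<Phi> s *v x) = -1" for s
      using mink H3_norm[OF x] by simp
    have nz: "(\<Phi> s *v x) $ 4 \<noteq> 0" for s
    proof
      assume "(\<Phi> s *v x) $ 4 = 0"
      then have "mink (\<Phi> s *v x) (\<Phi> s *v x) \<ge> 0"
        by (simp add: mink_def)
      then show False
        using n[of s] by simp
    qed
    have "continuous_on UNIV (\<lambda>s. \<Phi> s *v x)"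
      by (intro continuous_at_imp_continuous_on ballI) (rule has_vector_derivative_continuous[OF d])
    then have "continuous_on UNIV (\<lambda>s. (\<Phi> s *v x) $ 4)"
      by (intro continuous_intros)
    then have "connected ((\<lambda>s. (\<Phi> s *v x) $ 4) ` UNIV)"
      by (rule connected_continuous_image) (rule connected_UNIV)
    moreover have "(\<Phi> 0 *v x) $ 4 > 0"
      using H3_future[OF x] by (simp add: \<Phi>0)
    ultimately have "(\<Phi> t *v x) $ 4 > 0"
      using nz connectedD_interval[of "(\<lambda>s. (\<Phi> s *v x) $ 4) ` UNIV" "(\<Phi> t *v x) $ 4" "(\<Phi> 0 *v x) $ 4" 0]
      by (smt (verit) imageE rangeI)
    then show ?thesis
      using n by (simp add: H3_def)
  qed
  then have "hyp_isometry (\<Phi> t)" for t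
    by (intro hyp_isometryI mink)
  then show ?thesis
    unfolding killing_field_def using \<Phi>0 d by blast
qed

section \<open>The projective chart at an ideal point\<close>

text \<open>\<open>d\<close> represents a second ideal point, and \<open>e1\<close>,
  \<open>e2\<close> complete the two null vectors orthogonally. The minus signs in
  \<open>decomp\<close> come from \<open>mink c d = -1\<close>.\<close>

locale null_frame =
  fixes c d e1 e2 :: "real^4"
  assumes ideal: "ideal_point c"
    and dd: "mink d d = 0" and cd: "mink c d = -1"
    and ee: "mink e1 e1 = 1" "mink e2 e2 = 1" "mink e1 e2 = 0"
    and orth: "mink c e1 = 0" "mink c e2 = 0" "mink d e1 = 0" "mink d e2 = 0"
    and decomp: "x = mink x e1 *\<^sub>R e1 + mink x e2 *\<^sub>R e2 - mink x d *\<^sub>R c - mink x c *\<^sub>R d"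

text \<open>With \<open>c\<close> written as \<open>k\<close> times \<open>(n, 1)\<close> for a unit
  vector \<open>n\<close>, the frame completes \<open>n\<close> to an orthonormal basis of Euclidean
  space and takes \<open>d\<close> along the opposite null direction.\<close>

lemma ex_null_frame:
  assumes "ideal_point c"
  obtains d e1 e2 where "null_frame c d e1 e2"
proof -
  define k where "k = c$4"
  have k: "k > 0"
    using assms by (simp add: ideal_point_def k_def)
  define n :: "real^3" where "n = vector [c$1 / k, c$2 / k, c$3 / k]"
  have c: "c$1 = k * n$1" "c$2 = k * n$2" "c$3 = k * n$3" "c$4 = k"
    using k by (simp_all add: n_def k_def)
  have "mink c c = k\<^sup>2 * ((n$1)\<^sup>2 + (n$2)\<^sup>2 + (n$3)\<^sup>2 - 1)"
    by (simp add: mink_def c power2_eq_square algebra_simps)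
  then have nn: "(n$1)\<^sup>2 + (n$2)\<^sup>2 + (n$3)\<^sup>2 = 1"
    using assms k by (simp add: ideal_point_def)
  then have "norm n = 1"
    by (simp add: norm_eq_1 inner_vec_def sum_3 power2_eq_square)
  then obtain A :: "real^3^3" where A: "orthogonal_matrix A" "A *v axis 3 1 = n"
    using orthogonal_matrix_exists_basis[of n 3] by metis
  define u where "u = A *v axis 1 1"
  define v where "v = A *v axis 2 1"
  have A': "A$i$1 = u$i" "A$i$2 = v$i" "A$i$3 = n$i" for i
    by (simp_all add: u_def v_def A(2)[symmetric] matrix_vector_mult_def axis_def if_distrib cong: if_cong)
  have "transpose A ** A = mat 1" "A ** transpose A = mat 1"
    using A(1) by (simp_all add: orthogonal_matrix_def)
  then have o: "u$1 * u$1 + u$2 * u$2 + u$3 * u$3 = 1" "v$1 * v$1 + v$2 * v$2 + v$3 * v$3 = 1"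
    "u$1 * v$1 + u$2 * v$2 + u$3 * v$3 = 0" "u$1 * n$1 + u$2 * n$2 + u$3 * n$3 = 0"
    "v$1 * n$1 + v$2 * n$2 + v$3 * n$3 = 0"
    and p: "u$1 * u$1 + v$1 * v$1 + n$1 * n$1 = 1" "u$2 * u$2 + v$2 * v$2 + n$2 * n$2 = 1"
    "u$3 * u$3 + v$3 * v$3 + n$3 * n$3 = 1" "u$1 * u$2 + v$1 * v$2 + n$1 * n$2 = 0"
    "u$1 * u$3 + v$1 * v$3 + n$1 * n$3 = 0" "u$2 * u$3 + v$2 * v$3 + n$2 * n$3 = 0"
    by (simp_all add: vec_eq_iff forall_3 matrix_matrix_mult_def sum_3 transpose_def mat_def A')
  \<comment> \<open>This factor normalises \<open>mink c d\<close>, which equals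
    \<open>- 2 * k * h\<close>.\<close>
  define h where "h = 1 / (2 * k)"
  have kh: "2 * k * h = 1"
    using k by (simp add: h_def)
  define d :: "real^4" where
    "d = (\<chi> i. if i = 1 then - h * n$1 else if i = 2 then - h * n$2 else if i = 3 then - h * n$3 else h)"
  define e1 :: "real^4" where
    "e1 = (\<chi> i. if i = 1 then u$1 else if i = 2 then u$2 else if i = 3 then u$3 else 0)"
  define e2 :: "real^4" where
    "e2 = (\<chi> i. if i = 1 then v$1 else if i = 2 then v$2 else if i = 3 then v$3 else 0)"
  have d: "d$1 = - h * n$1" "d$2 = - h * n$2" "d$3 = - h * n$3" "d$4 = h"
    by (simp_all add: d_def)
  have e: "e1$1 = u$1" "e1$2 = u$2" "e1$3 = u$3" "e1$4 = 0" "e2$1 = v$1" "e2$2 = v$2" "e2$3 = v$3" "e2$4 = 0"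
    by (simp_all add: e1_def e2_def)
  have "null_frame c d e1 e2"
  proof
    show "ideal_point c" by fact
    show "mink d d = 0" "mink c d = -1"
      unfolding mink_def c d using nn kh by algebra+
    show "mink e1 e1 = 1" "mink e2 e2 = 1" "mink e1 e2 = 0"
      using o by (simp_all add: mink_def e)
    show "mink c e1 = 0" "mink c e2 = 0" "mink d e1 = 0" "mink d e2 = 0"
      unfolding mink_def c d e using o by algebra+
    show "x = mink x e1 *\<^sub>R e1 + mink x e2 *\<^sub>R e2 - mink x d *\<^sub>R c - mink x c *\<^sub>R d" for x
    proof -
      define q where "q = x$1 * n$1 + x$2 * n$2 + x$3 * n$3"
      have xc: "mink x c = k * (q - x$4)" and xd: "mink x d = - h * (q + x$4)"
        unfolding mink_def c d q_def by algebra+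
      have cd': "- mink x d * (k * m) - mink x c * (- h * m) = q * m" for m
        unfolding xc xd using kh by algebra
      have cd4: "- mink x d * k - mink x c * h = x$4"
        unfolding xc xd using kh by algebra
      have "x$1 = mink x e1 * u$1 + mink x e2 * v$1 + q * n$1"
        "x$2 = mink x e1 * u$2 + mink x e2 * v$2 + q * n$2"
        "x$3 = mink x e1 * u$3 + mink x e2 * v$3 + q * n$3"
        unfolding q_def mink_def e using p by algebra+
      then show ?thesis
        using cd'[of "n$1"] cd'[of "n$2"] cd'[of "n$3"] cd4
        by (simp only: vec_eq_iff forall_4 c d e vector_add_component vector_minus_component
            vector_scaleR_component real_scaleR_def) linarith
    qed
  qed
  then show thesis
    by (rule that)
qed

context null_frame
begin

lemma cc: "mink c c = 0"
  using ideal by (simp add: ideal_point_def)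

text \<open>Coordinates in the null frame. The level sets of \<open>W\<close> in \<open>H3\<close>
  are the horospheres at \<open>c\<close>, and \<open>W\<close> is the denominator of the projective
  chart.\<close>

definition Y :: "real^4 \<Rightarrow> complex" where "Y x = Complex (mink x e1) (mink x e2)"
definition S :: "real^4 \<Rightarrow> real" where "S x = - mink x d"
definition W :: "real^4 \<Rightarrow> real" where "W x = - mink x c"

definition vec :: "complex \<Rightarrow> real \<Rightarrow> real \<Rightarrow> real^4" where
  "vec y s w = Re y *\<^sub>R e1 + Im y *\<^sub>R e2 + s *\<^sub>R c + w *\<^sub>R d"

lemma vec_coords: "vec (Y x) (S x) (W x) = x"
  using decomp[of x] by (simp add: vec_def Y_def S_def W_def)

lemma coords_vec [simp]: "Y (vec y s w) = y" "S (vec y s w) = s" "W (vec y s w) = w"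
  by (simp_all add: Y_def S_def W_def vec_def mink_linear ee orth cd dd cc mink_commute[of e2 e1]
      mink_commute[of d c] complex_eq_iff mink_commute[of e1 c] mink_commute[of e2 c]
      mink_commute[of e1 d] mink_commute[of e2 d])

lemma coords_linear [simp]:
  "Y (x + x') = Y x + Y x'" "Y (a *\<^sub>R x) = a *\<^sub>R Y x"
  "S (x + x') = S x + S x'" "S (a *\<^sub>R x) = a * S x"
  "W (x + x') = W x + W x'" "W (a *\<^sub>R x) = a * W x"
  by (simp_all add: Y_def S_def W_def mink_linear complex_eq_iff)

lemma coords_c [simp]: "Y c = 0" "S c = 1" "W c = 0"
  by (simp_all add: Y_def S_def W_def orth cd cc complex_eq_iff)

lemma mink_coords: "mink x x' = Y x \<bullet> Y x' - S x * W x' - W x * S x'"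
proof -
  have "mink x x' = mink (vec (Y x) (S x) (W x)) x'"
    by (simp only: vec_coords)
  also have "\<dots> = Re (Y x) * mink x' e1 + Im (Y x) * mink x' e2 + S x * mink x' c + W x * mink x' d"
    by (simp add: vec_def mink_linear mink_commute)
  also have "\<dots> = Y x \<bullet> Y x' - S x * W x' - W x * S x'"
    by (simp add: Y_def S_def W_def inner_complex_def)
  finally show ?thesis .
qed

lemma coords_eqI: "Y x = Y x' \<Longrightarrow> S x = S x' \<Longrightarrow> W x = W x' \<Longrightarrow> x = x'"
  by (metis vec_coords)

lemma continuous_coords [continuous_intros]:
  assumes "continuous_on A f"
  shows "continuous_on A (\<lambda>t. Y (f t))" "continuous_on A (\<lambda>t. S (f t))" "continuous_on A (\<lambda>t. W (f t))"
  unfolding Y_def S_def W_def mink_def Complex_eq by (intro continuous_intros assms)+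

lemma continuous_vec [continuous_intros]:
  assumes "continuous_on A f" "continuous_on A g" "continuous_on A h"
  shows "continuous_on A (\<lambda>t. vec (f t) (g t) (h t))"
  unfolding vec_def by (intro continuous_intros assms)

text \<open>\<open>W\<close> is negative on the lower sheet, so its sign can replace that of the
  last coordinate.\<close>

lemma H3_coords: "x \<in> H3 \<longleftrightarrow> (norm (Y x))\<^sup>2 - 2 * S x * W x = -1 \<and> W x > 0"
proof -
  have n: "mink x x = (norm (Y x))\<^sup>2 - 2 * S x * W x" for x
    by (simp add: mink_coords dot_square_norm)
  have "x$4 > 0" if "mink x x = -1" "W x > 0"
  proof (rule ccontr)
    assume "\<not> x$4 > 0"
    moreover have "x$4 \<noteq> 0"
    proof
      assume "x$4 = 0"
      then have "mink x x \<ge> 0"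
        by (simp add: mink_def)
      then show False
        using that by simp
    qed
    ultimately have "- x \<in> H3"
      using that by (simp add: H3_def mink_linear)
    then show False
      using mink_H3_ideal[OF _ ideal] that(2) by (fastforce simp: W_def mink_linear)
  qed
  moreover have "W x > 0" if "x \<in> H3"
    using mink_H3_ideal[OF that ideal] by (simp add: W_def)
  ultimately show ?thesis
    unfolding n[symmetric] using H3_def by blast
qed

lemma W_pos: "x \<in> H3 \<Longrightarrow> W x > 0"
  by (simp add: H3_coords)

text \<open>The Klein model in the affine chart \<open>W = 1\<close>. The points at infinity other
  than \<open>c\<close> form the paraboloid below \<open>region\<close>, and \<open>lift\<close>
  rescales a point above it onto the hyperboloid.\<close>

definition pos :: "real^4 \<Rightarrow> complex" where "pos x = (1 / W x) *\<^sub>R Y x"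
definition ht :: "real^4 \<Rightarrow> real" where "ht x = S x / W x"
definition chart :: "real^4 \<Rightarrow> complex \<times> real" where "chart x = (pos x, ht x)"
definition region :: "(complex \<times> real) set" where "region = {(y, s). (norm y)\<^sup>2 / 2 < s}"
definition lift :: "complex \<times> real \<Rightarrow> real^4" where
  "lift = (\<lambda>(y, s). (1 / sqrt (2 * s - (norm y)\<^sup>2)) *\<^sub>R vec y s 1)"

lemma fst_chart [simp]: "fst (chart x) = pos x" and snd_chart [simp]: "snd (chart x) = ht x"
  by (simp_all add: chart_def)

text \<open>Horospheres at \<open>c\<close> are vertical translates of the paraboloid; small
  \<open>W\<close> means high above it.\<close>

lemma ht_eq:
  assumes "x \<in> H3"
  shows "ht x = (norm (pos x))\<^sup>2 / 2 + 1 / (2 * (W x)\<^sup>2)"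
proof -
  have w: "W x > 0" and "(norm (Y x))\<^sup>2 + 1 = 2 * S x * W x"
    using assms by (auto simp: H3_coords)
  then have "ht x = ((norm (Y x))\<^sup>2 + 1) / (2 * (W x)\<^sup>2)"
    by (simp add: ht_def power2_eq_square)
  then show ?thesis
    using w by (simp add: pos_def power_divide add_divide_distrib)
qed

lemma chart_in_region: "x \<in> H3 \<Longrightarrow> chart x \<in> region"
  using W_pos[of x] by (simp add: region_def chart_def ht_eq)

lemma lift_in_H3:
  assumes "p \<in> region"
  shows "lift p \<in> H3"
proof -
  obtain y s where p: "p = (y, s)"
    by fastforce
  define q where "q = 2 * s - (norm y)\<^sup>2"
  have "q > 0"
    using assms by (simp add: p region_def q_def)
  define r where "r = 1 / sqrt q"
  have r: "r > 0" "r\<^sup>2 * q = 1"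
    using \<open>q > 0\<close> by (simp_all add: r_def power_divide)
  have "lift p = r *\<^sub>R vec y s 1"
    by (simp add: lift_def p r_def q_def)
  moreover have "(r * norm y)\<^sup>2 - 2 * (r * s) * r = - (r\<^sup>2 * q)"
    unfolding q_def by algebra
  ultimately show ?thesis
    using r by (simp add: H3_coords)
qed

lemma chart_lift: "p \<in> region \<Longrightarrow> chart (lift p) = p"
  by (auto simp: lift_def region_def chart_def pos_def ht_def split: prod.splits)

lemma lift_chart:
  assumes "x \<in> H3"
  shows "lift (chart x) = x"
proof -
  have w: "W x > 0"
    using W_pos assms .
  have "2 * ht x - (norm (pos x))\<^sup>2 = 1 / (W x)\<^sup>2"
    unfolding ht_eq[OF assms] by simp
  then have "1 / sqrt (2 * ht x - (norm (pos x))\<^sup>2) = W x"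
    using w by (simp add: real_sqrt_divide)
  then have l: "lift (chart x) = W x *\<^sub>R vec (pos x) (ht x) 1"
    by (simp add: lift_def chart_def)
  show ?thesis
    unfolding l using w by (intro coords_eqI) (simp_all add: pos_def ht_def)
qed

lemma chart_inj: "x \<in> H3 \<Longrightarrow> x' \<in> H3 \<Longrightarrow> pos x = pos x' \<Longrightarrow> ht x = ht x' \<Longrightarrow> x = x'"
  by (metis chart_def lift_chart)

lemma chart_H3: "chart ` H3 = region"
  by (auto simp: chart_in_region) (metis chart_lift image_iff lift_in_H3)

lemma continuous_on_chart: "continuous_on H3 chart"
  unfolding chart_def pos_def ht_def
  by (intro continuous_intros) (use W_pos in force)+

lemma continuous_on_lift: "continuous_on region lift"
  unfolding lift_def split_beta
  by (intro continuous_intros) (auto simp: region_def)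

lemma open_region: "open region"
proof -
  have "region = {p. (norm (fst p))\<^sup>2 / 2 < snd p}"
    by (auto simp: region_def)
  moreover have "open {p :: complex \<times> real. (norm (fst p))\<^sup>2 / 2 < snd p}"
    by (intro open_Collect_less continuous_intros) auto
  ultimately show ?thesis
    by simp
qed

lemma homeomorphic_chart: "homeomorphic_map (top_of_set H3) (top_of_set region) chart"
proof (rule homeomorphic_maps_imp_map)
  show "homeomorphic_maps (top_of_set H3) (top_of_set region) chart lift"
    unfolding homeomorphic_maps_def
    using continuous_on_chart continuous_on_lift
    by (auto simp: continuous_map_in_subtopology chart_in_region lift_in_H3 chart_lift lift_chart)
qed

text \<open>Central projection turns linear combinations into affine ones once the weights are
  rescaled by \<open>W\<close>.\<close>

lemma chart_combination:
  assumes "x \<in> H3" "y \<in> H3" "z \<in> H3" "z = a *\<^sub>R x + b *\<^sub>R y"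
  shows "chart z = (a * W x / W z) *\<^sub>R chart x + (b * W y / W z) *\<^sub>R chart y"
    "a * W x / W z + b * W y / W z = 1"
proof -
  have w: "W x > 0" "W y > 0" "W z > 0"
    using assms(1-3) W_pos by blast+
  have "Y z = a *\<^sub>R Y x + b *\<^sub>R Y y" "S z = a * S x + b * S y" and Wz: "W z = a * W x + b * W y"
    using assms(4) by simp_all
  then show "chart z = (a * W x / W z) *\<^sub>R chart x + (b * W y / W z) *\<^sub>R chart y"
    using w by (simp add: chart_def pos_def ht_def scaleR_add_right add_divide_distrib del: coords_linear)
  show "a * W x / W z + b * W y / W z = 1"
    using w unfolding add_divide_distrib[symmetric] Wz[symmetric] by simp
qed

lemma chart_segment:
  assumes "x \<in> H3" "y \<in> H3"
  shows "chart ` hyp_segment x y = closed_segment (chart x) (chart y)"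
proof (intro equalityI subsetI)
  fix p assume "p \<in> chart ` hyp_segment x y"
  then obtain z a b where z: "z \<in> H3" "a \<ge> 0" "b \<ge> 0" "z = a *\<^sub>R x + b *\<^sub>R y" and p: "p = chart z"
    by (auto simp: hyp_segment_def)
  define t where "t = b * W y / W z"
  have w: "W x > 0" "W y > 0" "W z > 0"
    using assms z(1) W_pos by blast+
  have at: "a * W x / W z = 1 - t"
    using chart_combination(2)[OF assms z(1,4)] unfolding t_def by linarith
  moreover have "0 \<le> t"
    using w z by (simp add: t_def)
  moreover have "0 \<le> a * W x / W z"
    using w z by simp
  then have "t \<le> 1"
    unfolding at by simp
  ultimately show "p \<in> closed_segment (chart x) (chart y)"
    unfolding in_segment p using chart_combination(1)[OF assms z(1,4)] by (auto simp: t_def)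
next
  fix p assume "p \<in> closed_segment (chart x) (chart y)"
  then obtain t where t: "0 \<le> t" "t \<le> 1" and p: "p = (1 - t) *\<^sub>R chart x + t *\<^sub>R chart y"
    by (auto simp: in_segment)
  have w: "W x > 0" "W y > 0"
    using assms W_pos by auto
  \<comment> \<open>Dividing by \<open>W\<close> undoes the rescaling of weights, so that
    \<open>W q = 1\<close>. The vector \<open>q\<close> is timelike because \<open>mink x y\<close>
    is negative, and \<open>l\<close> scales it onto the hyperboloid.\<close>
  define \<alpha> where "\<alpha> = (1 - t) / W x"
  define \<gamma> where "\<gamma> = t / W y"
  have ag: "\<alpha> \<ge> 0" "\<gamma> \<ge> 0" "\<alpha> * W x = 1 - t" "\<gamma> * W y = t"
    using t w by (simp_all add: \<alpha>_def \<gamma>_def)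
  define q where "q = \<alpha> *\<^sub>R x + \<gamma> *\<^sub>R y"
  have Wq: "W q = 1"
    using ag by (simp add: q_def)
  have "mink q q = \<alpha>\<^sup>2 * mink x x + \<gamma>\<^sup>2 * mink y y + 2 * (\<alpha> * \<gamma> * mink x y)"
    by (simp add: q_def mink_linear mink_commute[of y x] power2_eq_square algebra_simps)
  moreover have "\<alpha> * \<gamma> * mink x y \<le> 0"
    using mink_H3_le[OF assms] ag by (intro mult_nonneg_nonpos) auto
  moreover have "\<alpha> \<noteq> 0 \<or> \<gamma> \<noteq> 0"
    using ag by auto
  then have "\<alpha>\<^sup>2 + \<gamma>\<^sup>2 > 0"
    by (simp add: sum_power2_gt_zero_iff)
  ultimately have "mink q q < 0"
    using assms by (simp add: H3_norm)
  define l where "l = 1 / sqrt (- mink q q)"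
  have l: "l > 0" "l\<^sup>2 * mink q q = -1"
    using \<open>mink q q < 0\<close> by (auto simp: l_def power_divide)
  define z where "z = l *\<^sub>R q"
  have "mink z z = -1"
    using l by (simp add: z_def mink_linear power2_eq_square mult.assoc)
  then have "z \<in> H3"
    using l Wq by (simp add: H3_coords mink_coords dot_square_norm z_def algebra_simps)
  have z: "z = (l * \<alpha>) *\<^sub>R x + (l * \<gamma>) *\<^sub>R y"
    by (simp add: z_def q_def scaleR_add_right)
  have "0 \<le> l * \<alpha>" "0 \<le> l * \<gamma>"
    using ag l by simp_all
  then have "z \<in> hyp_segment x y"
    unfolding hyp_segment_def using \<open>z \<in> H3\<close> z by blast
  moreover have "chart z = p"
  proof -
    have "W z = l"
      by (simp add: z_def Wq)
    then have "l * \<alpha> * W x / W z = 1 - t" "l * \<gamma> * W y / W z = t"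
      using ag l by (simp_all add: mult.assoc)
    then show ?thesis
      using chart_combination(1)[OF assms \<open>z \<in> H3\<close> z] p by simp
  qed
  ultimately show "p \<in> chart ` hyp_segment x y"
    by blast
qed

lemma hyp_convex_iff:
  assumes "C \<subseteq> H3"
  shows "hyp_convex C \<longleftrightarrow> convex (chart ` C)"
proof
  assume "hyp_convex C"
  then show "convex (chart ` C)"
    unfolding convex_contains_segment
  proof (intro ballI)
    fix p q assume "p \<in> chart ` C" "q \<in> chart ` C"
    then obtain x y where xy: "x \<in> C" "y \<in> C" "p = chart x" "q = chart y"
      by blast
    then have "hyp_segment x y \<subseteq> C"
      using \<open>hyp_convex C\<close> unfolding hyp_convex_def by blast
    moreover have "x \<in> H3" "y \<in> H3"
      using xy assms by blast+
    then have "closed_segment p q = chart ` hyp_segment x y"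
      unfolding xy by (rule chart_segment[symmetric])
    ultimately show "closed_segment p q \<subseteq> chart ` C"
      by (simp add: image_mono)
  qed
next
  assume cv: "convex (chart ` C)"
  have "z \<in> C" if "x \<in> C" "y \<in> C" "z \<in> hyp_segment x y" for x y z
  proof -
    have "chart z \<in> closed_segment (chart x) (chart y)"
      using chart_segment[of x y] that assms by blast
    also have "\<dots> \<subseteq> chart ` C"
      using cv that by (simp add: closed_segment_subset)
    finally obtain z' where "z' \<in> C" and "chart z = chart z'"
      by blast
    have "z \<in> H3"
      using that by (simp add: hyp_segment_def)
    then have "z = lift (chart z)"
      by (rule lift_chart[symmetric])
    also have "\<dots> = lift (chart z')"
      using \<open>chart z = chart z'\<close> by (rule arg_cong)
    also have "\<dots> = z'"
      by (rule lift_chart) (use \<open>z' \<in> C\<close> assms in blast)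
    finally show ?thesis
      using \<open>z' \<in> C\<close> by simp
  qed
  then show "hyp_convex C"
    unfolding hyp_convex_def using assms by blast
qed

lemma convex_region: "convex region"
proof (rule convexI)
  fix p q :: "complex \<times> real" and u v :: real
  assume pq: "p \<in> region" "q \<in> region" and uv: "0 \<le> u" "0 \<le> v" "u + v = 1"
  have p: "(norm (fst p))\<^sup>2 / 2 < snd p" and q: "(norm (fst q))\<^sup>2 / 2 < snd q"
    using pq by (auto simp: region_def)
  have v: "v = 1 - u"
    using uv by simp
  have "u * (norm (fst p))\<^sup>2 + v * (norm (fst q))\<^sup>2 - (norm (u *\<^sub>R fst p + v *\<^sub>R fst q))\<^sup>2
      = u * v * (norm (fst p - fst q))\<^sup>2"
    unfolding cmod_power2 v by simp algebra
  moreover have "0 \<le> u * v * (norm (fst p - fst q))\<^sup>2"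
    using uv by simp
  ultimately have "(norm (u *\<^sub>R fst p + v *\<^sub>R fst q))\<^sup>2 / 2 \<le> u * ((norm (fst p))\<^sup>2 / 2) + v * ((norm (fst q))\<^sup>2 / 2)"
    by simp
  also have "\<dots> < u * snd p + v * snd q"
  proof (cases "u = 0")
    case True
    then show ?thesis using q uv by simp
  next
    case False
    then show ?thesis
      using uv p q by (intro add_less_le_mono mult_strict_left_mono mult_left_mono) auto
  qed
  finally show "u *\<^sub>R p + v *\<^sub>R q \<in> region"
    by (simp add: region_def case_prod_beta)
qed

lemma hyp_convex_H3: "hyp_convex H3"
  by (simp add: hyp_convex_iff chart_H3 convex_region)

lemma hyp_convex_hull_subset: "A \<subseteq> H3 \<Longrightarrow> hyp_convex hull A \<subseteq> H3"
  by (simp add: hull_minimal hyp_convex_H3)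

lemma hyp_convex_hyp_hull:
  assumes "A \<subseteq> H3"
  shows "hyp_convex (hyp_convex hull A)"
  unfolding hyp_convex_def[of "hyp_convex hull A"]
proof (intro conjI ballI hyp_convex_hull_subset[OF assms])
  fix x y assume xy: "x \<in> hyp_convex hull A" "y \<in> hyp_convex hull A"
  have "hyp_segment x y \<subseteq> C" if C: "hyp_convex C" "A \<subseteq> C" for C
  proof -
    have "hyp_convex hull A \<subseteq> C"
      using C(2,1) by (rule hull_minimal)
    then have "x \<in> C" "y \<in> C"
      using xy by blast+
    then show ?thesis
      using C(1) unfolding hyp_convex_def[of C] by blast
  qed
  then show "hyp_segment x y \<subseteq> hyp_convex hull A"
    unfolding hull_def by (intro Inter_greatest) blast
qed

lemma chart_hull:
  assumes "A \<subseteq> H3"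
  shows "chart ` (hyp_convex hull A) = convex hull (chart ` A)"
proof
  have sub: "convex hull (chart ` A) \<subseteq> region"
    using assms chart_H3 by (intro hull_minimal convex_region) blast
  then have L: "lift ` (convex hull (chart ` A)) \<subseteq> H3"
    using lift_in_H3 by blast
  have cl: "chart ` lift ` (convex hull (chart ` A)) = convex hull (chart ` A)"
  proof -
    have "chart ` lift ` B = B" if "B \<subseteq> region" for B
      using that chart_lift by (force simp: image_image)
    then show ?thesis
      using sub by blast
  qed
  have "hyp_convex hull A \<subseteq> lift ` (convex hull (chart ` A))"
  proof (rule hull_minimal)
    show "A \<subseteq> lift ` (convex hull (chart ` A))"
    proof
      fix x assume "x \<in> A"
      then have "chart x \<in> convex hull (chart ` A)" "lift (chart x) = x"
        using assms lift_chart by (auto intro: hull_inc)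
      then show "x \<in> lift ` (convex hull (chart ` A))"
        by force
    qed
    show "hyp_convex (lift ` (convex hull (chart ` A)))"
      using hyp_convex_iff[OF L] cl by (simp add: convex_convex_hull)
  qed
  then show "chart ` (hyp_convex hull A) \<subseteq> convex hull (chart ` A)"
    using cl by blast
  show "convex hull (chart ` A) \<subseteq> chart ` (hyp_convex hull A)"
    using hyp_convex_iff[OF hyp_convex_hull_subset[OF assms]] hyp_convex_hyp_hull[OF assms]
    by (intro hull_minimal image_mono hull_subset) auto
qed

lemma pos_hull:
  assumes "A \<subseteq> H3"
  shows "pos ` (hyp_convex hull A) = convex hull (pos ` A)"
proof -
  have "pos ` B = fst ` chart ` B" for B
    by (simp add: image_image)
  then show ?thesis
    using chart_hull[OF assms] convex_hull_linear_image[OF linear_fst, of "chart ` A"] by simp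
qed

text \<open>Through this, linear independence of vertices and linear identities at vertices bear on
  whole triangles.\<close>

lemma hyp_hull_subset_span:
  assumes "A \<subseteq> H3"
  shows "hyp_convex hull A \<subseteq> span A"
proof -
  have "hyp_convex hull A \<subseteq> H3 \<inter> span A"
  proof (rule hull_minimal)
    show "A \<subseteq> H3 \<inter> span A"
      using assms span_superset by blast
    show "hyp_convex (H3 \<inter> span A)"
      by (auto simp: hyp_convex_def hyp_segment_def intro: span_add span_scale)
  qed
  then show ?thesis by blast
qed

end

section \<open>The polyhedron as an epigraph\<close>

text \<open>A point outside gives a separating line, and far behind it there is a point at distance
  more than \<open>R\<close> from the set.\<close>

lemma convex_dense_eq_UNIV:
  fixes C :: "complex set"
  assumes "convex C" "\<And>y. \<exists>z\<in>C. dist z y \<le> R"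
  shows "C = UNIV"
proof (rule ccontr)
  assume "C \<noteq> UNIV"
  then obtain y where y: "y \<notin> C"
    by blast
  have "C \<noteq> {}"
    using assms(2)[of 0] by blast
  then obtain a b where a: "a \<noteq> 0" "\<forall>x\<in>C. a \<bullet> x \<le> b" "\<forall>x\<in>{y}. b \<le> a \<bullet> x"
    using separating_hyperplane_sets[of C "{y}"] assms(1) y by auto
  obtain z where z: "z \<in> C" "dist z (y + ((\<bar>R\<bar> + 1) / norm a) *\<^sub>R a) \<le> R"
    using assms(2) by blast
  define w where "w = y + ((\<bar>R\<bar> + 1) / norm a) *\<^sub>R a"
  have "((\<bar>R\<bar> + 1) / norm a) * (a \<bullet> a) = (\<bar>R\<bar> + 1) * norm a"
    using a(1) by (simp add: dot_square_norm power2_eq_square)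
  then have "a \<bullet> w = a \<bullet> y + (\<bar>R\<bar> + 1) * norm a"
    by (simp add: w_def inner_add_right)
  moreover have "a \<bullet> (w - z) \<le> norm a * norm (w - z)"
    by (rule norm_cauchy_schwarz)
  moreover have "norm a * norm (w - z) \<le> norm a * \<bar>R\<bar>"
    using z(2) by (intro mult_left_mono) (auto simp: w_def dist_norm norm_minus_commute)
  ultimately have "a \<bullet> z \<ge> a \<bullet> y + norm a"
    by (simp add: inner_diff_right algebra_simps)
  moreover have "a \<bullet> z \<le> b" "b \<le> a \<bullet> y" "norm a > 0"
    using a z(1) by auto
  ultimately show False
    by linarith
qed

text \<open>Two consequences of the group action are kept: \<open>dense\<close> expresses
  cocompactness on horospheres, and \<open>bounded_W\<close> comes from the finitely many vertex
  orbits, on each of which \<open>W\<close> is constant.\<close>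

locale chart_polyhedron = null_frame +
  fixes P :: "(real^4) set" and T :: "(real^4) set set"
  assumes hyp_convex_P: "hyp_convex P"
    and triangulation: "triangulation_of (hyp_boundary P) (hyp_vertices P) T"
    and boundary_nonempty: "hyp_boundary P \<noteq> {}"
    and dense: "x \<in> P \<Longrightarrow> \<exists>R. \<forall>y. \<exists>x'\<in>P. W x' = W x \<and> dist (pos x') y \<le> R"
    and bounded_W: "\<exists>w. \<forall>v\<in>hyp_vertices P. W v \<le> w"
begin

lemma P_H3: "P \<subseteq> H3"
  using hyp_convex_P by (simp add: hyp_convex_def)

lemma triangles:
  assumes "\<sigma> \<in> T"
  shows "\<sigma> \<subseteq> H3" "card \<sigma> = 3" "independent \<sigma>" "finite \<sigma>"
proof -
  have "\<forall>\<sigma>\<in>T. \<sigma> \<subseteq> H3 \<and> card \<sigma> = 3 \<and> independent \<sigma>"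
    using triangulation unfolding triangulation_of_def by (elim conjE)
  then have s: "\<sigma> \<subseteq> H3 \<and> card \<sigma> = 3 \<and> independent \<sigma>"
    using assms by (rule bspec)
  then show "\<sigma> \<subseteq> H3" "card \<sigma> = 3" "independent \<sigma>"
    by simp_all
  show "finite \<sigma>"
    using s by (intro card_ge_0_finite) simp
qed

lemma triangles_Int:
  assumes "\<sigma> \<in> T" "\<tau> \<in> T"
  shows "(hyp_convex hull \<sigma>) \<inter> (hyp_convex hull \<tau>) = hyp_convex hull (\<sigma> \<inter> \<tau>)"
proof -
  have "\<forall>\<sigma>\<in>T. \<forall>\<tau>\<in>T. (hyp_convex hull \<sigma>) \<inter> (hyp_convex hull \<tau>) = hyp_convex hull (\<sigma> \<inter> \<tau>)"
    using triangulation unfolding triangulation_of_def by (elim conjE)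
  then show ?thesis
    by (rule bspec[OF bspec[OF _ assms(1)] assms(2)])
qed

lemma locally_finite_boundary:
  assumes "x \<in> hyp_boundary P"
  obtains U where "open U" "x \<in> U" "finite {\<sigma>\<in>T. (hyp_convex hull \<sigma>) \<inter> U \<noteq> {}}"
proof -
  have "\<forall>x\<in>hyp_boundary P. \<exists>U. open U \<and> x \<in> U \<and> finite {\<sigma>\<in>T. (hyp_convex hull \<sigma>) \<inter> U \<noteq> {}}"
    using triangulation unfolding triangulation_of_def by (elim conjE)
  from bspec[OF this assms] show thesis
    using that by blast
qed

lemma boundary_eq: "hyp_boundary P = (\<Union>\<sigma>\<in>T. hyp_convex hull \<sigma>)"
  using triangulation unfolding triangulation_of_def by (elim conjE)

lemma vertices_eq: "hyp_vertices P = \<Union>T"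
  using triangulation unfolding triangulation_of_def by (elim conjE)

lemma vertices_P: "hyp_vertices P \<subseteq> P"
  by (auto simp: hyp_vertices_def)

lemma boundary_P: "hyp_boundary P \<subseteq> P"
proof -
  have "hyp_convex hull \<sigma> \<subseteq> P" if "\<sigma> \<in> T" for \<sigma>
    using vertices_P that hyp_convex_P by (intro hull_minimal) (auto simp: vertices_eq)
  then show ?thesis
    unfolding boundary_eq by blast
qed

definition Q :: "(complex \<times> real) set" where "Q = chart ` P"

lemma Q_region: "Q \<subseteq> region"
  using P_H3 chart_H3 by (auto simp: Q_def)

lemma convex_Q: "convex Q"
  using hyp_convex_P hyp_convex_iff[OF P_H3] by (simp add: Q_def)

lemma chart_boundary: "chart ` hyp_boundary P = region \<inter> frontier Q"
proof -
  have "chart ` hyp_boundary P = top_of_set region frontier_of Q"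
    unfolding hyp_boundary_def Q_def
    by (rule homeomorphic_map_frontier_of[OF homeomorphic_chart, symmetric]) (simp add: P_H3)
  also have "\<dots> = region \<inter> frontier Q"
    using frontier_of_subtopology_open[of euclidean region Q] open_region by simp
  finally show ?thesis .
qed

text \<open>All vertices lie in one horoball at \<open>c\<close>, which in the chart is the
  paraboloid epigraph raised by \<open>\<delta>\<close>. It is convex, so it contains the triangles
  and hence the boundary.\<close>

lemma boundary_gap:
  obtains \<delta> where "\<delta> > 0" "\<And>y s. (y, s) \<in> region \<inter> frontier Q \<Longrightarrow> (norm y)\<^sup>2 / 2 + \<delta> \<le> s"
proof -
  obtain w0 where w0: "\<And>v. v \<in> hyp_vertices P \<Longrightarrow> W v \<le> w0"
    using bounded_W by blast
  define w where "w = max w0 1"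
  have w: "w > 0" "\<And>v. v \<in> hyp_vertices P \<Longrightarrow> W v \<le> w"
    using w0 by (auto simp: w_def le_max_iff_disj)
  define \<delta> where "\<delta> = 1 / (2 * w\<^sup>2)"
  have "\<delta> > 0"
    using w by (simp add: \<delta>_def)
  moreover have "(norm y)\<^sup>2 / 2 + \<delta> \<le> s" if "(y, s) \<in> region \<inter> frontier Q" for y s
  proof -
    obtain \<sigma> where \<sigma>: "\<sigma> \<in> T" "(y, s) \<in> chart ` (hyp_convex hull \<sigma>)"
      using \<open>(y, s) \<in> region \<inter> frontier Q\<close> unfolding chart_boundary[symmetric] boundary_eq by blast
    define E where "E = (+) (0, \<delta>) ` closure region"
    have "chart v \<in> E" if "v \<in> \<sigma>" for v
    proof -
      have v: "v \<in> H3" "v \<in> hyp_vertices P"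
        using that \<sigma>(1) triangles(1) vertices_eq by blast+
      have "(W v)\<^sup>2 \<le> w\<^sup>2" "0 < (W v)\<^sup>2"
        using w(2)[OF v(2)] W_pos[OF v(1)] by (auto intro: power_mono)
      then have "\<delta> \<le> 1 / (2 * (W v)\<^sup>2)"
        unfolding \<delta>_def by (intro frac_le) auto
      then have h: "(norm (pos v))\<^sup>2 / 2 \<le> ht v - \<delta>"
        unfolding ht_eq[OF v(1)] by simp
      have "(pos v, ht v - \<delta>) \<in> closure region"
      proof (rule closure_approachable[THEN iffD2], intro allI impI)
        fix e :: real assume "e > 0"
        then have "(pos v, ht v - \<delta> + e / 2) \<in> region"
          using h by (simp add: region_def)
        moreover have "dist (pos v, ht v - \<delta> + e / 2) (pos v, ht v - \<delta>) < e"
          using \<open>e > 0\<close> by (simp add: dist_Pair_Pair dist_real_def)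
        ultimately show "\<exists>p\<in>region. dist p (pos v, ht v - \<delta>) < e"
          by blast
      qed
      then have "(0, \<delta>) + (pos v, ht v - \<delta>) \<in> E"
        unfolding E_def by (rule imageI)
      then show ?thesis
        by (simp add: chart_def)
    qed
    then have "chart ` \<sigma> \<subseteq> E"
      by blast
    moreover have "convex E"
      unfolding E_def by (intro convex_translation convex_closure convex_region)
    ultimately have "convex hull (chart ` \<sigma>) \<subseteq> E"
      by (rule hull_minimal)
    then have "(y, s) \<in> E"
      using \<sigma>(2) unfolding chart_hull[OF triangles(1)[OF \<sigma>(1)]] by blast
    then have ys: "(y, s - \<delta>) \<in> closure region"
      by (auto simp: E_def)
    have "closure region \<subseteq> {p. (norm (fst p))\<^sup>2 / 2 \<le> snd p}"
      by (intro closure_minimal closed_Collect_le continuous_intros) (auto simp: region_def)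
    then show ?thesis
      using ys by auto
  qed
  ultimately show thesis
    using that by blast
qed

text \<open>The layer \<open>N\<close> below the raised paraboloid is connected and free of frontier
  points, so it lies inside or outside \<open>Q\<close>. If inside, convexity fills the whole model
  and no boundary remains.\<close>

lemma Q_gap:
  obtains \<delta> where "\<delta> > 0" "\<And>y s. (y, s) \<in> Q \<Longrightarrow> (norm y)\<^sup>2 / 2 + \<delta> \<le> s"
proof -
  obtain \<delta> where \<delta>: "\<delta> > 0" "\<And>y s. (y, s) \<in> region \<inter> frontier Q \<Longrightarrow> (norm y)\<^sup>2 / 2 + \<delta> \<le> s"
    using boundary_gap by blast
  define N where "N = {(y :: complex, s). (norm y)\<^sup>2 / 2 < s \<and> s < (norm y)\<^sup>2 / 2 + \<delta>}"
  have "N = (\<lambda>p. (fst p, (norm (fst p))\<^sup>2 / 2 + snd p)) ` (UNIV \<times> {0<..<\<delta>})"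
  proof (intro equalityI subsetI)
    fix p assume "p \<in> N"
    then have "(fst p, snd p - (norm (fst p))\<^sup>2 / 2) \<in> UNIV \<times> {0<..<\<delta>}"
      "p = (fst p, (norm (fst p))\<^sup>2 / 2 + (snd p - (norm (fst p))\<^sup>2 / 2))"
      by (auto simp: N_def)
    then show "p \<in> (\<lambda>p. (fst p, (norm (fst p))\<^sup>2 / 2 + snd p)) ` (UNIV \<times> {0<..<\<delta>})"
      by (metis (no_types, lifting) fst_conv image_eqI snd_conv)
  qed (auto simp: N_def)
  moreover have "connected ((\<lambda>p. (fst p, (norm (fst p))\<^sup>2 / 2 + snd p)) ` ((UNIV :: complex set) \<times> {0<..<\<delta>}))"
    by (intro connected_continuous_image continuous_intros connected_Times connected_UNIV connected_Ioo) simp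
  ultimately have "connected N"
    by simp
  have NF: "N \<inter> frontier Q = {}"
    using \<delta>(2) by (fastforce simp: N_def region_def)
  have "N \<inter> Q = {}"
  proof (rule ccontr)
    assume "N \<inter> Q \<noteq> {}"
    then have "N \<subseteq> Q"
      using connected_Int_frontier[OF \<open>connected N\<close>] NF by blast
    have "region \<subseteq> Q"
    proof
      fix p assume p: "p \<in> region"
      obtain y s where ys: "p = (y, s)"
        by fastforce
      define q where "q = 2 * s - (norm y)\<^sup>2"
      have "q > 0"
        using p by (simp add: ys region_def q_def)
      show "p \<in> Q"
      proof (cases "q < 2 * \<delta>")
        case True
        then have "p \<in> N"
          using \<open>q > 0\<close> by (simp add: N_def ys q_def)
        then show ?thesis
          using \<open>N \<subseteq> Q\<close> by blast
      next
        case False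
        obtain v where v: "norm v = 1" "y \<bullet> v = 0"
        proof (cases "y = 0")
          case True
          then show ?thesis using that[of 1] by simp
        next
          case False
          have "y \<bullet> ((1 / norm y) *\<^sub>R (\<i> * y)) = 0"
            by (simp add: inner_complex_def)
          then show ?thesis
            using that[of "(1 / norm y) *\<^sub>R (\<i> * y)"] False by (simp add: norm_mult)
        qed
        \<comment> \<open>At \<open>y + u\<close> and \<open>y - u\<close> the gap \<open>q\<close>
          has shrunk to \<open>\<delta>\<close>, so \<open>p\<close> is the midpoint of two points
          of \<open>N\<close>.\<close>
        define u where "u = sqrt (q - \<delta>) *\<^sub>R v"
        have u: "(norm u)\<^sup>2 = q - \<delta>" "y \<bullet> u = 0"
          using False \<delta>(1) v by (simp_all add: u_def)
        have "(norm (y + u))\<^sup>2 = (norm y)\<^sup>2 + (q - \<delta>)" "(norm (y - u))\<^sup>2 = (norm y)\<^sup>2 + (q - \<delta>)"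
          using u by (simp_all add: power2_norm_eq_inner inner_add_left inner_add_right inner_diff_left
              inner_diff_right inner_commute[of u y] del: dot_square_norm)
        then have "(y + u, s) \<in> N" "(y - u, s) \<in> N"
          using \<delta>(1) by (simp_all add: N_def q_def field_simps)
        then have "(1/2) *\<^sub>R (y + u, s) + (1/2) *\<^sub>R (y - u, s) \<in> Q"
          using \<open>N \<subseteq> Q\<close> by (intro convexD[OF convex_Q]) auto
        moreover have "(1/2) *\<^sub>R (y + u, s) + (1/2) *\<^sub>R (y - u, s) = p"
          by (simp add: ys) (simp add: complex_eq_iff field_simps)
        ultimately show ?thesis
          by simp
      qed
    qed
    then have "Q = region"
      using Q_region by blast
    then have "region \<inter> frontier Q = {}"
      using frontier_disjoint_eq[of region] open_region by (simp add: Int_commute)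
    then show False
      using boundary_nonempty chart_boundary by simp
  qed
  then have "(norm y)\<^sup>2 / 2 + \<delta> \<le> s" if "(y, s) \<in> Q" for y s
    using that Q_region by (fastforce simp: N_def region_def)
  then show thesis
    using that \<delta>(1) by blast
qed

text \<open>The gap keeps the closure of \<open>Q\<close> inside the open model, so the relative
  frontier is the full one. It belongs to \<open>Q\<close> because it is covered by triangles with
  vertices in \<open>P\<close>.\<close>

lemma frontier_Q: "frontier Q = chart ` hyp_boundary P" and closed_Q: "closed Q"
proof -
  obtain \<delta> where \<delta>: "\<delta> > 0" "\<And>y s. (y, s) \<in> Q \<Longrightarrow> (norm y)\<^sup>2 / 2 + \<delta> \<le> s"
    using Q_gap by blast
  have "closure Q \<subseteq> {p. (norm (fst p))\<^sup>2 / 2 + \<delta> \<le> snd p}"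
    using \<delta>(2) by (intro closure_minimal closed_Collect_le continuous_intros) auto
  also have "\<dots> \<subseteq> region"
    using \<delta>(1) by (auto simp: region_def)
  finally have "closure Q \<subseteq> region" .
  then show F: "frontier Q = chart ` hyp_boundary P"
    unfolding chart_boundary by (auto simp: frontier_def)
  have "frontier Q \<subseteq> Q"
    unfolding F using boundary_P by (auto simp: Q_def)
  then show "closed Q"
    by (simp add: frontier_subset_eq)
qed

text \<open>
  The segments from a point of \<open>P\<close> to remote points of the same height converge to the vertical ray.
\<close>

lemma upward_closed:
  assumes "(y, s) \<in> Q" "h \<ge> 0"
  shows "(y, s + h) \<in> Q"
proof -
  obtain x where x: "x \<in> P" "(y, s) = chart x"
    using assms(1) by (auto simp: Q_def)
  obtain R where R: "\<And>z. \<exists>x'\<in>P. W x' = W x \<and> dist (pos x') z \<le> R"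
    using dense[OF x(1)] by blast
  have "(y, s + h) \<in> closure Q"
  proof (rule closure_approachable[THEN iffD2], intro allI impI)
    fix e :: real assume "e > 0"
    \<comment> \<open>A point of \<open>Q\<close> over a plane point of norm
      \<open>n \<ge> m\<close> has height at least \<open>n^2 / 2\<close>, which exceeds
      \<open>s\<close> by at least \<open>n^2 / 4\<close>. On the segment to it, the horizontal
      error at height \<open>s + h\<close> is then at most \<open>8 * h / n\<close>, below
      \<open>e\<close>.\<close>
    define m where "m = 1 + norm y + 4 * \<bar>s\<bar> + 4 * h + 8 * h / e"
    have "0 \<le> 8 * h / e"
      using assms(2) \<open>e > 0\<close> by simp
    then have m: "1 \<le> m" "norm y \<le> m" "4 * \<bar>s\<bar> + 4 * h \<le> m"
      using assms(2) norm_ge_zero[of y] unfolding m_def by linarith+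
    have "m * e = (1 + norm y + 4 * \<bar>s\<bar> + 4 * h) * e + 8 * h"
      using \<open>e > 0\<close> by (simp add: m_def distrib_right)
    moreover have "0 < (1 + norm y + 4 * \<bar>s\<bar> + 4 * h) * e"
      using \<open>e > 0\<close> assms(2) norm_ge_zero[of y] by (intro mult_pos_pos) linarith+
    ultimately have m4: "8 * h < m * e"
      by linarith
    obtain x' where x': "x' \<in> P" "W x' = W x" "dist (pos x') (of_real (m + \<bar>R\<bar>)) \<le> R"
      using R by blast
    define n where "n = norm (pos x')"
    have "norm (of_real (m + \<bar>R\<bar>) :: complex) = m + \<bar>R\<bar>"
      using m(1) by (simp only: norm_of_real)
    then have "m \<le> n"
      using x'(3) norm_triangle_ineq2[of "of_real (m + \<bar>R\<bar>)" "pos x'"]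
      unfolding n_def dist_norm norm_minus_commute[of "pos x'"] by linarith
    have "x' \<in> H3"
      using x'(1) P_H3 by blast
    define s' where "s' = ht x'"
    have "(pos x', s') \<in> Q"
      using x'(1) by (auto simp: Q_def chart_def s'_def)
    have "n\<^sup>2 / 2 \<le> s'"
      using ht_eq[OF \<open>x' \<in> H3\<close>] by (simp add: s'_def n_def)
    have "m * n \<le> n * n" "1 * n \<le> m * n"
      using m \<open>m \<le> n\<close> by (auto intro!: mult_right_mono)
    have nn: "n * n \<ge> m * n" "n * n \<ge> n" "n \<ge> m" "n \<ge> 1"
      using \<open>m * n \<le> n * n\<close> \<open>1 * n \<le> m * n\<close> \<open>m \<le> n\<close> m(1) by linarith+
    have big: "s' - s \<ge> n * n / 4" "s' - s \<ge> h" "s' - s > 0"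
    proof -
      have "4 * \<bar>s\<bar> + 4 * h \<le> n * n"
        using m(3) nn by linarith
      moreover have "s' \<ge> n * n / 2"
        using \<open>n\<^sup>2 / 2 \<le> s'\<close> by (simp add: power2_eq_square)
      ultimately show "s' - s \<ge> n * n / 4" "s' - s \<ge> h" "s' - s > 0"
        using assms(2) nn by linarith+
    qed
    define \<tau> where "\<tau> = h / (s' - s)"
    have \<tau>: "0 \<le> \<tau>" "\<tau> \<le> 1" "\<tau> * (s' - s) = h"
      using assms(2) big by (simp_all add: \<tau>_def)
    have "(1 - \<tau>) *\<^sub>R (y, s) + \<tau> *\<^sub>R (pos x', s') \<in> Q"
      using \<tau> assms(1) \<open>(pos x', s') \<in> Q\<close> by (intro convexD[OF convex_Q]) auto
    moreover have "(1 - \<tau>) *\<^sub>R (y, s) + \<tau> *\<^sub>R (pos x', s') = (y + \<tau> *\<^sub>R (pos x' - y), s + h)"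
      by (simp add: algebra_simps flip: \<tau>(3))
    moreover have "dist (y + \<tau> *\<^sub>R (pos x' - y), s + h) (y, s + h) < e"
    proof -
      have "norm (pos x' - y) \<le> 2 * n"
        using norm_triangle_ineq4[of "pos x'" y] m(2) nn(3) by (simp add: n_def)
      then have "\<tau> * norm (pos x' - y) \<le> \<tau> * (2 * n)"
        using \<tau>(1) by (rule mult_left_mono)
      also have "\<dots> \<le> (h / (n * n / 4)) * (2 * n)"
      proof -
        have "n > 0"
          using nn(4) by linarith
        then have "\<tau> \<le> h / (n * n / 4)"
          unfolding \<tau>_def using big(1) assms(2) by (intro frac_le) simp_all
        then show ?thesis
          using \<open>n > 0\<close> by (intro mult_right_mono) simp_all
      qed
      also have "\<dots> = 8 * h / n"
        using nn by (simp add: field_simps)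
      also have "\<dots> < e"
      proof -
        have "m * e \<le> n * e"
          using nn(3) \<open>e > 0\<close> by (simp add: mult_right_mono)
        then show ?thesis
          using m4 nn(4) by (simp add: divide_less_eq mult.commute)
      qed
      finally show ?thesis
        using \<tau>(1) by (simp add: dist_Pair_Pair dist_norm)
    qed
    ultimately show "\<exists>p\<in>Q. dist p (y, s + h) < e"
      by metis
  qed
  then show ?thesis
    using closed_Q by simp
qed

lemma fst_Q: "fst ` Q = UNIV"
proof -
  obtain x where "x \<in> P"
    using boundary_nonempty boundary_P by blast
  then obtain R where R: "\<And>z. \<exists>x'\<in>P. W x' = W x \<and> dist (pos x') z \<le> R"
    using dense by blast
  have "\<exists>z\<in>fst ` Q. dist z y \<le> R" for y
    using R[of y] by (auto simp: Q_def image_image)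
  then show ?thesis
    by (intro convex_dense_eq_UNIV convex_linear_image linear_fst convex_Q)
qed

definition f :: "complex \<Rightarrow> real" where "f y = Inf {s. (y, s) \<in> Q}"

text \<open>Every vertical line meets \<open>Q\<close> in a nonempty closed set that is bounded
  below by the paraboloid and closed upwards, hence in a ray.\<close>

lemma Q_epigraph: "Q = epigraph UNIV f"
proof -
  have "(y, s) \<in> Q \<longleftrightarrow> f y \<le> s" for y s
  proof -
    obtain s0 where s0: "(y, s0) \<in> Q"
      using fst_Q by (metis UNIV_I imageE prod.collapse)
    have bdd: "bdd_below {s. (y, s) \<in> Q}"
      using Q_region by (intro bdd_belowI[of _ "(norm y)\<^sup>2 / 2"]) (auto simp: region_def)
    have "closed ((\<lambda>s. (y, s)) -` Q)"
      by (intro closed_vimage closed_Q continuous_intros)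
    then have "closed {s. (y, s) \<in> Q}"
      by (simp add: vimage_def)
    then have "(y, f y) \<in> Q"
      using closed_contains_Inf[of "{s. (y, s) \<in> Q}"] bdd s0 unfolding f_def by blast
    then have "(y, s) \<in> Q" if "f y \<le> s"
      using upward_closed[of y "f y" "s - f y"] that by simp
    moreover have "f y \<le> s" if "(y, s) \<in> Q"
      unfolding f_def by (rule cInf_lower[OF _ bdd]) (use that in simp)
    ultimately show ?thesis
      by blast
  qed
  then show ?thesis
    by (auto simp: epigraph_def)
qed

lemma convex_f: "convex_on UNIV f"
  using convex_Q convex_epigraph Q_epigraph by metis

lemma continuous_f: "continuous_on UNIV f"
  by (rule convex_on_continuous[OF open_UNIV convex_f])

lemma frontier_Q_graph: "frontier Q = {(y, f y) |y. True}"
proof -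
  have "open {p :: complex \<times> real. f (fst p) < snd p}"
    by (intro open_Collect_less continuous_on_compose2[OF continuous_f] continuous_intros) auto
  then have 1: "{p. f (fst p) < snd p} \<subseteq> interior Q"
    by (intro interior_maximal) (auto simp: Q_epigraph epigraph_def)
  have 2: "(y, f y) \<notin> interior Q" for y
  proof
    assume "(y, f y) \<in> interior Q"
    then obtain e where e: "e > 0" "ball (y, f y) e \<subseteq> Q"
      by (auto simp: mem_interior)
    have "(y, f y - e / 2) \<in> ball (y, f y) e"
      using e(1) by (simp add: dist_Pair_Pair dist_real_def)
    then have "(y, f y - e / 2) \<in> Q"
      using e(2) by blast
    then show False
      using e(1) by (simp add: Q_epigraph epigraph_def)
  qed
  have "frontier Q = Q - interior Q"
    using closed_Q by (simp add: frontier_def)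
  also have "\<dots> = {(y, f y) |y. True}"
    using 1 2 by (force simp: Q_epigraph epigraph_def)
  finally show ?thesis .
qed

lemma boundary_graph: "x \<in> hyp_boundary P \<Longrightarrow> ht x = f (pos x)"
proof -
  assume "x \<in> hyp_boundary P"
  then have "chart x \<in> frontier Q"
    unfolding frontier_Q by (rule imageI)
  then show ?thesis
    by (auto simp: frontier_Q_graph chart_def)
qed

lemma boundary_H3: "hyp_boundary P \<subseteq> H3"
  using boundary_P P_H3 by blast

lemma boundary_inj: "x \<in> hyp_boundary P \<Longrightarrow> x' \<in> hyp_boundary P \<Longrightarrow> pos x = pos x' \<Longrightarrow> x = x'"
  using boundary_graph boundary_H3 by (intro chart_inj) auto

lemma graph_region: "(y, f y) \<in> region"
proof -
  have "(y, f y) \<in> Q"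
    by (simp add: Q_epigraph epigraph_def)
  then show ?thesis
    using Q_region by blast
qed

lemma lift_boundary: "lift (y, f y) \<in> hyp_boundary P" "pos (lift (y, f y)) = y"
proof -
  have "(y, f y) \<in> chart ` hyp_boundary P"
    unfolding frontier_Q[symmetric] frontier_Q_graph by blast
  then obtain x where x: "x \<in> hyp_boundary P" "(y, f y) = chart x"
    by blast
  then have "lift (y, f y) = x"
    using lift_chart boundary_H3 by auto
  then show "lift (y, f y) \<in> hyp_boundary P"
    using x by simp
  have "chart (lift (y, f y)) = (y, f y)"
    by (rule chart_lift[OF graph_region])
  then show "pos (lift (y, f y)) = y"
    by (simp add: chart_def)
qed

lemma lift_pos: "x \<in> hyp_boundary P \<Longrightarrow> lift (pos x, f (pos x)) = x"
  using boundary_inj lift_boundary by blast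

lemma hull_boundary: "\<sigma> \<in> T \<Longrightarrow> hyp_convex hull \<sigma> \<subseteq> hyp_boundary P"
  unfolding boundary_eq by blast

lemma triangle_boundary: "\<sigma> \<in> T \<Longrightarrow> \<sigma> \<subseteq> hyp_boundary P"
  by (rule order_trans[OF hull_subset hull_boundary])

lemma inj_on_pos: "inj_on pos (hyp_boundary P)"
  by (rule inj_onI) (rule boundary_inj)

text \<open>The edge from \<open>a\<close> to \<open>b\<close> would have a point over
  \<open>pos m\<close>. The boundary is a graph, so this point is \<open>m\<close> itself, which
  makes \<open>m\<close> linearly dependent on \<open>a\<close> and \<open>b\<close>.\<close>

lemma pos_not_between:
  assumes \<sigma>: "\<sigma> \<in> T" "a \<in> \<sigma>" "b \<in> \<sigma>" "m \<in> \<sigma>" "m \<noteq> a" "m \<noteq> b" and t: "0 \<le> t" "t \<le> 1"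
  shows "pos m \<noteq> (1 - t) *\<^sub>R pos a + t *\<^sub>R pos b"
proof
  assume e: "pos m = (1 - t) *\<^sub>R pos a + t *\<^sub>R pos b"
  have ab: "{a, b} \<subseteq> \<sigma>" "{a, b} \<subseteq> H3"
    using \<sigma> triangles(1)[OF \<sigma>(1)] by auto
  have "pos m \<in> convex hull (pos ` {a, b})"
    using t unfolding e image_insert image_empty segment_convex_hull[symmetric] in_segment by blast
  then obtain z where z: "z \<in> hyp_convex hull {a, b}" "pos z = pos m"
    unfolding pos_hull[OF ab(2), symmetric] by force
  have "z \<in> hyp_convex hull \<sigma>"
    using z(1) hull_mono[OF ab(1)] by blast
  then have "z \<in> hyp_boundary P" "m \<in> hyp_boundary P"
    using hull_boundary[OF \<sigma>(1)] triangle_boundary[OF \<sigma>(1)] \<sigma>(4) by blast+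
  then have "z = m"
    using z(2) by (rule boundary_inj)
  then have "m \<in> span {a, b}"
    using z(1) hyp_hull_subset_span[OF ab(2)] by blast
  moreover have "span {a, b} \<subseteq> span (\<sigma> - {m})"
    using ab(1) \<sigma>(5,6) by (intro span_mono) blast
  ultimately have "dependent \<sigma>"
    unfolding dependent_def using \<sigma>(4) by blast
  then show False
    using triangles(3)[OF \<sigma>(1)] by simp
qed

text \<open>Of three collinear projections one lies between the other two; the cases on
  \<open>t\<close> sort out which one.\<close>

lemma pos_triangle:
  assumes "\<sigma> \<in> T"
  shows "\<exists>i j k. \<sigma> = {i, j, k} \<and> det2 (pos j - pos i) (pos k - pos i) \<noteq> 0"
proof -
  have "\<exists>a b c. \<sigma> = {a, b, c} \<and> a \<noteq> b \<and> b \<noteq> c \<and> a \<noteq> c"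
    by (rule card_3_iff[THEN iffD1]) (rule triangles(2)[OF assms])
  then obtain a b c where s: "\<sigma> = {a, b, c}" "a \<noteq> b" "b \<noteq> c" "a \<noteq> c"
    by (elim exE conjE)
  have mem: "a \<in> \<sigma>" "b \<in> \<sigma>" "c \<in> \<sigma>"
    unfolding s(1) by simp_all
  have "det2 (pos b - pos a) (pos c - pos a) \<noteq> 0"
  proof
    assume "det2 (pos b - pos a) (pos c - pos a) = 0"
    moreover have "a \<in> hyp_boundary P" "b \<in> hyp_boundary P"
      using triangle_boundary[OF assms] mem by blast+
    then have "pos b - pos a \<noteq> 0"
      using boundary_inj s(2) by fastforce
    ultimately obtain t where t: "pos c - pos a = t *\<^sub>R (pos b - pos a)"
      using det2_zero_imp_scaleR by blast
    consider "0 \<le> t \<and> t \<le> 1" | "1 < t" | "t < 0"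
      by linarith
    then show False
    proof cases
      case 1
      have "pos c = (1 - t) *\<^sub>R pos a + t *\<^sub>R pos b"
        using t by (simp add: algebra_simps)
      then show False
        using pos_not_between[OF assms mem(1,2,3) s(4)[symmetric] s(3)[symmetric], of t] 1 by simp
    next
      case 2
      have "(1 / t) *\<^sub>R (pos c - pos a) = pos b - pos a"
        using 2 by (simp add: t)
      then have "pos b = (1 - 1 / t) *\<^sub>R pos a + (1 / t) *\<^sub>R pos c"
        by (simp add: algebra_simps)
      moreover have "0 \<le> 1 / t" "1 / t \<le> 1"
        using 2 by simp_all
      ultimately show False
        using pos_not_between[OF assms mem(1,3,2) s(2)[symmetric] s(3), of "1 / t"] by simp
    next
      case 3
      define r where "r = 1 / (1 - t)"
      have r: "0 \<le> r" "r \<le> 1" "r * (1 - t) = 1"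
        using 3 by (simp_all add: r_def)
      have "pos c - pos b = (1 - t) *\<^sub>R (pos a - pos b)"
        using t by (simp add: algebra_simps)
      then have "r *\<^sub>R (pos c - pos b) = pos a - pos b"
        using r(3) by simp
      then have "pos a = (1 - r) *\<^sub>R pos b + r *\<^sub>R pos c"
        by (simp add: algebra_simps)
      then show False
        using pos_not_between[OF assms mem(2,3,1) s(2) s(4) r(1,2)] by simp
    qed
  qed
  then show ?thesis
    using s(1) by (intro exI conjI)
qed

lemma pos_hull_triangle: "\<sigma> \<in> T \<Longrightarrow> convex hull (pos ` \<sigma>) = pos ` (hyp_convex hull \<sigma>)"
  by (rule pos_hull[OF triangles(1), symmetric])

text \<open>In the chart the triangle is a flat Euclidean triangle, and it lies in the
  graph.\<close>

lemma f_affine: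
  assumes "\<sigma> \<in> T"
  shows "\<exists>p k. \<forall>y\<in>convex hull (pos ` \<sigma>). f y = p \<bullet> y + k"
proof -
  obtain a b c where s: "\<sigma> = {a, b, c}" and d: "det2 (pos b - pos a) (pos c - pos a) \<noteq> 0"
    using pos_triangle[OF assms] by (elim exE conjE)
  obtain p where p: "p \<bullet> (pos b - pos a) = ht b - ht a" "p \<bullet> (pos c - pos a) = ht c - ht a"
    by (rule ex_inner_eq[OF d])
  have "f y = p \<bullet> y + (ht a - p \<bullet> pos a)" if y: "y \<in> convex hull (pos ` \<sigma>)" for y
  proof -
    have "y \<in> convex hull {pos a, pos b, pos c}"
      using y by (simp add: s)
    then obtain u v where uv: "0 \<le> u" "0 \<le> v" "u + v \<le> 1"
      and y': "y = pos a + u *\<^sub>R (pos b - pos a) + v *\<^sub>R (pos c - pos a)"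
      unfolding in_triangle_iff by blast
    define q where "q = chart a + u *\<^sub>R (chart b - chart a) + v *\<^sub>R (chart c - chart a)"
    have "q \<in> convex hull {chart a, chart b, chart c}"
      unfolding convex_hull_3_alt q_def using uv by blast
    then have "q \<in> chart ` (hyp_convex hull \<sigma>)"
      unfolding chart_hull[OF triangles(1)[OF assms]] by (simp add: s)
    then obtain z where z: "z \<in> hyp_convex hull \<sigma>" "q = chart z"
      by blast
    have "fst q = y" "snd q = ht a + u * (ht b - ht a) + v * (ht c - ht a)"
      by (simp_all add: q_def y')
    moreover have "ht z = f (pos z)"
      using z(1) hull_boundary[OF assms] by (intro boundary_graph) blast
    ultimately have "f y = ht a + u * (p \<bullet> (pos b - pos a)) + v * (p \<bullet> (pos c - pos a))"
      by (simp add: z(2) p)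
    also have "\<dots> = p \<bullet> y + (ht a - p \<bullet> pos a)"
      by (simp add: y' inner_add_right)
    finally show ?thesis .
  qed
  then show ?thesis
    by blast
qed

text \<open>Equality would place the vertex at the midpoint of a chord between two graph points.
  Chords are geodesics in the chart, so this contradicts the extremality of vertices.\<close>

lemma f_strict:
  assumes w: "w \<in> hyp_vertices P" and u: "u \<noteq> 0"
  shows "2 * f (pos w) < f (pos w + u) + f (pos w - u)"
proof (rule ccontr)
  assume n: "\<not> ?thesis"
  define v where "v = pos w"
  have wB: "w \<in> hyp_boundary P" "w \<in> H3"
    using w vertices_eq triangle_boundary boundary_H3 by blast+
  have "f ((1 - 1/2) *\<^sub>R (v + u) + (1/2) *\<^sub>R (v - u)) \<le> (1 - 1/2) * f (v + u) + (1/2) * f (v - u)"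
    by (rule convex_onD[OF convex_f]) auto
  moreover have "(1 - 1/2) *\<^sub>R (v + u) + (1/2) *\<^sub>R (v - u) = v"
    by (simp add: complex_eq_iff field_simps)
  ultimately have eq: "f v = (f (v + u) + f (v - u)) / 2"
    using n by (simp add: v_def)
  define x where "x = lift (v + u, f (v + u))"
  define x' where "x' = lift (v - u, f (v - u))"
  have L: "lift (y, f y) \<in> P" "lift (y, f y) \<in> H3" for y
    using lift_boundary(1)[of y] boundary_P boundary_H3 by blast+
  have x: "x \<in> P" "x \<in> H3" "pos x = v + u" "chart x = (v + u, f (v + u))"
    unfolding x_def by (rule L lift_boundary chart_lift graph_region)+
  have x': "x' \<in> P" "x' \<in> H3" "pos x' = v - u" "chart x' = (v - u, f (v - u))"
    unfolding x'_def by (rule L lift_boundary chart_lift graph_region)+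
  have "chart w = (v, f v)"
    using boundary_graph[OF wB(1)] by (simp add: chart_def v_def)
  also have "\<dots> = midpoint (chart x) (chart x')"
    unfolding x(4) x'(4) midpoint_def by (simp add: eq complex_eq_iff)
  finally have "chart w \<in> closed_segment (chart x) (chart x')"
    by simp
  then obtain z where z: "z \<in> hyp_segment x x'" "chart z = chart w"
    unfolding chart_segment[OF x(2) x'(2), symmetric] by force
  have "z \<in> H3"
    using z(1) by (simp add: hyp_segment_def)
  then have "z = w"
    using z(2) wB(2) by (intro chart_inj) (simp_all add: chart_def)
  then have "w = x \<or> w = x'"
    using z(1) w x(1) x'(1) unfolding hyp_vertices_def by blast
  then have "v = v + u \<or> v = v - u"
    using x(3) x'(3) v_def by metis
  then show False
    using u by simp
qed

lemma convex_triangulated: "convex_triangulated f ((`) pos ` T)"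
proof
  show "convex_on UNIV f"
    by (rule convex_f)
next
  fix \<sigma>' assume "\<sigma>' \<in> (`) pos ` T"
  then obtain \<sigma> where "\<sigma> \<in> T" and "\<sigma>' = pos ` \<sigma>"
    by blast
  obtain a b c where "\<sigma> = {a, b, c}" "det2 (pos b - pos a) (pos c - pos a) \<noteq> 0"
    using pos_triangle[OF \<open>\<sigma> \<in> T\<close>] by (elim exE conjE)
  then have "\<sigma>' = {pos a, pos b, pos c} \<and> det2 (pos b - pos a) (pos c - pos a) \<noteq> 0"
    using \<open>\<sigma>' = pos ` \<sigma>\<close> by simp
  then show "\<exists>a b c. \<sigma>' = {a, b, c} \<and> det2 (b - a) (c - a) \<noteq> 0"
    by (intro exI)
next
  fix \<sigma>' \<tau>' assume "\<sigma>' \<in> (`) pos ` T" "\<tau>' \<in> (`) pos ` T"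
  then obtain \<sigma> \<tau> where s: "\<sigma> \<in> T" "\<sigma>' = pos ` \<sigma>" and t: "\<tau> \<in> T" "\<tau>' = pos ` \<tau>"
    by blast
  have "convex hull \<sigma>' \<inter> convex hull \<tau>' = pos ` ((hyp_convex hull \<sigma>) \<inter> (hyp_convex hull \<tau>))"
    unfolding s(2) t(2) pos_hull_triangle[OF s(1)] pos_hull_triangle[OF t(1)]
    by (rule inj_on_image_Int[OF inj_on_pos hull_boundary[OF s(1)] hull_boundary[OF t(1)], symmetric])
  also have "\<dots> = convex hull (pos ` (\<sigma> \<inter> \<tau>))"
    unfolding triangles_Int[OF s(1) t(1)] using triangles(1)[OF s(1)] by (intro pos_hull) blast
  also have "pos ` (\<sigma> \<inter> \<tau>) = \<sigma>' \<inter> \<tau>'"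
    unfolding s(2) t(2)
    by (rule inj_on_image_Int[OF inj_on_pos triangle_boundary[OF s(1)] triangle_boundary[OF t(1)]])
  finally show "convex hull \<sigma>' \<inter> convex hull \<tau>' = convex hull (\<sigma>' \<inter> \<tau>')" .
next
  fix y
  obtain U where U: "open U" "lift (y, f y) \<in> U" and fin: "finite {\<sigma>\<in>T. (hyp_convex hull \<sigma>) \<inter> U \<noteq> {}}"
    using locally_finite_boundary[OF lift_boundary(1)] by blast
  \<comment> \<open>Local finiteness is pulled back along the continuous section
    \<open>lift (y, f y)\<close> of the boundary.\<close>
  define V where "V = (\<lambda>y. lift (y, f y)) -` U"
  have "continuous_on UNIV (\<lambda>y. lift (y, f y))"
    by (rule continuous_on_compose2[OF continuous_on_lift])
      (auto intro!: continuous_intros continuous_f graph_region)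
  then have "open V"
    unfolding V_def using U(1) by (simp add: open_vimage)
  moreover have "y \<in> V"
    using U(2) by (simp add: V_def)
  moreover have "{\<sigma>'\<in>(`) pos ` T. convex hull \<sigma>' \<inter> V \<noteq> {}} \<subseteq> (`) pos ` {\<sigma>\<in>T. (hyp_convex hull \<sigma>) \<inter> U \<noteq> {}}"
  proof
    fix \<sigma>' assume "\<sigma>' \<in> {\<sigma>'\<in>(`) pos ` T. convex hull \<sigma>' \<inter> V \<noteq> {}}"
    then obtain \<sigma> y' where s: "\<sigma> \<in> T" "\<sigma>' = pos ` \<sigma>" "y' \<in> convex hull \<sigma>'" "y' \<in> V"
      by blast
    then obtain z where z: "z \<in> hyp_convex hull \<sigma>" "y' = pos z"
      unfolding s(2) pos_hull_triangle[OF s(1)] by blast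
    then have "lift (pos z, f (pos z)) = z"
      using hull_boundary[OF s(1)] by (intro lift_pos) blast
    then have "z \<in> U"
      using s(4) z(2) by (simp add: V_def)
    then show "\<sigma>' \<in> (`) pos ` {\<sigma>\<in>T. (hyp_convex hull \<sigma>) \<inter> U \<noteq> {}}"
      using s(1,2) z(1) by blast
  qed
  then have "finite {\<sigma>'\<in>(`) pos ` T. convex hull \<sigma>' \<inter> V \<noteq> {}}"
    by (rule finite_subset) (rule finite_imageI[OF fin])
  ultimately show "\<exists>U. open U \<and> y \<in> U \<and> finite {\<sigma>'\<in>(`) pos ` T. convex hull \<sigma>' \<inter> U \<noteq> {}}"
    by blast
next
  fix y
  obtain \<sigma> where s: "\<sigma> \<in> T" "lift (y, f y) \<in> hyp_convex hull \<sigma>"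
    using lift_boundary(1)[of y] unfolding boundary_eq by blast
  then have "y \<in> convex hull (pos ` \<sigma>)"
    unfolding pos_hull_triangle[OF s(1)] using lift_boundary(2)[of y] by (intro image_eqI) simp_all
  then show "\<exists>\<sigma>'\<in>(`) pos ` T. y \<in> convex hull \<sigma>'"
    using s(1) by blast
next
  fix \<sigma>' assume "\<sigma>' \<in> (`) pos ` T"
  then show "\<exists>p k. \<forall>y\<in>convex hull \<sigma>'. f y = p \<bullet> y + k"
    using f_affine by blast
next
  fix v u :: complex assume v: "v \<in> \<Union>((`) pos ` T)" and u: "u \<noteq> 0"
  then obtain w where "w \<in> hyp_vertices P" "v = pos w"
    unfolding vertices_eq by blast
  then show "2 * f v < f (v + u) + f (v - u)"
    using f_strict[OF _ u] by simp
next
  fix y show "(norm y)\<^sup>2 / 2 \<le> f y"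
    using graph_region[of y] by (simp add: region_def)
qed

text \<open>Dividing \<open>mink (Z i) j\<close> by \<open>W i * W j\<close> expresses it by chart
  coordinates of \<open>j\<close> and rescaled components of \<open>Z i\<close>. Tangency at each
  vertex eliminates the component \<open>a\<close>, and the two-point Killing equation becomes the
  flex equation for \<open>b\<close> and \<open>e\<close>.\<close>

lemma infinitesimal_isometry_trivial:
  fixes Z :: "real^4 \<Rightarrow> real^4"
  assumes Z: "\<And>\<sigma> i j. \<sigma> \<in> T \<Longrightarrow> i \<in> \<sigma> \<Longrightarrow> j \<in> \<sigma> \<Longrightarrow> mink (Z i) j + mink i (Z j) = 0"
    and max: "\<exists>v\<in>hyp_vertices P. \<forall>w\<in>hyp_vertices P. W (Z w) / W w \<le> W (Z v) / W v"
  shows "\<exists>B. (\<forall>x y. mink (B *v x) y + mink x (B *v y) = 0) \<and> (\<forall>v\<in>hyp_vertices P. Z v = B *v v)"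
proof -
  define b where "b = (\<lambda>x. W (Z x) / W x)"
  define e where "e = (\<lambda>x. (1 / W x) *\<^sub>R Y (Z x))"
  define a where "a = (\<lambda>x. S (Z x) / W x)"
  have vertex: "v \<in> hyp_boundary P" "v \<in> H3" "ht v = f (pos v)" "W v > 0" "lift (pos v, f (pos v)) = v"
    if "v \<in> hyp_vertices P" for v
  proof -
    show 1: "v \<in> hyp_boundary P"
      using that triangle_boundary unfolding vertices_eq by blast
    then show 2: "v \<in> H3"
      using boundary_H3 by blast
    show "ht v = f (pos v)" "lift (pos v, f (pos v)) = v"
      using 1 by (simp_all add: boundary_graph lift_pos)
    show "W v > 0"
      using 2 by (rule W_pos)
  qed
  have pair: "e i \<bullet> pos j - a i - b i * ht j = mink (Z i) j / (W i * W j)" if "W i > 0" "W j > 0" for i j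
    using that by (simp add: mink_coords e_def pos_def a_def b_def ht_def diff_divide_distrib)
  have diag: "a i = e i \<bullet> pos i - b i * ht i" if "\<sigma> \<in> T" "i \<in> \<sigma>" for \<sigma> i
  proof -
    have "W i > 0"
      using that vertex(4) vertices_eq by blast
    moreover have "mink (Z i) i = 0"
      using Z[OF that that(2)] by (simp add: mink_commute)
    ultimately show ?thesis
      using pair[of i i] by simp
  qed
  define \<beta> where "\<beta> = (\<lambda>y. b (lift (y, f y)))"
  define \<eta> where "\<eta> = (\<lambda>y. e (lift (y, f y)))"
  have be: "\<beta> (pos v) = b v" "\<eta> (pos v) = e v" if "v \<in> hyp_vertices P" for v
    using vertex(5)[OF that] by (simp_all add: \<beta>_def \<eta>_def)
  have "flexed_triangulated f ((`) pos ` T) \<beta> \<eta>"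
  proof (intro flexed_triangulated.intro convex_triangulated flexed_triangulated_axioms.intro)
    fix \<sigma>' i' j' assume "\<sigma>' \<in> (`) pos ` T" "i' \<in> \<sigma>'" "j' \<in> \<sigma>'"
    then obtain \<sigma> i j where s: "\<sigma> \<in> T" "i \<in> \<sigma>" "j \<in> \<sigma>" and ij: "i' = pos i" "j' = pos j"
      by blast
    then have V: "i \<in> hyp_vertices P" "j \<in> hyp_vertices P"
      unfolding vertices_eq by blast+
    note w = vertex(4)[OF V(1)] vertex(4)[OF V(2)]
    have "(e i \<bullet> pos j - a i - b i * ht j) + (e j \<bullet> pos i - a j - b j * ht i)
        = (mink (Z i) j + mink (Z j) i) / (W i * W j)"
      unfolding pair[OF w] pair[OF w(2,1)] by (simp add: add_divide_distrib mult.commute)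
    then have "(e i \<bullet> pos j - a i - b i * ht j) + (e j \<bullet> pos i - a j - b j * ht i) = 0"
      using Z[OF s] by (simp add: mink_commute)
    then have "(b i - b j) * (ht i - ht j) = (e i - e j) \<bullet> (pos i - pos j)"
      using diag[OF s(1,2)] diag[OF s(1,3)] by (simp add: inner_diff_left inner_diff_right algebra_simps)
    then show "(\<beta> i' - \<beta> j') * (f i' - f j') = (\<eta> i' - \<eta> j') \<bullet> (i' - j')"
      unfolding ij be[OF V(1)] be[OF V(2)] vertex(3)[OF V(1)] vertex(3)[OF V(2)] .
  next
    obtain v where v: "v \<in> hyp_vertices P" "\<And>w. w \<in> hyp_vertices P \<Longrightarrow> b w \<le> b v"
      using max unfolding b_def by blast
    have "\<beta> w' \<le> \<beta> (pos v)" if w': "w' \<in> \<Union>((`) pos ` T)" for w'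
    proof -
      obtain w where "w \<in> hyp_vertices P" "w' = pos w"
        using w' unfolding vertices_eq by blast
      then show ?thesis
        using v be by simp
    qed
    moreover have "pos v \<in> \<Union>((`) pos ` T)"
      using v(1) unfolding vertices_eq by blast
    ultimately show "\<exists>v\<in>\<Union>((`) pos ` T). \<forall>w\<in>\<Union>((`) pos ` T). \<beta> w \<le> \<beta> v"
      by blast
  qed
  then interpret flexed_triangulated f "(`) pos ` T" \<beta> \<eta> .
  obtain k w r where k: "\<And>v. v \<in> \<Union>((`) pos ` T) \<Longrightarrow> \<beta> v = k"
    and wr: "\<And>v. v \<in> \<Union>((`) pos ` T) \<Longrightarrow> \<eta> v = w + r *\<^sub>R (\<i> * v)"
    using flex_trivial by blast
  \<comment> \<open>These are the infinitesimal isometries preserving the ray of \<open>c\<close>: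
    \<open>w\<close> generates parabolic motions, \<open>r\<close> rotations about the geodesic from
    \<open>c\<close> to \<open>d\<close>, and \<open>k\<close> translations along it.\<close>
  define L where "L = (\<lambda>x. vec (W x *\<^sub>R w + r *\<^sub>R (\<i> * Y x)) (w \<bullet> Y x - k * S x) (k * W x))"
  have "linear L"
  proof (rule linearI)
    show "L (x + y) = L x + L y" for x y
      by (rule coords_eqI) (simp_all add: L_def inner_add_right algebra_simps)
    show "L (t *\<^sub>R x) = t *\<^sub>R L x" for t x
      by (rule coords_eqI) (simp_all add: L_def algebra_simps)
  qed
  then have B: "matrix L *v x = L x" for x
    by (simp add: matrix_works)
  have "mink (L x) y + mink x (L y) = 0" for x y
    by (simp add: mink_coords L_def inner_complex_def algebra_simps)
  moreover have "Z v = L v" if v: "v \<in> hyp_vertices P" for v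
  proof -
    have "pos v \<in> \<Union>((`) pos ` T)"
      using v unfolding vertices_eq by blast
    then have bk: "b v = k" and ew: "e v = w + r *\<^sub>R (\<i> * pos v)"
      using k wr be[OF v] by auto
    have pos: "W v > 0"
      by (rule vertex(4)[OF v])
    have WY: "W v *\<^sub>R pos v = Y v" and WS: "W v * ht v = S v"
      using pos by (simp_all add: pos_def ht_def)
    obtain \<sigma> where "\<sigma> \<in> T" "v \<in> \<sigma>"
      using v unfolding vertices_eq by blast
    then have av: "a v = e v \<bullet> pos v - k * ht v"
      using diag bk by simp
    have "e v \<bullet> pos v = w \<bullet> pos v"
      by (simp add: ew inner_add_left inner_i_mult)
    show ?thesis
    proof (rule coords_eqI)
      have "Y (Z v) = W v *\<^sub>R e v"
        using pos by (simp add: e_def)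
      also have "\<dots> = W v *\<^sub>R w + r *\<^sub>R (\<i> * (W v *\<^sub>R pos v))"
        by (simp add: ew algebra_simps)
      finally show "Y (Z v) = Y (L v)"
        by (simp add: L_def WY)
      have "S (Z v) = W v * a v"
        using pos by (simp add: a_def)
      also have "\<dots> = w \<bullet> (W v *\<^sub>R pos v) - k * (W v * ht v)"
        by (simp add: av \<open>e v \<bullet> pos v = w \<bullet> pos v\<close> algebra_simps)
      finally show "S (Z v) = S (L v)"
        by (simp add: L_def WY WS)
      have "W (Z v) = W v * b v"
        using pos by (simp add: b_def)
      then show "W (Z v) = W (L v)"
        by (simp add: L_def bk)
    qed
  qed
  ultimately show ?thesis
    by (intro exI[of _ "matrix L"]) (simp add: B)
qed

end

section \<open>The parabolic group and rigidity\<close>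

text \<open>Each horosphere is preserved along the path, so \<open>mink\<close> with
  \<open>c\<close> is constant; its value and its derivative at time 0 give the two claims. Applying
  \<open>g\<close> cancels \<open>matrix_inv g\<close> in the definition of
  \<open>X\<close>.\<close>

lemma parabolic_killing_field_tangent:
  assumes "parabolic_killing_field c g X" "ideal_point c" "invertible g" "x \<in> H3"
  shows "mink (g *v x) c = mink x c" "mink (g *v X x) c = 0"
proof -
  obtain D :: "nat \<Rightarrow> real \<Rightarrow> real^4^4" and \<epsilon> where \<epsilon>: "\<epsilon> > 0"
    and deriv: "\<forall>k. \<forall>t\<in>{-\<epsilon><..<\<epsilon>}. (D k has_vector_derivative D (Suc k) t) (at t)"
    and path: "\<forall>t\<in>{-\<epsilon><..<\<epsilon>}. hyp_isometry (D 0 t) \<and> (\<forall>r>0. (*v) (D 0 t) ` horosphere c r = horosphere c r)"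
    and D0: "D 0 0 = g" and X: "\<forall>x\<in>H3. X x = matrix_inv g *v (D 1 0 *v x)"
    using assms(1) unfolding parabolic_killing_field_def by (elim exE conjE)
  define r where "r = - mink x c"
  have "r > 0"
    using mink_H3_ideal[OF assms(4,2)] by (simp add: r_def)
  have const: "mink (D 0 t *v x) c = mink x c" if "t \<in> {-\<epsilon><..<\<epsilon>}" for t
  proof -
    have "x \<in> horosphere c r"
      using assms(4) by (simp add: horosphere_def r_def)
    moreover have "(*v) (D 0 t) ` horosphere c r = horosphere c r"
      using bspec[OF path that] \<open>r > 0\<close> by simp
    ultimately have "D 0 t *v x \<in> horosphere c r"
      by blast
    then show ?thesis
      by (simp add: horosphere_def r_def)
  qed
  show "mink (g *v x) c = mink x c"
    using const[of 0] \<epsilon> D0 by simp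
  have "linear (\<lambda>A :: real^4^4. mink (A *v x) c)"
    by (rule linearI) (simp_all add: matrix_vector_mult_add_rdistrib scaleR_matrix_vector_assoc[symmetric] mink_linear)
  then have "bounded_linear (\<lambda>A :: real^4^4. mink (A *v x) c)"
    by (simp only: linear_conv_bounded_linear)
  moreover have "(D 0 has_vector_derivative D 1 0) (at 0)"
    using deriv \<epsilon> by simp
  ultimately have "((\<lambda>t. mink (D 0 t *v x) c) has_vector_derivative mink (D 1 0 *v x) c) (at 0)"
    by (rule bounded_linear.has_vector_derivative)
  then have "((\<lambda>t. mink x c) has_vector_derivative mink (D 1 0 *v x) c) (at 0)"
    by (rule has_vector_derivative_transform_within_open[of _ _ _ "{-\<epsilon><..<\<epsilon>}"]) (use \<epsilon> const in auto)
  then have "mink (D 1 0 *v x) c = 0"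
    by (rule vector_derivative_unique_at) (rule has_vector_derivative_const)
  moreover have "g ** matrix_inv g = mat 1"
    using someI_ex[OF assms(3)[unfolded invertible_def]] unfolding matrix_inv_def by blast
  then have "g *v (matrix_inv g *v y) = y" for y
    by (simp only: matrix_vector_mul_assoc matrix_vector_mul_lid)
  then have "g *v X x = D 1 0 *v x"
    using X assms(4) by simp
  ultimately show "mink (g *v X x) c = 0"
    by simp
qed

context null_frame
begin

text \<open>The right side involves only \<open>mink\<close> and \<open>W\<close>, so isometries
  preserving \<open>W\<close> act on the plane by Euclidean isometries.\<close>

lemma dist_pos:
  assumes "x \<in> H3" "x' \<in> H3"
  shows "(dist (pos x) (pos x'))\<^sup>2 = - (1 / (W x)\<^sup>2) - 1 / (W x')\<^sup>2 - 2 * mink x x' / (W x * W x')"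
proof -
  have w: "W x > 0" "W x' > 0"
    using assms W_pos by blast+
  have "mink x x' / (W x * W x') = pos x \<bullet> pos x' - ht x - ht x'"
    using w by (simp add: mink_coords pos_def ht_def diff_divide_distrib)
  then have "2 * mink x x' / (W x * W x') = 2 * (pos x \<bullet> pos x') - 2 * ht x - 2 * ht x'"
    unfolding times_divide_eq_right[symmetric] by simp
  moreover have "2 * ht x = pos x \<bullet> pos x + 1 / (W x)\<^sup>2" "2 * ht x' = pos x' \<bullet> pos x' + 1 / (W x')\<^sup>2"
    using ht_eq[OF assms(1)] ht_eq[OF assms(2)] by (simp_all add: dot_square_norm)
  moreover have "(dist (pos x) (pos x'))\<^sup>2 = pos x \<bullet> pos x - 2 * (pos x \<bullet> pos x') + pos x' \<bullet> pos x'"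
    unfolding dist_norm power2_norm_eq_inner inner_diff_left inner_diff_right
    using inner_commute[of "pos x'" "pos x"] by linarith
  ultimately show ?thesis
    by linarith
qed

text \<open>
  \<open>G\<close> preserves \<open>W\<close>, so by cocompactness \<open>W\<close> is bounded on the horosphere centered at \<open>n\<close>; this
  forces \<open>n\<close> and \<open>c\<close> to represent the same ideal point.
\<close>

lemma cocompact_center:
  assumes n: "ideal_point n" "r > 0"
    and K: "compact K" "horosphere n r = (\<Union>g\<in>G. (*v) g ` K)" "K \<subseteq> horosphere n r"
    and G: "\<And>g x. g \<in> G \<Longrightarrow> x \<in> H3 \<Longrightarrow> W (g *v x) = W x"
  obtains l where "l > 0" "n = l *\<^sub>R c"
proof -
  obtain d' e1' e2' where "null_frame n d' e1' e2'"
    by (rule ex_null_frame[OF n(1)])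
  then interpret N: null_frame n d' e1' e2' .
  have "compact ((\<lambda>x. W x) ` K)"
    by (intro compact_continuous_image K(1) continuous_intros)
  then obtain C where C: "\<And>k. k \<in> K \<Longrightarrow> \<bar>W k\<bar> \<le> C"
    using compact_imp_bounded bounded_real by (metis (no_types, lifting) image_eqI)
  have bound: "\<bar>W x\<bar> \<le> C" if x: "x \<in> horosphere n r" for x
  proof -
    obtain g k where gk: "g \<in> G" "k \<in> K" "x = g *v k"
      using x unfolding K(2) by blast
    then have "k \<in> H3"
      using K(3) unfolding horosphere_def by blast
    then have "W x = W k"
      using G gk by simp
    then show ?thesis
      using C[OF gk(2)] by simp
  qed
  \<comment> \<open>Coordinates of \<open>c\<close> in the frame of \<open>n\<close>. Along a
    parabola on the horosphere, \<open>W\<close> is a quadratic polynomial in \<open>t\<close> with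
    leading coefficient \<open>a / (2 * r)\<close>.\<close>
  define a where "a = N.W c"
  define b where "b = N.S c"
  define e where "e = Re (N.Y c)"
  have Wt: "\<bar>t * e - (t\<^sup>2 + 1) / (2 * r) * a - r * b\<bar> \<le> C" for t :: real
  proof -
    define x where "x = N.vec (of_real t) ((t\<^sup>2 + 1) / (2 * r)) r"
    have "x \<in> H3"
    proof -
      have "2 * ((t\<^sup>2 + 1) / (2 * r)) * r = t\<^sup>2 + 1"
        using n(2) by simp
      moreover have "(norm (of_real t :: complex))\<^sup>2 = t\<^sup>2"
        by simp
      ultimately show ?thesis
        using n(2) unfolding N.H3_coords x_def N.coords_vec by linarith
    qed
    moreover have "mink x n = - r"
      using N.coords_vec(3)[of "of_real t" "(t\<^sup>2 + 1) / (2 * r)" r] by (simp add: x_def N.W_def)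
    ultimately have "\<bar>W x\<bar> \<le> C"
      by (intro bound) (simp add: horosphere_def)
    moreover have "W x = - (t * e - (t\<^sup>2 + 1) / (2 * r) * a - r * b)"
      unfolding W_def N.mink_coords by (simp add: x_def a_def b_def e_def inner_complex_def)
    ultimately show ?thesis
      by linarith
  qed
  have "a = 0"
  proof (rule ccontr)
    assume "a \<noteq> 0"
    \<comment> \<open>Taking both \<open>q\<close> and \<open>- q\<close> removes the linear term;
      with this value the bound reads \<open>q^2 + 1 \<le> q\<close>.\<close>
    define q where "q = r * (2 * C + 2 * r * \<bar>b\<bar>) / \<bar>a\<bar>"
    have "C \<ge> 0"
      using Wt[of 0] by linarith
    then have "q \<ge> 0"
      using n(2) by (simp add: q_def)
    define p where "p = (q\<^sup>2 + 1) / (2 * r) * a"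
    have "\<bar>q * e - p - r * b\<bar> \<le> C" "\<bar>- (q * e) - p - r * b\<bar> \<le> C"
      using Wt[of q] Wt[of "- q"] by (simp_all add: p_def)
    then have "2 * \<bar>p\<bar> \<le> 2 * C + 2 * \<bar>r * b\<bar>"
      by linarith
    then have "2 * \<bar>p\<bar> \<le> 2 * C + 2 * r * \<bar>b\<bar>"
      using n(2) by (simp add: abs_mult)
    moreover have "2 * \<bar>p\<bar> = (q\<^sup>2 + 1) / r * \<bar>a\<bar>"
      using n(2) by (simp add: p_def abs_mult)
    ultimately have "(q\<^sup>2 + 1) / r * \<bar>a\<bar> \<le> 2 * C + 2 * r * \<bar>b\<bar>"
      by simp
    then have "q\<^sup>2 + 1 \<le> q"
      using n(2) \<open>a \<noteq> 0\<close> by (simp add: q_def field_simps)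
    moreover have "0 \<le> (q - 1)\<^sup>2" "0 \<le> q\<^sup>2"
      by simp_all
    ultimately show False
      using \<open>q \<ge> 0\<close> unfolding power2_diff by simp
  qed
  \<comment> \<open>The null vectors \<open>n\<close> and \<open>c\<close> are now orthogonal, hence
    proportional.\<close>
  then have Wn: "W n = 0"
    by (simp add: a_def N.W_def W_def mink_commute)
  have "mink n n = 0"
    using n(1) by (simp add: ideal_point_def)
  then have "Y n = 0"
    using Wn by (simp add: mink_coords)
  then have n_eq: "n = S n *\<^sub>R c"
    using Wn by (intro coords_eqI) simp_all
  moreover have "S n > 0"
  proof -
    have "n$4 = S n * c$4"
      using arg_cong[OF n_eq, of "\<lambda>v. v$4"] by simp
    then show ?thesis
      using n(1) ideal by (simp add: ideal_point_def zero_less_mult_iff)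
  qed
  ultimately show thesis
    using that by blast
qed

lemma W_lift: "W (lift (y, s)) = 1 / sqrt (2 * s - (norm y)\<^sup>2)"
  by (simp add: lift_def)

text \<open>\<open>G\<close> acts on the plane by Euclidean isometries, and the translates of
  \<open>K\<close> project onto the whole plane. Carrying \<open>y\<close> back to \<open>K\<close>
  shows that the orbit of \<open>x\<close> comes within \<open>norm (pos x) + R\<close> of
  it.\<close>

lemma cocompact_dense:
  assumes act: "acts_freely_cocompactly G (horosphere n r)" "ideal_point n" "r > 0"
    and G: "\<And>g x. g \<in> G \<Longrightarrow> x \<in> H3 \<Longrightarrow> W (g *v x) = W x" "\<And>g. g \<in> G \<Longrightarrow> hyp_isometry g"
    and P: "P \<subseteq> H3" "\<And>g. g \<in> G \<Longrightarrow> (*v) g ` P = P" and x: "x \<in> P"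
  shows "\<exists>R. \<forall>y. \<exists>x'\<in>P. W x' = W x \<and> dist (pos x') y \<le> R"
proof -
  obtain K where K: "compact K" "K \<subseteq> horosphere n r" "horosphere n r = (\<Union>g\<in>G. (*v) g ` K)"
    using act(1) unfolding acts_freely_cocompactly_def by (elim exE conjE)
  obtain l where l: "l > 0" "n = l *\<^sub>R c"
    using cocompact_center[OF act(2,3) K(1,3,2) G(1)] by blast
  have KH: "K \<subseteq> H3"
    using K(2) by (auto simp: horosphere_def)
  have "continuous_on K chart"
    by (rule continuous_on_subset[OF continuous_on_chart KH])
  then have "compact (chart ` K)"
    by (rule compact_continuous_image) (rule K(1))
  then have "\<exists>R. \<forall>p\<in>chart ` K. norm p \<le> R"
    by (simp only: compact_imp_bounded flip: bounded_iff)
  then obtain R where R: "\<forall>p\<in>chart ` K. norm p \<le> R" ..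
  have R': "norm (pos k) \<le> R" if "k \<in> K" for k
  proof -
    have "norm (pos k) \<le> norm (chart k)"
      unfolding chart_def by (rule norm_fst_le)
    also have "\<dots> \<le> R"
      using R that by blast
    finally show ?thesis .
  qed
  have xH: "x \<in> H3"
    using x P(1) by blast
  have "\<exists>x'\<in>P. W x' = W x \<and> dist (pos x') y \<le> norm (pos x) + R" for y
  proof -
    \<comment> \<open>The horosphere is the level \<open>W = r / l\<close>, because
      \<open>n = l *\<^sub>R c\<close>; \<open>p\<close> is its point over \<open>y\<close>.\<close>
    define w where "w = r / l"
    have w: "w > 0"
      using l(1) act(3) by (simp add: w_def)
    define p where "p = (y, (norm y)\<^sup>2 / 2 + 1 / (2 * w\<^sup>2))"
    have p: "p \<in> region"
      using w by (simp add: p_def region_def)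
    have "W (lift p) = w"
      using w unfolding p_def W_lift by (simp add: real_sqrt_divide)
    then have "mink (lift p) n = - r"
      using l(1) by (simp add: l(2) mink_linear W_def w_def field_simps)
    then have "lift p \<in> horosphere n r"
      using lift_in_H3[OF p] by (simp add: horosphere_def)
    then obtain g k where gk: "g \<in> G" "k \<in> K" "lift p = g *v k"
      unfolding K(3) by blast
    have kH: "k \<in> H3"
      using gk(2) KH by blast
    have gH: "g *v x \<in> H3" "g *v k \<in> H3"
      using G(2)[OF gk(1)] xH kH unfolding hyp_isometry_def by blast+
    have "pos (g *v k) = y"
      using arg_cong[OF chart_lift[OF p], of fst] by (simp add: p_def flip: gk(3))
    moreover have "(dist (pos (g *v x)) (pos (g *v k)))\<^sup>2 = (dist (pos x) (pos k))\<^sup>2"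
      unfolding dist_pos[OF gH] dist_pos[OF xH kH]
      using G(1)[OF gk(1) xH] G(1)[OF gk(1) kH] hyp_isometry_mink[OF G(2)[OF gk(1)] xH kH] by simp
    then have "dist (pos (g *v x)) (pos (g *v k)) = dist (pos x) (pos k)"
      by (simp add: power2_eq_iff_nonneg)
    moreover have "dist (pos x) (pos k) \<le> norm (pos x) + R"
      using norm_triangle_ineq4[of "pos x" "pos k"] R'[OF gk(2)] by (simp add: dist_norm)
    moreover have "g *v x \<in> P"
      using P(2)[OF gk(1)] x by blast
    ultimately show ?thesis
      using G(1)[OF gk(1) xH] by (intro bexI[of _ "g *v x"]) simp_all
  qed
  then show ?thesis
    by blast
qed

end

theorem theoremB:
  fixes P :: "(real^4) set" and G :: "(real^4^4) set" and c :: "real^4"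
    and Z :: "real^4 \<Rightarrow> real^4"
  assumes "convex_parabolic_polyhedron P G"
    and "center_of G c"
    and "parabolic_deformation P G c Z"
  shows "trivial_deformation P Z"
proof (cases "hyp_boundary P = {}")
  case True
  have "killing_field ((*v) 0)"
    by (rule killing_field_skew_matrix) simp
  then show ?thesis
    unfolding trivial_deformation_def True by blast
next
  case False
  have ideal: "ideal_point c"
    using assms(2) by (simp add: center_of_def)
  obtain d e1 e2 where "null_frame c d e1 e2"
    by (rule ex_null_frame[OF ideal])
  then interpret null_frame c d e1 e2 .
  obtain S0 n r A where P: "P = hyp_convex hull S0" "S0 \<subseteq> H3"
    and G: "matrix_subgroup G" and n: "ideal_point n" "r > 0" "acts_freely_cocompactly G (horosphere n r)"
    and GP: "\<forall>g\<in>G. (*v) g ` P = P"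
    and A: "finite A" "hyp_vertices P = (\<Union>v\<in>A. (\<lambda>g. g *v v) ` G)"
    using assms(1) unfolding convex_parabolic_polyhedron_def by (elim exE conjE)
  have P_convex: "hyp_convex P" and PH: "P \<subseteq> H3"
    unfolding P(1) by (rule hyp_convex_hyp_hull[OF P(2)], rule hyp_convex_hull_subset[OF P(2)])
  have Iso: "hyp_isometry g" "invertible g" if "g \<in> G" for g
  proof -
    have "g \<in> Iso_plus"
      using G that unfolding matrix_subgroup_def by blast
    then show "hyp_isometry g" "invertible g"
      by (simp_all add: Iso_plus_def invertible_det_nz)
  qed
  obtain T K where T: "triangulation_of (hyp_boundary P) (hyp_vertices P) T"
    and K: "\<forall>\<sigma>\<in>T. killing_field (K \<sigma>)" and ZK: "\<forall>\<sigma>\<in>T. \<forall>x \<in> hyp_convex hull \<sigma>. Z x = K \<sigma> x"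
    using assms(3) unfolding parabolic_deformation_def inf_isometric_deformation_def by (elim exE conjE)
  have field: "\<exists>X. parabolic_killing_field c g X \<and> (\<forall>i\<in>hyp_vertices P. Z (g *v i) = g *v (Z i + X i))"
    if "g \<in> G" for g
    using assms(3) that unfolding parabolic_deformation_def by blast
  have GW: "W (g *v x) = W x" if g: "g \<in> G" and x: "x \<in> H3" for g x
  proof -
    obtain X where "parabolic_killing_field c g X"
      using field[OF g] by blast
    then show ?thesis
      using parabolic_killing_field_tangent(1)[OF _ ideal Iso(2)[OF g] x] by (simp add: W_def)
  qed
  \<comment> \<open>The vectors \<open>Z v\<close> are not points of \<open>H3\<close>, so
    invariance of \<open>W\<close> is extended to the ambient space by linearity.\<close>
  have GW': "W (g *v v) = W v" if g: "g \<in> G" for g v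
  proof -
    have "linear (\<lambda>v. W (g *v v) - W v)"
      by (rule linearI) (simp_all add: matrix_vector_right_distrib algebra_simps matrix_vector_mult_scaleR)
    then have "W (g *v v) - W v = 0"
      by (rule linear_eq_0_on_H3) (simp add: GW[OF g])
    then show ?thesis
      by simp
  qed
  have VH: "hyp_vertices P \<subseteq> H3"
    using PH by (auto simp: hyp_vertices_def)
  have one: "mat 1 \<in> G"
    using G by (simp add: matrix_subgroup_def)
  have AV: "A \<subseteq> hyp_vertices P"
  proof
    fix v assume "v \<in> A"
    then have "mat 1 *v v \<in> hyp_vertices P"
      unfolding A(2) using one by blast
    then show "v \<in> hyp_vertices P"
      by simp
  qed
  \<comment> \<open>The parabolic correction is tangent to the horospheres and contributes nothing
    to \<open>W\<close>, so the pairs of \<open>W i\<close> and \<open>W (Z i)\<close> are those of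
    the finite set \<open>A\<close>.\<close>
  have orbit: "\<exists>v\<in>A. W i = W v \<and> W (Z i) = W (Z v)" if i: "i \<in> hyp_vertices P" for i
  proof -
    obtain v g where v: "v \<in> A" "g \<in> G" "i = g *v v"
      using i unfolding A(2) by blast
    obtain X where X: "parabolic_killing_field c g X" "\<forall>i\<in>hyp_vertices P. Z (g *v i) = g *v (Z i + X i)"
      using field[OF v(2)] by blast
    have vP: "v \<in> hyp_vertices P" "v \<in> H3"
      using v(1) AV VH by blast+
    have "Z i = g *v Z v + g *v X v"
      using X(2) vP(1) v(3) by (simp add: matrix_vector_right_distrib)
    moreover have "W (g *v X v) = 0"
      using parabolic_killing_field_tangent(2)[OF X(1) ideal Iso(2)[OF v(2)] vP(2)] by (simp add: W_def)
    ultimately have "W (Z i) = W (Z v)"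
      by (simp add: GW'[OF v(2)])
    moreover have "W i = W v"
      by (simp add: v(3) GW'[OF v(2)])
    ultimately show ?thesis
      using v(1) by blast
  qed
  interpret chart_polyhedron c d e1 e2 P T
  proof
    show "hyp_convex P" "triangulation_of (hyp_boundary P) (hyp_vertices P) T" "hyp_boundary P \<noteq> {}"
      by fact+
    show "\<exists>R. \<forall>y. \<exists>x'\<in>P. W x' = W x \<and> dist (pos x') y \<le> R" if "x \<in> P" for x
      by (rule cocompact_dense[OF n(3,1,2) GW Iso(1) PH _ that]) (use GP in blast)+
    have "W i \<le> Max (W ` A)" if i: "i \<in> hyp_vertices P" for i
      using orbit[OF i] A(1) by (auto intro!: Max_ge)
    then show "\<exists>w. \<forall>v\<in>hyp_vertices P. W v \<le> w"
      by blast
  qed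
  have ZK': "Z x = K \<sigma> x" if "\<sigma> \<in> T" "x \<in> hyp_convex hull \<sigma>" for \<sigma> x
    using ZK that by blast
  have ZKv: "Z i = K \<sigma> i" if "\<sigma> \<in> T" "i \<in> \<sigma>" for \<sigma> i
    by (rule ZK'[OF that(1) hull_inc[OF that(2)]])
  have Z_mink: "mink (Z i) j + mink i (Z j) = 0" if s: "\<sigma> \<in> T" "i \<in> \<sigma>" "j \<in> \<sigma>" for \<sigma> i j
    unfolding ZKv[OF s(1,2)] ZKv[OF s(1,3)]
    by (rule killing_field_skew) (use K s triangles(1)[OF s(1)] in auto)
  have max: "\<exists>v\<in>hyp_vertices P. \<forall>w\<in>hyp_vertices P. W (Z w) / W w \<le> W (Z v) / W v"
  proof -
    define b where "b = (\<lambda>v. W (Z v) / W v)"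
    have "hyp_vertices P \<noteq> {}"
      using False unfolding boundary_eq vertices_eq
      using triangles(2) by fastforce
    then have "A \<noteq> {}"
      unfolding A(2) by blast
    then have "Max (b ` A) \<in> b ` A"
      using A(1) by (intro Max_in) auto
    then obtain v where v: "v \<in> A" "Max (b ` A) = b v"
      by blast
    have "b i \<le> b v" if i: "i \<in> hyp_vertices P" for i
    proof -
      obtain u where "u \<in> A" "b i = b u"
        using orbit[OF i] unfolding b_def by metis
      moreover have "b u \<le> Max (b ` A)"
        using A(1) \<open>u \<in> A\<close> by (intro Max_ge) auto
      ultimately show ?thesis
        by (simp add: v(2))
    qed
    then show ?thesis
      using v(1) AV unfolding b_def by blast
  qed
  have "\<exists>B. (\<forall>x y. mink (B *v x) y + mink x (B *v y) = 0) \<and> (\<forall>v\<in>hyp_vertices P. Z v = B *v v)"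
    by (rule infinitesimal_isometry_trivial[OF _ max]) (rule Z_mink)
  then obtain B where skew: "\<And>x y. mink (B *v x) y + mink x (B *v y) = 0"
    and ZB: "\<And>v. v \<in> hyp_vertices P \<Longrightarrow> Z v = B *v v"
    by blast
  have "Z x = B *v x" if x: "x \<in> hyp_boundary P" for x
  proof -
    obtain \<sigma> where s: "\<sigma> \<in> T" "x \<in> hyp_convex hull \<sigma>"
      using x unfolding boundary_eq by blast
    have kf: "killing_field (K \<sigma>)"
      using K s(1) by blast
    have xH: "x \<in> H3" and xs: "x \<in> span \<sigma>"
      using s(2) hyp_convex_hull_subset[OF triangles(1)[OF s(1)]]
        hyp_hull_subset_span[OF triangles(1)[OF s(1)]] by blast+
    \<comment> \<open>\<open>K \<sigma>\<close> is not given as a linear map. Skewness shifts it to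
      the test point \<open>y\<close>, leaving an expression linear in \<open>x\<close> that
      vanishes at the vertices and hence on \<open>span \<sigma>\<close>.\<close>
    have "K \<sigma> x = B *v x"
    proof (rule mink_nondegenerate)
      fix y assume y: "y \<in> H3"
      have "mink x (K \<sigma> y) + mink (B *v x) y = 0"
      proof (rule linear_eq_0_on_span[OF _ _ xs])
        show "linear (\<lambda>x. mink x (K \<sigma> y) + mink (B *v x) y)"
          by (rule linearI) (simp_all add: mink_linear matrix_vector_right_distrib matrix_vector_mult_scaleR algebra_simps)
        fix i assume i: "i \<in> \<sigma>"
        then have "K \<sigma> i = B *v i"
          using ZB[of i] ZKv[OF s(1) i] s(1) unfolding vertices_eq by auto
        moreover have "mink (K \<sigma> i) y + mink i (K \<sigma> y) = 0"
          using i triangles(1)[OF s(1)] by (intro killing_field_skew[OF kf _ y]) blast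
        ultimately show "mink i (K \<sigma> y) + mink (B *v i) y = 0"
          by simp
      qed
      then show "mink (K \<sigma> x) y = mink (B *v x) y"
        using killing_field_skew[OF kf xH y] by simp
    qed
    then show ?thesis
      using ZK'[OF s] by simp
  qed
  then show ?thesis
    unfolding trivial_deformation_def using killing_field_skew_matrix[OF skew] by blast
qed

end
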